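(* Suppose the marginal distribution function $F$ is continuous and let $p$ be the smallest integer satisfying $\max\left(2,\tau,\frac{\tau D}{1-\tau D}\right)<p\le \max\left(\frac{4-\tau D}{D},\frac{4-\tau D}{1-\tau D}\right)$. Put $\nu=\min(D,1-\tau D)/2$. Then for every sufficiently small $\varepsilon>0$, as $n\to\infty$, $$\sup_{0\le t\le 1}\sup_{0\le y\le 1}\left|R_n^*(y,t)-\left(V(y,nt)-V(\widehat U_{[nt]}(y),nt)\right)\right| = O\left(n^{1-\nu p/2-\tau D/4+\varepsilon}L^{\tau/2}(n)\right)\quad\text{a.s.}$$ where $R_n^*(y,t)=d_n(\alpha_n(y,t)-u_n(y,t))$.
   Context: $\{\eta_n\}_{n\ge1}$ is a stationary Gaussian sequence with $E\eta_1=0$, $E\eta_1^2=1$ and positive covariance function $\gamma(k)=E(\eta_1\eta_{k+1})$ such that $\gamma(k)=k^{-D}L(k)$ for large $k$, where $L$ is slowly varying at infinity. $G:\mathbb R\to\mathbb R$ is Borel measurable, $X_n=G(\eta_n)$, $F(x)=P(X_1\le x)$. $H_l(x)=(-1)^le^{x^2/2}\frac{d^l}{dx^l}e^{-x^2/2}$ is the $l$th Hermite polynomial, $c_l(x)=E\{[I(G(\eta)\le x)-F(x)]H_l(\eta)\}$ with $\eta$ standard normal, and $\tau=\min\{l\ge 1: c_l(x)\ne0\text{ for some }x\in\mathbb R\}$ (the Hermite rank). It is assumed that $0<D<1/\tau$. $d_n>0$ is given by $d_n^2=n^{2-\tau D}L^\tau(n)$; $[\cdot]$ is the integer part. $U_n=F(X_n)$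 (uniform on $[0,1]$ as $F$ is continuous), $J_l(y)=E\{[I(F(G(\eta))\le y)-y]H_l(\eta)\}$. For $[nt]\ge1$: $\widehat E_{[nt]}(y)=\frac1{[nt]}\sum_{i=1}^{[nt]}I(U_i\le y)$, $\widehat U_{[nt]}(y)=\inf\{s:\widehat E_{[nt]}(s)\ge y\}$ for $0<y\le1$, $\widehat U_{[nt]}(0)=\widehat U_{[nt]}(0+)$. For $0\le y,t\le 1$: $\alpha_n(y,t)=d_n^{-1}[nt](\widehat E_{[nt]}(y)-y)$, $u_n(y,t)=d_n^{-1}[nt](y-\widehat U_{[nt]}(y))$, $V(y,nt)=J_\tau(y)\sum_{i=1}^{[nt]}H_\tau(\eta_i)/\tau!$. When $[nt]=0$ all of these processes (and $V(\widehat U_{[nt]}(y),nt)$) are $0$. "$A_n=O(a_n)$ a.s." means that almost surely $\limsup_n|A_n|/a_n<\infty$. *)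

theory Defs
  imports "HOL-Probability.Probability"
begin

definition is_smallest :: "'a::linorder set \<Rightarrow> 'a \<Rightarrow> bool" where
  "is_smallest S x \<longleftrightarrow> x \<in> S \<and> (\<forall>y\<in>S. x \<le> y)"

text \<open>Positivity and measurability are only
  required on some half-line, as usual for functions that are slowly varying at infinity.\<close>

definition slowly_varying :: "(real \<Rightarrow> real) \<Rightarrow> bool" where
  "slowly_varying L \<longleftrightarrow>
     (\<exists>a. set_borel_measurable borel {a..} L \<and> (\<forall>x\<ge>a. 0 < L x)) \<and>
     (\<forall>c>0. ((\<lambda>x. L (c * x) / L x) \<longlongrightarrow> 1) at_top)"

text \<open>Point masses count as (degenerate) normal laws, so that linear combinations
  in a Gaussian sequence may degenerate.\<close>

definition gaussian_rv :: "'a measure \<Rightarrow> ('a \<Rightarrow> real) \<Rightarrow> bool" where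
  "gaussian_rv M X \<longleftrightarrow> X \<in> borel_measurable M \<and>
     ((\<exists>\<mu> \<sigma>. 0 < \<sigma> \<and> distributed M lborel X (normal_density \<mu> \<sigma>)) \<or>
      (\<exists>\<mu>. AE \<omega> in M. X \<omega> = \<mu>))"

text \<open>Sequences are indexed by the positive integers; the entry at index 0 is ignored.\<close>

definition gaussian_sequence :: "'a measure \<Rightarrow> (nat \<Rightarrow> 'a \<Rightarrow> real) \<Rightarrow> bool" where
  "gaussian_sequence M \<eta> \<longleftrightarrow>
     (\<forall>I a. finite I \<and> I \<subseteq> {1..} \<longrightarrow> gaussian_rv M (\<lambda>\<omega>. \<Sum>i\<in>I. a i * \<eta> i \<omega>))"

definition stationary_sequence :: "'a measure \<Rightarrow> (nat \<Rightarrow> 'a \<Rightarrow> real) \<Rightarrow> bool" where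
  "stationary_sequence M \<eta> \<longleftrightarrow>
     (\<forall>n\<ge>1. \<eta> n \<in> borel_measurable M) \<and>
     (\<forall>h. distr M (\<Pi>\<^sub>M n\<in>{1..}. borel) (\<lambda>\<omega>. \<lambda>n\<in>{1..}. \<eta> (n + h) \<omega>) =
          distr M (\<Pi>\<^sub>M n\<in>{1..}. borel) (\<lambda>\<omega>. \<lambda>n\<in>{1..}. \<eta> n \<omega>))"

definition hermite :: "nat \<Rightarrow> real \<Rightarrow> real" where
  "hermite l x = (-1) ^ l * exp (x\<^sup>2 / 2) * (deriv ^^ l) (\<lambda>z. exp (- z\<^sup>2 / 2)) x"

text \<open>In the next two definitions \<open>F\<close> is meant to be the distribution function of \<open>G(\<eta>)\<close>,
  \<open>\<eta>\<close> standard normal; the integration variable \<open>z\<close> is the value of \<open>\<eta>\<close>.\<close>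

definition c_coeff :: "(real \<Rightarrow> real) \<Rightarrow> (real \<Rightarrow> real) \<Rightarrow> nat \<Rightarrow> real \<Rightarrow> real" where
  "c_coeff F G l x = (\<integral>z. (of_bool (G z \<le> x) - F x) * hermite l z \<partial>std_normal_distribution)"

definition J_coeff :: "(real \<Rightarrow> real) \<Rightarrow> (real \<Rightarrow> real) \<Rightarrow> nat \<Rightarrow> real \<Rightarrow> real" where
  "J_coeff F G l y = (\<integral>z. (of_bool (F (G z) \<le> y) - y) * hermite l z \<partial>std_normal_distribution)"

definition is_hermite_rank :: "(real \<Rightarrow> real) \<Rightarrow> (real \<Rightarrow> real) \<Rightarrow> nat \<Rightarrow> bool" where
  "is_hermite_rank F G \<tau> \<longleftrightarrow> is_smallest {l. 1 \<le> l \<and> (\<exists>x. c_coeff F G l x \<noteq> 0)} \<tau>"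

text \<open>\<open>d\<^sub>n\<close>; it is positive as soon as \<open>n \<ge> 1\<close> and \<open>L n > 0\<close>, hence for all large \<open>n\<close>.\<close>

definition norming :: "real \<Rightarrow> (real \<Rightarrow> real) \<Rightarrow> nat \<Rightarrow> nat \<Rightarrow> real" where
  "norming D L \<tau> n = sqrt (real n powr (2 - real \<tau> * D) * L (real n) ^ \<tau>)"

text \<open>The integer part \<open>[n t]\<close>.\<close>

definition npart :: "nat \<Rightarrow> real \<Rightarrow> nat" where
  "npart n t = nat \<lfloor>real n * t\<rfloor>"

text \<open>The processes are defined pathwise, for real sequences \<open>u\<close> (a path of the \<open>U\<^sub>i\<close>)
  and \<open>e\<close> (a path of the \<open>\<eta>\<^sub>i\<close>). For \<open>[n t] = 0\<close> the processes \<open>emp_process\<close>, \<open>quant_process\<close>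
  and \<open>V_process\<close> vanish because of the factor \<open>[n t]\<close> or the empty sum.\<close>

definition emp_df :: "(nat \<Rightarrow> real) \<Rightarrow> nat \<Rightarrow> real \<Rightarrow> real" where
  "emp_df u m y = (\<Sum>i=1..m. of_bool (u i \<le> y)) / real m"

definition emp_quantile :: "(nat \<Rightarrow> real) \<Rightarrow> nat \<Rightarrow> real \<Rightarrow> real" where
  "emp_quantile u m y =
     (if y = 0 then Lim (at_right 0) (\<lambda>z. Inf {s. emp_df u m s \<ge> z})
      else Inf {s. emp_df u m s \<ge> y})"

definition emp_process ::
    "real \<Rightarrow> (real \<Rightarrow> real) \<Rightarrow> nat \<Rightarrow> (nat \<Rightarrow> real) \<Rightarrow> nat \<Rightarrow> real \<Rightarrow> real \<Rightarrow> real" where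
  "emp_process D L \<tau> u n y t =
     inverse (norming D L \<tau> n) * real (npart n t) * (emp_df u (npart n t) y - y)"

definition quant_process ::
    "real \<Rightarrow> (real \<Rightarrow> real) \<Rightarrow> nat \<Rightarrow> (nat \<Rightarrow> real) \<Rightarrow> nat \<Rightarrow> real \<Rightarrow> real \<Rightarrow> real" where
  "quant_process D L \<tau> u n y t =
     inverse (norming D L \<tau> n) * real (npart n t) * (y - emp_quantile u (npart n t) y)"

definition R_star ::
    "real \<Rightarrow> (real \<Rightarrow> real) \<Rightarrow> nat \<Rightarrow> (nat \<Rightarrow> real) \<Rightarrow> nat \<Rightarrow> real \<Rightarrow> real \<Rightarrow> real" where
  "R_star D L \<tau> u n y t =
     norming D L \<tau> n * (emp_process D L \<tau> u n y t - quant_process D L \<tau> u n y t)"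

text \<open>The last argument \<open>m\<close> of \<open>V_process\<close> stands for \<open>[n t]\<close>.\<close>

definition V_process ::
    "(real \<Rightarrow> real) \<Rightarrow> (nat \<Rightarrow> real) \<Rightarrow> nat \<Rightarrow> real \<Rightarrow> nat \<Rightarrow> real" where
  "V_process J e \<tau> y m = J y * (\<Sum>i=1..m. hermite \<tau> (e i)) / fact \<tau>"

definition bigo_as :: "'a measure \<Rightarrow> (nat \<Rightarrow> 'a \<Rightarrow> ereal) \<Rightarrow> (nat \<Rightarrow> real) \<Rightarrow> bool" where
  "bigo_as M A a \<longleftrightarrow> (AE \<omega> in M. limsup (\<lambda>n. \<bar>A n \<omega>\<bar> / ereal (a n)) < \<infinity>)"

end

theory Submission
  imports Defs "HOL-Real_Asymp.Real_Asymp"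
begin

text \<open>With \<open>m = [nt]\<close> and \<open>Q = \<widehat>U\<^sub>m(y)\<close>, the quantity to be bounded equals
  \<open>R(y, m) - R(Q, m) + m (E\<^sub>m(Q) - y)\<close>, where
  \<open>R(y, m) = \<Sum>\<^sub>i\<^sub>\<le>\<^sub>m (I(U\<^sub>i \<le> y) - y - J\<^sub>\<tau>(y) H\<^sub>\<tau>(\<eta>\<^sub>i) / \<tau>!)\<close>
  is the error of the reduction principle; it is therefore controlled by the supremum of \<open>|R|\<close>.
  The summands of \<open>R(y, m) - R(x, m)\<close> are orthogonal to \<open>H\<^sub>0, \<dots>, H\<^sub>\<tau>\<close>, so their
  covariances are at most \<open>\<gamma>(k)\<^sup>\<tau>\<^sup>+\<^sup>1 (y - x)\<close>. Since this is linear in \<open>y - x\<close>,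
  dyadic chaining in \<open>y\<close> and \<open>m\<close> loses only logarithms, and second moments already give
  \<open>sup |R(y, m)| = O(n\<^sup>\<theta>\<^sup>+\<^sup>\<epsilon>)\<close> almost surely with \<open>\<theta> = max (1/2) (1 - (\<tau> + 1) D / 2)\<close>.
  The choice of \<open>p\<close> makes \<open>\<theta> \<le> 1 - \<nu> p / 2 - \<tau> D / 4\<close>.\<close>

text \<open>The covariance bound rests on Mehler's expansion of \<open>E f(X) g(Y)\<close> in powers
  of the correlation \<open>\<rho>\<close>. It is verified on cosines, where both sides are explicit
  through the joint characteristic function; this admits \<open>\<rho> = 1\<close>, where the
  expansion is Parseval's identity. Only the resulting inequality is extended, by density, to square
  integrable functions. Positivity of \<open>\<gamma>\<close> matters because for
  \<open>f = g\<close> all terms are then nonnegative, so that every power beyond the rank can be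
  replaced by the lowest one. The two values in \<open>\<theta>\<close> reflect whether
  \<open>\<gamma>(k)^(\<tau> + 1)\<close> is summable: a sum of \<open>n\<close> residuals has
  variance about \<open>n\<close> times the partial sum of these powers. Chaining reaches only grid
  points. Between them the indicator is monotone and \<open>J_coeff\<close> is Hoelder continuous of
  order \<open>1/2\<close>, so a mesh of order \<open>n^(-2)\<close> suffices. Slow variation is
  given as a limit for each fixed factor. The comparison of \<open>L\<close> with small powers
  therefore needs the uniform convergence theorem.\<close>

section \<open>Slowly varying functions\<close>

text \<open>Pointwise convergence makes these sets increase to \<open>{0..2}\<close>, so their
  measures tend to 2. The threshold \<open>8/5\<close> could be any number between
  \<open>3/2\<close> and 2: two sets of measure above \<open>3/2\<close> in an interval of length 3
  intersect.\<close>

lemma large_set_of_small_increments: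
  fixes h :: "real \<Rightarrow> real" and z :: "nat \<Rightarrow> real"
  assumes h [measurable]: "h \<in> borel_measurable borel"
    and conv: "\<And>u. ((\<lambda>x. h (x + u) - h x) \<longlongrightarrow> 0) at_top"
    and z: "filterlim z at_top sequentially" and "0 < e"
  shows "\<forall>\<^sub>F n in sequentially. {v \<in> {0..2}. \<forall>m\<ge>n. \<bar>h (z m + v) - h (z m)\<bar> \<le> e} \<in> lmeasurable \<and>
     measure lebesgue {v \<in> {0..2}. \<forall>m\<ge>n. \<bar>h (z m + v) - h (z m)\<bar> \<le> e} > 8/5"
proof -
  define V where "V n = {v \<in> {0..2}. \<forall>m\<ge>n. \<bar>h (z m + v) - h (z m)\<bar> \<le> e}" for n
  have V_meas: "V n \<in> sets lebesgue" for n
  proof -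
    have "{v. 0 \<le> v \<and> v \<le> 2 \<and> (\<forall>m. n \<le> m \<longrightarrow> \<bar>h (z m + v) - h (z m)\<bar> \<le> e)} \<in> sets borel"
      by measurable
    then show ?thesis
      unfolding V_def by (simp add: conj_assoc)
  qed
  have V_sub: "V n \<subseteq> {0..2}" for n
    by (auto simp: V_def)
  have V_lm: "V n \<in> lmeasurable" for n
    by (rule fmeasurableI2[OF _ V_sub V_meas]) auto
  have inc: "incseq V"
    by (auto simp: incseq_def V_def)
  have UN: "(\<Union>n. V n) = {0..2}"
  proof (rule antisym)
    show "{0..2} \<subseteq> (\<Union>n. V n)"
    proof
      fix v :: real assume v: "v \<in> {0..2}"
      have "(\<lambda>m. h (z m + v) - h (z m)) \<longlonglongrightarrow> 0"
        using filterlim_compose[OF conv z] .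
      then have "\<forall>\<^sub>F m in sequentially. dist (h (z m + v) - h (z m)) 0 < e"
        using \<open>0 < e\<close> by (rule tendstoD)
      then obtain n where "\<forall>m\<ge>n. dist (h (z m + v) - h (z m)) 0 < e"
        by (auto simp: eventually_sequentially)
      then show "v \<in> (\<Union>n. V n)"
        using v by (auto simp: V_def dist_real_def intro!: exI[of _ n] less_imp_le)
    qed
  qed (use V_sub in auto)
  have "(\<lambda>n. measure lebesgue (V n)) \<longlonglongrightarrow> measure lebesgue (\<Union>n. V n)"
    by (rule Lim_measure_incseq) (use V_meas inc UN in auto)
  then have "(\<lambda>n. measure lebesgue (V n)) \<longlonglongrightarrow> 2"
    by (simp add: UN)
  then have "\<forall>\<^sub>F n in sequentially. measure lebesgue (V n) > 8/5"
    by (rule order_tendstoD) simp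
  then show ?thesis
    using V_lm by (simp add: V_def)
qed

text \<open>Restricting the argument to a sequence keeps the sets of good increments measurable;
  in an interval of length 3, a translate of one such set must meet the other.\<close>

lemma uniform_small_increments:
  fixes h :: "real \<Rightarrow> real"
  assumes h: "h \<in> borel_measurable borel"
    and conv: "\<And>u. ((\<lambda>x. h (x + u) - h x) \<longlongrightarrow> 0) at_top"
    and "0 < e"
  shows "\<exists>X. \<forall>x\<ge>X. \<forall>u\<in>{0..1}. \<bar>h (x + u) - h x\<bar> \<le> e"
proof (rule ccontr)
  assume "\<not> ?thesis"
  then have "\<forall>n::nat. \<exists>x u. x \<ge> real n \<and> u \<in> {0..1} \<and> \<bar>h (x + u) - h x\<bar> > e"
    by (metis linorder_not_le)
  then obtain x u where x: "\<And>n. x n \<ge> real n" and u: "\<And>n. u n \<in> {0..1::real}"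
    and bad: "\<And>n. \<bar>h (x n + u n) - h (x n)\<bar> > e"
    by metis
  have lim1: "filterlim x at_top sequentially"
    by (rule filterlim_at_top_mono[OF filterlim_real_sequentially]) (use x in auto)
  have lim2: "filterlim (\<lambda>n. x n + u n) at_top sequentially"
    by (rule filterlim_at_top_mono[OF filterlim_real_sequentially])
      (use x u in \<open>auto simp: add_increasing2\<close>)
  define V where "V n = {v \<in> {0..2}. \<forall>m\<ge>n. \<bar>h (x m + v) - h (x m)\<bar> \<le> e/2}" for n
  define W where "W n = {v \<in> {0..2}. \<forall>m\<ge>n. \<bar>h (x m + u m + v) - h (x m + u m)\<bar> \<le> e/2}" for n
  have e2: "0 < e / 2"
    using \<open>0 < e\<close> by simp
  from eventually_conj[OF large_set_of_small_increments[OF h conv lim1 e2]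
      large_set_of_small_increments[OF h conv lim2 e2], folded V_def W_def]
  obtain n where V: "V n \<in> lmeasurable" "measure lebesgue (V n) > 8/5"
    and W: "W n \<in> lmeasurable" "measure lebesgue (W n) > 8/5"
    using eventually_happens'[OF sequentially_bot] by blast
  \<comment> \<open>After the shift by \<open>u n\<close> both sets describe displacements from
    \<open>x n\<close>, and both lie in \<open>{0..3}\<close>.\<close>
  define W' where "W' = (+) (u n) ` W n"
  have W': "W' \<in> lmeasurable" "measure lebesgue W' > 8/5"
    unfolding W'_def using W measurable_translation by (blast, simp only: measure_translation)
  have "V n \<inter> W' \<noteq> {}"
  proof
    assume disj: "V n \<inter> W' = {}"
    have "measure lebesgue (V n \<union> W') = measure lebesgue (V n) + measure lebesgue W'"
      using measure_Un3[OF V(1) W'(1)] disj by simp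
    moreover have "measure lebesgue (V n \<union> W') \<le> measure lebesgue {0..3::real}"
    proof (rule measure_mono_fmeasurable)
      show "V n \<union> W' \<subseteq> {0..3}"
        using u[of n] by (auto simp: V_def W_def W'_def)
    qed (use V W' in \<open>auto simp: fmeasurableD\<close>)
    ultimately show False
      using V W' by simp
  qed
  \<comment> \<open>At the common point, \<open>h (x n + u n + w)\<close> is within
    \<open>e/2\<close> of both \<open>h (x n + u n)\<close> and \<open>h (x n)\<close>, which
    contradicts \<open>bad\<close>.\<close>
  then obtain w where w: "w \<in> W n" "u n + w \<in> V n"
    by (auto simp: W'_def)
  have "\<bar>h (x n + u n + w) - h (x n + u n)\<bar> \<le> e/2" "\<bar>h (x n + (u n + w)) - h (x n)\<bar> \<le> e/2"
    using w by (auto simp: V_def W_def)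
  then have "\<bar>h (x n + u n) - h (x n)\<bar> \<le> e"
    unfolding add.assoc by linarith
  with bad[of n] show False
    by simp
qed

text \<open>Unit steps are added up; the incomplete last step accounts for the extra 1.\<close>

lemma small_increments_sublinear:
  fixes h :: "real \<Rightarrow> real"
  assumes X: "\<And>x u. x \<ge> X \<Longrightarrow> u \<in> {0..1} \<Longrightarrow> \<bar>h (x + u) - h x\<bar> \<le> e" and "x \<ge> X" "0 \<le> e"
  shows "\<bar>h x - h X\<bar> \<le> e * (x - X + 1)"
proof -
  have step: "\<bar>h (X + real n) - h X\<bar> \<le> e * real n" for n
  proof (induction n)
    case (Suc n)
    then show ?case
      using X[of "X + real n" 1] by (auto simp: algebra_simps abs_le_iff)
  qed simp
  define n where "n = nat \<lfloor>x - X\<rfloor>"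
  have n: "real n \<le> x - X" "x - X - real n \<in> {0..1}"
    using \<open>x \<ge> X\<close> by (auto simp: n_def)  linarith
  have "\<bar>h (X + real n + (x - X - real n)) - h (X + real n)\<bar> \<le> e"
    by (rule X) (use n in auto)
  then have "\<bar>h x - h X\<bar> \<le> e * real n + e"
    using step[of n] by (simp add: abs_le_iff) 
  also have "\<dots> \<le> e * (x - X) + e"
    using n \<open>0 \<le> e\<close> by (intro add_right_mono mult_left_mono)
  finally show ?thesis
    by (simp add: algebra_simps)
qed

text \<open>A weak form of Potter's bounds. In logarithmic coordinates,
  \<open>h x = ln (L (exp x))\<close>, slow variation says that increments of \<open>h\<close>
  vanish at infinity. Being uniform over steps of length at most 1, this makes \<open>h\<close> grow
  slower than any linear function, and linear functions are powers of \<open>x\<close> in these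
  coordinates.\<close>

lemma slowly_varying_bounds:
  assumes L: "slowly_varying L" and "0 < e"
  shows "\<forall>\<^sub>F x in at_top. x powr (-e) \<le> L x \<and> L x \<le> x powr e"
proof -
  obtain a where meas: "set_borel_measurable borel {a..} L" and pos: "\<And>x. x \<ge> a \<Longrightarrow> 0 < L x"
    and lim: "\<And>c. c > 0 \<Longrightarrow> ((\<lambda>x. L (c * x) / L x) \<longlongrightarrow> 1) at_top"
    using L unfolding slowly_varying_def by blast
  \<comment> \<open>Cutting \<open>L\<close> off below \<open>a\<close> gives a Borel function on
    the whole line with the same behaviour at infinity.\<close>
  define l where "l x = indicator {a..} x *\<^sub>R L x" for x
  have l [measurable]: "l \<in> borel_measurable borel"
    using meas unfolding set_borel_measurable_def l_def by simp
  have l_eq: "l x = L x" if "x \<ge> a" for x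
    using that by (simp add: l_def)
  define h where "h x = ln (l (exp x))" for x
  have h: "h \<in> borel_measurable borel"
    unfolding h_def by measurable
  have conv: "((\<lambda>x. h (x + u) - h x) \<longlongrightarrow> 0) at_top" for u
  proof (rule Lim_transform_eventually)
    have "((\<lambda>x. ln (L (exp u * exp x) / L (exp x))) \<longlongrightarrow> ln 1) at_top"
      by (rule tendsto_ln[OF filterlim_compose[OF lim exp_at_top]]) simp_all
    then show "((\<lambda>x. ln (L (exp u * exp x) / L (exp x))) \<longlongrightarrow> 0) at_top"
      by simp
    have ev: "\<forall>\<^sub>F x in at_top. exp x \<ge> a" "\<forall>\<^sub>F x in at_top. exp x \<ge> a / exp u"
      using exp_at_top by (auto simp: filterlim_at_top)
    then show "\<forall>\<^sub>F x in at_top. ln (L (exp u * exp x) / L (exp x)) = h (x + u) - h x"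
    proof eventually_elim
      case (elim x)
      then have "exp u * exp x \<ge> a"
        by (simp add: field_simps)
      then show ?case
        using elim pos[of "exp x"] pos[of "exp u * exp x"]
        by (simp add: h_def l_eq exp_add mult.commute ln_div)
    qed
  qed
  have "0 < e / 2"
    using \<open>0 < e\<close> by simp
  from uniform_small_increments[OF h conv this]
  obtain X where X: "\<And>x u. x \<ge> X \<Longrightarrow> u \<in> {0..1} \<Longrightarrow> \<bar>h (x + u) - h x\<bar> \<le> e / 2"
    by blast
  \<comment> \<open>\<open>B\<close> collects what does not grow; one half of \<open>e\<close> is
    reserved for absorbing it.\<close>
  define B where "B = \<bar>h X\<bar> + e / 2 * (1 + \<bar>X\<bar>)"
  have "\<forall>\<^sub>F x in at_top. ln x \<ge> max X (2 / e * B)"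
    using ln_at_top by (simp only: filterlim_at_top)
  moreover have "\<forall>\<^sub>F x::real in at_top. x \<ge> max a 1"
    by (rule eventually_ge_at_top)
  ultimately show ?thesis
  proof eventually_elim
    case (elim x)
    have "\<bar>h (ln x) - h X\<bar> \<le> e / 2 * (ln x - X + 1)"
      using elim \<open>0 < e\<close> by (intro small_increments_sublinear[OF X]) auto
    also have "\<dots> \<le> e / 2 * (ln x + \<bar>X\<bar> + 1)"
      using \<open>0 < e\<close> by (intro mult_left_mono) auto
    finally have "\<bar>h (ln x)\<bar> \<le> e / 2 * ln x + B"
      unfolding B_def distrib_left mult_1_right by linarith
    also have "B \<le> e / 2 * ln x"
      using elim \<open>0 < e\<close> by (simp add: field_simps)
    finally have *: "\<bar>ln (L x)\<bar> \<le> e * ln x"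
      using elim by (simp add: h_def l_eq)
    have Lx: "L x > 0" "x > 0"
      using elim pos by auto
    have "exp (- (e * ln x)) \<le> exp (ln (L x))" "exp (ln (L x)) \<le> exp (e * ln x)"
      using * by auto
    then show ?case
      using Lx by (simp add: powr_def)
  qed
qed

section \<open>Dyadic chaining\<close>

text \<open>Cauchy-Schwarz with weights \<open>c\<close> and 1. If \<open>c\<close> is the constant
  accumulated so far, one more link of a chain increases it only by 1.\<close>

lemma power2_add_le_weighted:
  fixes a b c :: real
  assumes "c > 0"
  shows "(a + b)\<^sup>2 \<le> (c + 1) * (a\<^sup>2 / c + b\<^sup>2)"
proof -
  have "(c + 1) * (a\<^sup>2 / c + b\<^sup>2) - (a + b)\<^sup>2 = (a - c * b)\<^sup>2 / c"
    using assms by (simp add: field_simps power2_eq_square)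
  also have "\<dots> \<ge> 0"
    using assms by simp
  finally show ?thesis
    by simp
qed

text \<open>A sum over all dyadic intervals stands in for the maximum over chains, because second
  moments control its expectation.\<close>

definition dyadic_sq :: "nat \<Rightarrow> (nat \<Rightarrow> real) \<Rightarrow> real" where
  "dyadic_sq K h = (\<Sum>r\<le>K. \<Sum>a<2 ^ (K - r). (h (Suc a * 2 ^ r) - h (a * 2 ^ r))\<^sup>2)"

lemma dyadic_sq_nonneg: "0 \<le> dyadic_sq K h"
  unfolding dyadic_sq_def by (intro sum_nonneg) simp

text \<open>Removing the unit steps leaves the same quantity for the path sampled at even
  times.\<close>

lemma dyadic_sq_Suc:
  "dyadic_sq (Suc K) h = (\<Sum>a<2 ^ Suc K. (h (Suc a) - h a)\<^sup>2) + dyadic_sq K (\<lambda>j. h (2 * j))"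
  unfolding dyadic_sq_def sum.atMost_Suc_shift
  by (simp add: mult.left_commute mult.assoc del: mult_Suc)

text \<open>Every \<open>j \<le> 2\<^sup>K\<close> is reached from \<open>0\<close> by at most one dyadic step of each size.\<close>

lemma dyadic_chaining:
  assumes "j \<le> 2 ^ K"
  shows "(h j - h 0)\<^sup>2 \<le> (real K + 1) * dyadic_sq K h"
  using assms
proof (induction K arbitrary: h j)
  case 0
  then have "j = 0 \<or> j = 1"
    by auto
  then show ?case
    by (auto simp: dyadic_sq_def)
next
  case (Suc K)
  define i where "i = j div 2"
  have i: "i \<le> 2 ^ K"
    using Suc.prems by (simp add: i_def)
  have IH: "(h (2 * i) - h 0)\<^sup>2 \<le> (real K + 1) * dyadic_sq K (\<lambda>j. h (2 * j))"
    using Suc.IH[OF i, of "\<lambda>j. h (2 * j)"] by simp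
  have last: "(h j - h (2 * i))\<^sup>2 \<le> (\<Sum>a<2 ^ Suc K. (h (Suc a) - h a)\<^sup>2)"
  proof (cases "even j")
    case True
    then have "h j - h (2 * i) = 0"
      by (simp add: i_def)
    then show ?thesis
      by (simp add: sum_nonneg)
  next
    case False
    then have j: "j = Suc (2 * i)"
      by (simp add: i_def)
    have "j \<noteq> 2 ^ Suc K"
      using False by auto
    then have "2 * i < 2 ^ Suc K"
      using Suc.prems j by linarith
    then show ?thesis
      unfolding j by (intro member_le_sum) auto
  qed
  have "(h j - h 0)\<^sup>2 = ((h (2 * i) - h 0) + (h j - h (2 * i)))\<^sup>2"
    by simp
  \<comment> \<open>The weight \<open>K + 1\<close> cancels the factor in \<open>IH\<close>, so the
    constant grows by 1 per level instead of doubling.\<close>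
  also have "\<dots> \<le> (real K + 1 + 1) * ((h (2 * i) - h 0)\<^sup>2 / (real K + 1) + (h j - h (2 * i))\<^sup>2)"
    by (rule power2_add_le_weighted) simp
  also have "\<dots> \<le> (real K + 1 + 1) * (dyadic_sq K (\<lambda>j. h (2 * j)) + (\<Sum>a<2 ^ Suc K. (h (Suc a) - h a)\<^sup>2))"
    using IH last by (intro mult_left_mono add_mono) (auto simp: field_simps)
  finally show ?case
    by (simp add: dyadic_sq_Suc add.commute add.left_commute)
qed

text \<open>The chain in \<open>j\<close> is formed at fixed \<open>m\<close>; each of its
  increments is a path in \<open>m\<close> that starts at 0 by \<open>g0\<close> and is chained in
  turn.\<close>

lemma dyadic_chaining_2d:
  fixes g :: "nat \<Rightarrow> nat \<Rightarrow> real"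
  assumes "j \<le> 2 ^ K" "m \<le> 2 ^ k" and g0: "\<And>j. g j 0 = 0"
  shows "(g j m - g 0 m)\<^sup>2 \<le> (real K + 1) * (real k + 1) *
    (\<Sum>r\<le>K. \<Sum>a<2 ^ (K - r). dyadic_sq k (\<lambda>m. g (Suc a * 2 ^ r) m - g (a * 2 ^ r) m))"
proof -
  have "(g j m - g 0 m)\<^sup>2 \<le> (real K + 1) * dyadic_sq K (\<lambda>j. g j m)"
    using dyadic_chaining[OF assms(1), of "\<lambda>j. g j m"] .
  also have "\<dots> \<le> (real K + 1) * (\<Sum>r\<le>K. \<Sum>a<2 ^ (K - r).
      (real k + 1) * dyadic_sq k (\<lambda>m. g (Suc a * 2 ^ r) m - g (a * 2 ^ r) m))"
    unfolding dyadic_sq_def[of K]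
  proof (intro mult_left_mono sum_mono)
    fix r a
    show "(g (Suc a * 2 ^ r) m - g (a * 2 ^ r) m)\<^sup>2
      \<le> (real k + 1) * dyadic_sq k (\<lambda>m. g (Suc a * 2 ^ r) m - g (a * 2 ^ r) m)"
      using dyadic_chaining[OF assms(2), of "\<lambda>m. g (Suc a * 2 ^ r) m - g (a * 2 ^ r) m"]
      by (simp add: g0)
  qed simp
  finally show ?thesis
    by (simp add: sum_distrib_left mult.assoc)
qed

section \<open>Hermite polynomials and the Stein identity\<close>

text \<open>The recurrence that results from differentiating a polynomial times
  \<open>exp (- z\<^sup>2 / 2)\<close>, with the alternating sign taken out.\<close>

fun hermite_poly :: "nat \<Rightarrow> real poly" where
  "hermite_poly 0 = 1"
| "hermite_poly (Suc l) = [:0, 1:] * hermite_poly l - pderiv (hermite_poly l)"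

lemma hermite_eq_poly: "hermite l x = poly (hermite_poly l) x"
proof -
  have "(deriv ^^ l) (\<lambda>z. exp (- z\<^sup>2 / 2)) = (\<lambda>z. (-1) ^ l * poly (hermite_poly l) z * exp (- z\<^sup>2 / 2))"
  proof (induction l)
    case (Suc l)
    have "((\<lambda>z. (-1) ^ l * poly (hermite_poly l) z * exp (- z\<^sup>2 / 2)) has_real_derivative
        (-1) ^ Suc l * poly (hermite_poly (Suc l)) z * exp (- z\<^sup>2 / 2)) (at z)" for z
      by (auto intro!: derivative_eq_intros poly_DERIV simp: algebra_simps)
    from DERIV_imp_deriv[OF this] show ?case
      by (simp only: funpow.simps o_apply Suc)
  qed simp
  moreover have "exp (x\<^sup>2 / 2) * exp (- x\<^sup>2 / 2) = 1" "(-1) ^ l * (-1) ^ l = (1::real)"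
    by (simp_all flip: exp_add power_mult_distrib)
  ultimately show ?thesis
    unfolding hermite_def by (simp only:) (simp add: algebra_simps)
qed

lemma borel_measurable_hermite [measurable]: "hermite l \<in> borel_measurable borel"
  unfolding hermite_eq_poly[abs_def] by (intro borel_measurable_continuous_onI continuous_intros)

lemma degree_hermite_poly: "degree (hermite_poly l) = l \<and> lead_coeff (hermite_poly l) = 1"
proof (induction l)
  case (Suc l)
  then have nz: "hermite_poly l \<noteq> 0"
    by auto
  have deg: "degree ([:0, 1:] * hermite_poly l) = Suc l"
    using Suc nz by (simp add: degree_mult_eq)
  moreover have "degree (pderiv (hermite_poly l)) < Suc l"
    using Suc by (simp add: degree_pderiv)
  ultimately have "degree (hermite_poly (Suc l)) = Suc l"
    using degree_add_eq_left[of "- pderiv (hermite_poly l)" "[:0, 1:] * hermite_poly l"] by simp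
  moreover have "coeff (hermite_poly (Suc l)) (Suc l) = 1"
  proof -
    have "coeff (hermite_poly l) l = 1"
      using Suc by metis
    then show ?thesis
      using \<open>degree (pderiv (hermite_poly l)) < Suc l\<close> by (simp add: coeff_eq_0)
  qed
  ultimately show ?case
    by simp
qed simp

lemma prob_space_std_normal: "prob_space std_normal_distribution"
  using real_dist_normal_dist by (simp add: real_distribution_def)

lemma integrable_std_normal_poly: "integrable std_normal_distribution (poly p)"
  unfolding poly_altdef[abs_def]
  by (intro Bochner_Integration.integrable_sum integrable_mult_right integrable_std_normal_distribution_moment)

lemma integrable_std_normal_poly_cos:
  "integrable std_normal_distribution (\<lambda>x. poly p x * cos (s * x + \<theta>))"
proof (rule Bochner_Integration.integrable_bound[OF integrable_std_normal_poly[of p]])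
  show "(\<lambda>x. poly p x * cos (s * x + \<theta>)) \<in> borel_measurable std_normal_distribution"
    by (simp, intro borel_measurable_continuous_onI continuous_intros)
  show "AE x in std_normal_distribution. norm (poly p x * cos (s * x + \<theta>)) \<le> norm (poly p x)"
    by (auto simp: abs_mult mult_left_le)
qed

lemma poly_times_std_normal_tendsto_0:
  fixes p :: "real poly"
  assumes F: "F = at_top \<or> F = at_bot"
  shows "((\<lambda>x. poly p x * std_normal_density x) \<longlongrightarrow> 0) F"
proof -
  have "((\<lambda>x::real. x ^ i * exp (- x\<^sup>2 / 2)) \<longlongrightarrow> 0) F" for i
  proof -
    have top: "((\<lambda>x::real. x ^ i * exp (- x\<^sup>2 / 2)) \<longlongrightarrow> 0) at_top"
      by real_asymp
    have "((\<lambda>x::real. (-1) ^ i * (x ^ i * exp (- x\<^sup>2 / 2))) \<longlongrightarrow> 0) at_top"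
      by real_asymp
    moreover have "(\<lambda>x. (- x) ^ i * exp (- (- x)\<^sup>2 / 2)) = (\<lambda>x::real. (-1) ^ i * (x ^ i * exp (- x\<^sup>2 / 2)))"
      by (subst power_minus) (simp add: mult.assoc)
    ultimately have bot: "((\<lambda>x::real. x ^ i * exp (- x\<^sup>2 / 2)) \<longlongrightarrow> 0) at_bot"
      by (simp only: filterlim_at_bot_mirror)
    show ?thesis
      using F by (elim disjE) (simp_all only: top bot)
  qed
  then have "((\<lambda>x. 1 / sqrt (2 * pi) * (\<Sum>i\<le>degree p. coeff p i * (x ^ i * exp (- x\<^sup>2 / 2)))) \<longlongrightarrow> 
     1 / sqrt (2 * pi) * (\<Sum>i\<le>degree p. coeff p i * 0)) F"
    by (intro tendsto_intros)
  then show ?thesis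
    by (simp add: poly_altdef std_normal_density_def sum_distrib_left sum_distrib_right mult_ac sum_divide_distrib)
qed

text \<open>Integration by parts against the normal density. The test functions include plain
  polynomials (\<open>s = 0\<close>, \<open>\<theta> = 0\<close>), which serve for orthogonality,
  and cosines, whose Hermite coefficients are needed for the expansion.\<close>

lemma stein_identity:
  "(\<integral>x. x * (poly p x * cos (s * x + \<theta>)) \<partial>std_normal_distribution) =
   (\<integral>x. poly (pderiv p) x * cos (s * x + \<theta>) + s * poly p x * cos (s * x + (\<theta> + pi / 2)) \<partial>std_normal_distribution)"
proof -
  define f where "f x = std_normal_density x * (poly (pderiv p) x * cos (s * x + \<theta>) +
    s * poly p x * cos (s * x + (\<theta> + pi / 2)) - x * (poly p x * cos (s * x + \<theta>)))" for x
  define F where "F x = std_normal_density x * (poly p x * cos (s * x + \<theta>))" for x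
  have i1: "integrable std_normal_distribution (\<lambda>x. x * (poly p x * cos (s * x + \<theta>)))"
    using integrable_std_normal_poly_cos[of "[:0,1:] * p" s \<theta>] by (simp add: mult_ac)
  have i2: "integrable std_normal_distribution (\<lambda>x. poly (pderiv p) x * cos (s * x + \<theta>) +
       s * poly p x * cos (s * x + (\<theta> + pi / 2)))"
    using integrable_std_normal_poly_cos[of p s "\<theta> + pi / 2"]
    by (intro Bochner_Integration.integrable_add integrable_std_normal_poly_cos)
       (simp add: mult.assoc)
  have f_int: "integrable lborel f"
    using Bochner_Integration.integrable_diff[OF i2 i1] unfolding f_def
    by (subst (asm) integrable_density) (auto intro!: borel_measurable_continuous_onI continuous_intros)
  have lim: "(F \<longlongrightarrow> 0) A" if "A = at_top \<or> A = at_bot" for A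
  proof (rule Lim_null_comparison[OF _ tendsto_rabs_zero[OF poly_times_std_normal_tendsto_0[OF that, of p]]])
    show "\<forall>\<^sub>F x in A. norm (F x) \<le> \<bar>poly p x * std_normal_density x\<bar>"
      using mult_left_le[OF abs_cos_le_one abs_ge_zero]
      by (intro always_eventually allI) (simp add: F_def abs_mult mult_ac mult_left_mono)
  qed
  have "(LBINT x=-\<infinity>..\<infinity>. f x) = 0 - 0"
  proof (rule interval_integral_FTC_integrable[where F = F])
    fix x :: real
    have "(F has_real_derivative f x) (at x)"
    proof -
      have "(std_normal_density has_real_derivative - x * std_normal_density x) (at x)"
      proof -
        have "((\<lambda>x. c * exp (- x\<^sup>2 / 2)) has_real_derivative - x * (c * exp (- x\<^sup>2 / 2))) (at x)" for c
          by (auto intro!: derivative_eq_intros)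
        then show ?thesis
          unfolding std_normal_density_def .
      qed
      moreover have "cos (s * x + (\<theta> + pi / 2)) = - sin (s * x + \<theta>)"
        by (simp add: minus_sin_cos_eq add.assoc)
      ultimately show ?thesis
        unfolding F_def f_def by (auto intro!: derivative_eq_intros poly_DERIV simp: algebra_simps)
    qed
    then show "(F has_vector_derivative f x) (at x)"
      by (simp add: has_real_derivative_iff_has_vector_derivative)
    show "isCont f x"
      unfolding f_def std_normal_density_def by (intro continuous_intros) auto
  next
    show "set_integrable lborel (einterval (-\<infinity>) \<infinity>) f"
      using f_int by (simp add: set_integrable_def)
    show "((F \<circ> real_of_ereal) \<longlongrightarrow> 0) (at_right (-\<infinity>))" "((F \<circ> real_of_ereal) \<longlongrightarrow> 0) (at_left \<infinity>)"
      using lim by (simp_all add: ereal_tendsto_simps)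
  qed simp
  then have "(\<integral>x. f x \<partial>lborel) = 0"
    by (simp add: interval_integral_to_infinity_eq interval_lebesgue_integral_def set_lebesgue_integral_def)
  then have "(\<integral>x. (poly (pderiv p) x * cos (s * x + \<theta>) +
    s * poly p x * cos (s * x + (\<theta> + pi / 2)) - x * (poly p x * cos (s * x + \<theta>))) \<partial>std_normal_distribution) = 0"
    unfolding f_def
    by (subst integral_density) (auto intro!: borel_measurable_continuous_onI continuous_intros)
  then show ?thesis
    using Bochner_Integration.integral_diff[OF i2 i1] by simp
qed

lemma integral_cos_std_normal:
  "(\<integral>x. cos (s * x + \<theta>) \<partial>std_normal_distribution) = cos \<theta> * exp (- s\<^sup>2 / 2)"
proof -
  interpret prob_space std_normal_distribution
    by (rule prob_space_std_normal)
  have int: "integrable std_normal_distribution (\<lambda>x. iexp (s * x))"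
    by (rule integrable_iexp) auto
  have "(\<integral>x. cos (s * x + \<theta>) \<partial>std_normal_distribution) = (\<integral>x. Re (iexp (s * x) * iexp \<theta>) \<partial>std_normal_distribution)"
    by (intro Bochner_Integration.integral_cong) (auto simp: cos_add Re_exp Im_exp cis_conv_exp[symmetric])
  also have "\<dots> = Re ((CLINT x|std_normal_distribution. iexp (s * x)) * iexp \<theta>)"
    using int by (subst integral_Re) auto
  also have "(CLINT x|std_normal_distribution. iexp (s * x)) = complex_of_real (exp (- s\<^sup>2 / 2))"
    using fun_cong[OF char_std_normal_distribution, of s] by (simp add: char_def)
  finally show ?thesis
    by (simp add: Re_exp cis_conv_exp[symmetric])
qed

text \<open>The phase \<open>\<theta>\<close> makes differentiation of a trigonometric function a shift by \<open>\<pi>/2\<close>.\<close>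

lemma integral_hermite_cos:
  "(\<integral>x. cos (s * x + \<theta>) * hermite l x \<partial>std_normal_distribution) =
    s ^ l * cos (\<theta> + real l * (pi / 2)) * exp (- s\<^sup>2 / 2)"
proof -
  have "(\<integral>x. poly (hermite_poly l) x * cos (s * x + \<theta>) \<partial>std_normal_distribution) =
    s ^ l * cos (\<theta> + real l * (pi / 2)) * exp (- s\<^sup>2 / 2)"
  proof (induction l arbitrary: \<theta>)
    case 0
    then show ?case
      by (simp add: integral_cos_std_normal)
  next
    case (Suc l)
    let ?p = "hermite_poly l"
    have i1: "integrable std_normal_distribution (\<lambda>x. x * (poly ?p x * cos (s * x + \<theta>)))"
      using integrable_std_normal_poly_cos[of "[:0,1:] * ?p" s \<theta>] by (simp add: mult_ac)
    have "(\<integral>x. poly (hermite_poly (Suc l)) x * cos (s * x + \<theta>) \<partial>std_normal_distribution) =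
       (\<integral>x. x * (poly ?p x * cos (s * x + \<theta>)) - poly (pderiv ?p) x * cos (s * x + \<theta>) \<partial>std_normal_distribution)"
      by (simp add: algebra_simps)
    also have "\<dots> = s * (\<integral>x. poly ?p x * cos (s * x + (\<theta> + pi / 2)) \<partial>std_normal_distribution)"
      using integrable_std_normal_poly_cos[of ?p s "\<theta> + pi / 2"]
      by (subst Bochner_Integration.integral_diff[OF i1 integrable_std_normal_poly_cos], subst stein_identity,
          subst Bochner_Integration.integral_add[OF integrable_std_normal_poly_cos])
         (simp_all add: mult.assoc)
    also have "\<dots> = s ^ Suc l * cos (\<theta> + real (Suc l) * (pi / 2)) * exp (- s\<^sup>2 / 2)"
    proof -
      have "\<theta> + pi / 2 + real l * (pi / 2) = \<theta> + real (Suc l) * (pi / 2)"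
        by (simp add: field_simps)
      then show ?thesis
        unfolding Suc.IH by (simp only: power_Suc mult.assoc)
    qed
    finally show ?case .
  qed
  then show ?thesis
    by (simp add: hermite_eq_poly mult.commute)
qed

text \<open>Each use of the recurrence moves one derivative onto \<open>q\<close>, by Stein's
  identity without the cosine.\<close>

lemma integral_hermite_poly:
  "(\<integral>x. hermite l x * poly q x \<partial>std_normal_distribution) =
   (\<integral>x. poly ((pderiv ^^ l) q) x \<partial>std_normal_distribution)"
proof -
  have "(\<integral>x. poly (hermite_poly l * q) x \<partial>std_normal_distribution) =
   (\<integral>x. poly ((pderiv ^^ l) q) x \<partial>std_normal_distribution)"
  proof (induction l arbitrary: q)
    case (Suc l)
    let ?p = "hermite_poly l"
    have "(\<integral>x. poly (hermite_poly (Suc l) * q) x \<partial>std_normal_distribution) =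
       (\<integral>x. poly ([:0, 1:] * (?p * q)) x - poly (pderiv ?p * q) x \<partial>std_normal_distribution)"
      by (simp add: algebra_simps)
    also have "\<dots> = (\<integral>x. poly ([:0, 1:] * (?p * q)) x \<partial>std_normal_distribution) -
      (\<integral>x. poly (pderiv ?p * q) x \<partial>std_normal_distribution)"
      by (intro Bochner_Integration.integral_diff integrable_std_normal_poly)
    also have "(\<integral>x. poly ([:0, 1:] * (?p * q)) x \<partial>std_normal_distribution) =
      (\<integral>x. poly (pderiv ?p * q) x + poly (?p * pderiv q) x \<partial>std_normal_distribution)"
      using stein_identity[of "?p * q" 0 0] by (simp add: pderiv_mult algebra_simps)
    also have "\<dots> = (\<integral>x. poly (pderiv ?p * q) x \<partial>std_normal_distribution) +
      (\<integral>x. poly (?p * pderiv q) x \<partial>std_normal_distribution)"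
      by (intro Bochner_Integration.integral_add integrable_std_normal_poly)
    finally show ?case
      using Suc[of "pderiv q"] by (simp add: funpow_swap1)
  qed simp
  then show ?thesis
    by (simp add: hermite_eq_poly)
qed

text \<open>Differentiating a monic polynomial of degree \<open>l \<le> k\<close> exactly
  \<open>k\<close> times leaves the constant \<open>k!\<close> if \<open>l = k\<close>, and 0
  otherwise.\<close>

lemma integral_hermite_hermite:
  assumes "l \<le> k"
  shows "(\<integral>x. hermite k x * hermite l x \<partial>std_normal_distribution) = (if l = k then fact k else 0)"
proof -
  interpret prob_space std_normal_distribution
    by (rule prob_space_std_normal)
  have deg: "degree ((pderiv ^^ j) q) = degree q - j" for j and q :: "real poly"
    by (induction j) (auto simp: degree_pderiv)
  have lead: "coeff ((pderiv ^^ j) q) 0 = fact j * coeff q j" for j and q :: "real poly"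
  proof (induction j arbitrary: q)
    case (Suc j)
    then show ?case
      by (simp add: funpow_Suc_right coeff_pderiv algebra_simps del: funpow.simps(2))
  qed simp
  have "degree ((pderiv ^^ k) (hermite_poly l)) = 0"
    using assms degree_hermite_poly[of l] by (simp add: deg)
  then obtain c where c: "(pderiv ^^ k) (hermite_poly l) = [:c:]"
    by (rule degree_eq_zeroE)
  have "c = fact k * coeff (hermite_poly l) k"
    using lead[of k "hermite_poly l"] c by simp
  also have "\<dots> = (if l = k then fact k else 0)"
    using degree_hermite_poly[of l] assms by (auto simp: coeff_eq_0)
  finally show ?thesis
    using integral_hermite_poly[of k "hermite_poly l"] c prob_space
    by (simp add: hermite_eq_poly[of l])
qed

section \<open>Square integrable functions and trigonometric polynomials\<close>

definition square_integrable :: "'a measure \<Rightarrow> ('a \<Rightarrow> real) \<Rightarrow> bool" where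
  "square_integrable M f \<longleftrightarrow> f \<in> borel_measurable M \<and> integrable M (\<lambda>x. (f x)\<^sup>2)"

lemma square_integrableD [dest]:
  "square_integrable M f \<Longrightarrow> f \<in> borel_measurable M"
  "square_integrable M f \<Longrightarrow> integrable M (\<lambda>x. (f x)\<^sup>2)"
  by (auto simp: square_integrable_def)

lemma square_integrable_bound:
  assumes "square_integrable M g" "f \<in> borel_measurable M" "\<And>x. x \<in> space M \<Longrightarrow> \<bar>f x\<bar> \<le> \<bar>g x\<bar>"
  shows "square_integrable M f"
  unfolding square_integrable_def
proof (intro conjI Bochner_Integration.integrable_bound[OF square_integrableD(2)[OF assms(1)]])
  show "AE x in M. norm ((f x)\<^sup>2) \<le> norm ((g x)\<^sup>2)"
    using assms(3) by (auto simp: abs_le_square_iff)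
qed (use assms(2) in auto)

lemma square_integrable_cmult:
  assumes "square_integrable M f"
  shows "square_integrable M (\<lambda>x. c * f x)"
  using assms by (auto simp: square_integrable_def power_mult_distrib)

lemma square_integrable_mult:
  assumes "square_integrable M f" "square_integrable M g"
  shows "integrable M (\<lambda>x. f x * g x)"
proof (rule Bochner_Integration.integrable_bound)
  show "integrable M (\<lambda>x. (f x)\<^sup>2 + (g x)\<^sup>2)"
    using assms by auto
  show "(\<lambda>x. f x * g x) \<in> borel_measurable M"
    using assms by (auto simp: square_integrable_def)
  show "AE x in M. norm (f x * g x) \<le> norm ((f x)\<^sup>2 + (g x)\<^sup>2)"
  proof (rule AE_I2)
    fix x
    have "2 * (\<bar>f x\<bar> * \<bar>g x\<bar>) \<le> (f x)\<^sup>2 + (g x)\<^sup>2"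
      using sum_squares_bound[of "\<bar>f x\<bar>" "\<bar>g x\<bar>"] by simp
    moreover have "0 \<le> \<bar>f x\<bar> * \<bar>g x\<bar>"
      by simp
    ultimately have "\<bar>f x\<bar> * \<bar>g x\<bar> \<le> (f x)\<^sup>2 + (g x)\<^sup>2"
      by linarith
    then show "norm (f x * g x) \<le> norm ((f x)\<^sup>2 + (g x)\<^sup>2)"
      by (simp add: abs_mult)
  qed
qed

lemma square_integrable_add:
  assumes "square_integrable M f" "square_integrable M g"
  shows "square_integrable M (\<lambda>x. f x + g x)"
proof -
  have "integrable M (\<lambda>x. (f x)\<^sup>2 + (g x)\<^sup>2 + 2 * (f x * g x))"
    by (intro Bochner_Integration.integrable_add integrable_mult_right square_integrable_mult
        square_integrableD(2) assms)
  then show ?thesis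
    using assms by (auto simp: square_integrable_def power2_sum mult.assoc)
qed

lemma square_integrable_diff:
  assumes "square_integrable M f" "square_integrable M g"
  shows "square_integrable M (\<lambda>x. f x - g x)"
  using square_integrable_add[OF assms(1) square_integrable_cmult[OF assms(2), of "-1"]] by simp

lemma Cauchy_Schwarz_integral:
  assumes f: "square_integrable M f" and g: "square_integrable M g"
  shows "\<bar>\<integral>x. f x * g x \<partial>M\<bar> \<le> sqrt (\<integral>x. (f x)\<^sup>2 \<partial>M) * sqrt (\<integral>x. (g x)\<^sup>2 \<partial>M)"
proof -
  have [measurable]: "f \<in> borel_measurable M" "g \<in> borel_measurable M"
    using assms by auto
  have fg: "integrable M (\<lambda>x. \<bar>f x * g x\<bar>)"
    using square_integrable_mult[OF assms] by simp
  have "ennreal ((\<integral>x. \<bar>f x * g x\<bar> \<partial>M)\<^sup>2) = (\<integral>\<^sup>+x. ennreal \<bar>f x * g x\<bar> \<partial>M)\<^sup>2"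
    using fg by (simp add: nn_integral_eq_integral ennreal_power)
  also have "\<dots> = (\<integral>\<^sup>+x. ennreal \<bar>f x\<bar> * ennreal \<bar>g x\<bar> \<partial>M)\<^sup>2"
    by (simp add: abs_mult ennreal_mult')
  also have "\<dots> \<le> (\<integral>\<^sup>+x. (ennreal \<bar>f x\<bar>)\<^sup>2 \<partial>M) * (\<integral>\<^sup>+x. (ennreal \<bar>g x\<bar>)\<^sup>2 \<partial>M)"
    by (rule Cauchy_Schwarz_nn_integral) simp_all
  also have "\<dots> = (\<integral>\<^sup>+x. ennreal ((f x)\<^sup>2) \<partial>M) * (\<integral>\<^sup>+x. ennreal ((g x)\<^sup>2) \<partial>M)"
    by (simp add: ennreal_power)
  also have "\<dots> = ennreal ((\<integral>x. (f x)\<^sup>2 \<partial>M) * (\<integral>x. (g x)\<^sup>2 \<partial>M))"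
    using assms by (simp add: nn_integral_eq_integral square_integrableD(2) ennreal_mult')
  finally have "(\<integral>x. \<bar>f x * g x\<bar> \<partial>M)\<^sup>2 \<le> (\<integral>x. (f x)\<^sup>2 \<partial>M) * (\<integral>x. (g x)\<^sup>2 \<partial>M)"
    by (simp add: ennreal_le_iff)
  then have "(\<integral>x. \<bar>f x * g x\<bar> \<partial>M) \<le> sqrt ((\<integral>x. (f x)\<^sup>2 \<partial>M) * (\<integral>x. (g x)\<^sup>2 \<partial>M))"
    by (rule real_le_rsqrt)
  from order_trans[OF integral_abs_bound this] show ?thesis
    by (simp add: real_sqrt_mult)
qed

lemma tendsto_integral_mult_L2:
  assumes f: "square_integrable M f" and g: "square_integrable M g"
    and fk: "\<And>k. square_integrable M (F k)" and gk: "\<And>k. square_integrable M (G k)"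
    and limf: "(\<lambda>k. \<integral>x. (F k x - f x)\<^sup>2 \<partial>M) \<longlonglongrightarrow> 0"
    and limg: "(\<lambda>k. \<integral>x. (G k x - g x)\<^sup>2 \<partial>M) \<longlonglongrightarrow> 0"
  shows "(\<lambda>k. \<integral>x. F k x * G k x \<partial>M) \<longlonglongrightarrow> (\<integral>x. f x * g x \<partial>M)"
proof -
  have df: "square_integrable M (\<lambda>x. F k x - f x)" and dg: "square_integrable M (\<lambda>x. G k x - g x)" for k
    by (intro square_integrable_diff f g fk gk)+
  let ?n = "\<lambda>h. sqrt (\<integral>x. (h x)\<^sup>2 \<partial>M)"
  \<comment> \<open>The product of the two errors is separated from the mixed terms, so that every
    summand has a factor that vanishes in L2.\<close>
  have eq: "(\<integral>x. F k x * G k x \<partial>M) - (\<integral>x. f x * g x \<partial>M) =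
      (\<integral>x. (F k x - f x) * (G k x - g x) \<partial>M) + ((\<integral>x. f x * (G k x - g x) \<partial>M) + (\<integral>x. (F k x - f x) * g x \<partial>M))" for k
  proof -
    have "F k x * G k x - f x * g x = (F k x - f x) * (G k x - g x) + (f x * (G k x - g x) + (F k x - f x) * g x)" for x
      by (simp add: algebra_simps)
    then have "(\<integral>x. F k x * G k x - f x * g x \<partial>M) = (\<integral>x. (F k x - f x) * (G k x - g x) + (f x * (G k x - g x) + (F k x - f x) * g x) \<partial>M)"
      by simp
    also have "\<dots> = (\<integral>x. (F k x - f x) * (G k x - g x) \<partial>M) + ((\<integral>x. f x * (G k x - g x) \<partial>M) + (\<integral>x. (F k x - f x) * g x \<partial>M))"
      using square_integrable_mult[OF df dg] square_integrable_mult[OF f dg] square_integrable_mult[OF df g]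
      by (simp only: Bochner_Integration.integral_add Bochner_Integration.integrable_add)
    finally show ?thesis
      by (subst (asm) Bochner_Integration.integral_diff) (auto intro: square_integrable_mult f g fk gk)
  qed
  have "(\<lambda>k. ?n (\<lambda>x. F k x - f x) * ?n (\<lambda>x. G k x - g x) + (?n f * ?n (\<lambda>x. G k x - g x) + ?n (\<lambda>x. F k x - f x) * ?n g))
      \<longlonglongrightarrow> sqrt 0 * sqrt 0 + (?n f * sqrt 0 + sqrt 0 * ?n g)"
    by (intro tendsto_intros limf limg)
  then have lim: "(\<lambda>k. ?n (\<lambda>x. F k x - f x) * ?n (\<lambda>x. G k x - g x) + (?n f * ?n (\<lambda>x. G k x - g x) + ?n (\<lambda>x. F k x - f x) * ?n g))
      \<longlonglongrightarrow> 0"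
    by simp
  have "(\<lambda>k. (\<integral>x. F k x * G k x \<partial>M) - (\<integral>x. f x * g x \<partial>M)) \<longlonglongrightarrow> 0"
  proof (rule Lim_null_comparison[OF _ lim])
    show "\<forall>\<^sub>F k in sequentially. norm ((\<integral>x. F k x * G k x \<partial>M) - (\<integral>x. f x * g x \<partial>M))
      \<le> ?n (\<lambda>x. F k x - f x) * ?n (\<lambda>x. G k x - g x) + (?n f * ?n (\<lambda>x. G k x - g x) + ?n (\<lambda>x. F k x - f x) * ?n g)"
      unfolding eq real_norm_def
      by (intro always_eventually allI order_trans[OF abs_triangle_ineq] add_mono
          Cauchy_Schwarz_integral f g df dg)
  qed
  then show ?thesis
    by (simp add: LIM_zero_iff)
qed

text \<open>By the product-to-sum formula this is an algebra of bounded functions, with explicit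
  Gaussian expectations. The phase in the generator makes sines and constants special cases.\<close>

inductive_set trig_poly :: "(real \<Rightarrow> real) set" where
  cos: "(\<lambda>x. cos (s * x + \<theta>)) \<in> trig_poly"
| add: "f \<in> trig_poly \<Longrightarrow> g \<in> trig_poly \<Longrightarrow> (\<lambda>x. f x + g x) \<in> trig_poly"
| cmult: "f \<in> trig_poly \<Longrightarrow> (\<lambda>x. c * f x) \<in> trig_poly"

lemma trig_poly_const: "(\<lambda>x. c) \<in> trig_poly"
  using trig_poly.cmult[OF trig_poly.cos[of 0 0], of c] by simp

lemma trig_poly_mult_cos:
  assumes "f \<in> trig_poly"
  shows "(\<lambda>x. f x * cos (t * x + \<phi>)) \<in> trig_poly"
  using assms
proof induction
  case (cos s \<theta>)
  have "(\<lambda>x. 1/2 * cos ((s - t) * x + (\<theta> - \<phi>)) + 1/2 * cos ((s + t) * x + (\<theta> + \<phi>))) \<in> trig_poly"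
    by (intro trig_poly.intros)
  moreover have "cos (s * x + \<theta>) * cos (t * x + \<phi>) =
      1/2 * cos ((s - t) * x + (\<theta> - \<phi>)) + 1/2 * cos ((s + t) * x + (\<theta> + \<phi>))" for x
    using cos_times_cos[of "s * x + \<theta>" "t * x + \<phi>"] by (simp add: algebra_simps add_divide_distrib)
  ultimately show ?case
    by simp
next
  case (add f g)
  from trig_poly.add[OF add.IH] show ?case
    by (simp add: distrib_right)
next
  case (cmult f c)
  from trig_poly.cmult[OF cmult.IH, of c] show ?case
    by (simp add: mult.assoc)
qed

lemma trig_poly_mult:
  assumes "f \<in> trig_poly" "g \<in> trig_poly"
  shows "(\<lambda>x. f x * g x) \<in> trig_poly"
  using assms(2)
proof induction
  case (cos s \<theta>)
  show ?case
    by (rule trig_poly_mult_cos[OF assms(1)])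
next
  case (add g h)
  from trig_poly.add[OF add.IH] show ?case
    by (simp add: distrib_left)
next
  case (cmult g c)
  from trig_poly.cmult[OF cmult.IH, of c] show ?case
    by (simp add: mult_ac)
qed

lemma trig_poly_sum: "(\<And>i. i \<in> I \<Longrightarrow> f i \<in> trig_poly) \<Longrightarrow> (\<lambda>x. \<Sum>i\<in>I. f i x) \<in> trig_poly"
  by (induction I rule: infinite_finite_induct) (auto intro: trig_poly_const trig_poly.add)

lemma trig_poly_power: "f \<in> trig_poly \<Longrightarrow> (\<lambda>x. f x ^ n) \<in> trig_poly"
  by (induction n) (auto intro: trig_poly_const trig_poly_mult)

lemma trig_poly_bounded_measurable:
  assumes "f \<in> trig_poly"
  shows "f \<in> borel_measurable borel \<and> (\<exists>B. \<forall>x. \<bar>f x\<bar> \<le> B)"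
  using assms
proof induction
  case (cos s \<theta>)
  then show ?case
    by (auto intro!: borel_measurable_continuous_onI continuous_intros exI[of _ 1])
next
  case (add f g)
  then obtain A B where "\<forall>x. \<bar>f x\<bar> \<le> A" "\<forall>x. \<bar>g x\<bar> \<le> B"
    by blast
  then have "\<forall>x. \<bar>f x + g x\<bar> \<le> A + B"
    by (meson abs_triangle_ineq add_mono order_trans)
  then show ?case
    using add by auto
next
  case (cmult f c)
  then obtain A where "\<forall>x. \<bar>f x\<bar> \<le> A"
    by blast
  then have "\<forall>x. \<bar>c * f x\<bar> \<le> \<bar>c\<bar> * A"
    by (simp add: abs_mult mult_left_mono)
  then show ?case
    using cmult by auto
qed

lemma (in finite_measure) square_integrable_bounded:
  assumes "f \<in> borel_measurable M" "\<And>x. x \<in> space M \<Longrightarrow> \<bar>f x\<bar> \<le> B"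
  shows "square_integrable M f"
proof (rule square_integrable_bound[OF _ assms(1)])
  show "square_integrable M (\<lambda>x. B)"
    by (simp add: square_integrable_def)
  show "\<bar>f x\<bar> \<le> \<bar>B\<bar>" if "x \<in> space M" for x
    using assms(2)[OF that] by linarith
qed

lemma (in prob_space) square_integrable_trig_poly:
  assumes "f \<in> trig_poly" "X \<in> borel_measurable M"
  shows "square_integrable M (\<lambda>\<omega>. f (X \<omega>))"
proof -
  obtain B where f: "f \<in> borel_measurable borel" "\<And>x. \<bar>f x\<bar> \<le> B"
    using trig_poly_bounded_measurable[OF assms(1)] by blast
  show ?thesis
    by (rule square_integrable_bounded[of _ B]) (use f assms(2) in \<open>auto intro: measurable_compose\<close>)
qed

section \<open>Covariances of functions of a Gaussian pair\<close>

lemma square_integrable_hermite: "square_integrable std_normal_distribution (hermite l)"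
proof -
  have "poly (hermite_poly l * hermite_poly l) = (\<lambda>x. (hermite l x)\<^sup>2)"
    by (simp add: fun_eq_iff hermite_eq_poly power2_eq_square)
  then show ?thesis
    using integrable_std_normal_poly[of "hermite_poly l * hermite_poly l"]
    by (simp add: square_integrable_def)
qed

lemma square_integrable_std_normal_trig_poly:
  "f \<in> trig_poly \<Longrightarrow> square_integrable std_normal_distribution f"
  using prob_space.square_integrable_trig_poly[OF prob_space_std_normal, of f "\<lambda>x. x"] by simp

text \<open>Not normalised; the squared norm \<open>l!\<close> of \<open>hermite l\<close> therefore
  appears as a denominator in the expansion.\<close>

definition hermite_coeff :: "nat \<Rightarrow> (real \<Rightarrow> real) \<Rightarrow> real" where
  "hermite_coeff l f = (\<integral>x. f x * hermite l x \<partial>std_normal_distribution)"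

lemma hermite_coeff_cmult: "hermite_coeff l (\<lambda>x. c * f x) = c * hermite_coeff l f"
  by (simp add: hermite_coeff_def mult.assoc)

lemma hermite_coeff_add:
  assumes "square_integrable std_normal_distribution f" "square_integrable std_normal_distribution g"
  shows "hermite_coeff l (\<lambda>x. f x + g x) = hermite_coeff l f + hermite_coeff l g"
  unfolding hermite_coeff_def distrib_right
  by (intro Bochner_Integration.integral_add square_integrable_mult assms square_integrable_hermite)

lemma hermite_coeff_diff:
  assumes "square_integrable std_normal_distribution f" "square_integrable std_normal_distribution g"
  shows "hermite_coeff l (\<lambda>x. f x - g x) = hermite_coeff l f - hermite_coeff l g"
  using hermite_coeff_add[OF assms(1) square_integrable_cmult[OF assms(2), of "-1"], of l]
    hermite_coeff_cmult[of l "-1" g] by simp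

text \<open>Encoded by the joint characteristic function instead of a density, which includes
  degenerate pairs. The phase \<open>\<theta>\<close> puts its real and imaginary parts into one
  real identity.\<close>

definition gaussian_pair :: "'a measure \<Rightarrow> real \<Rightarrow> ('a \<Rightarrow> real) \<Rightarrow> ('a \<Rightarrow> real) \<Rightarrow> bool" where
  "gaussian_pair M \<rho> X Y \<longleftrightarrow> X \<in> borel_measurable M \<and> Y \<in> borel_measurable M \<and>
    (\<forall>s t \<theta>. (\<integral>\<omega>. cos (s * X \<omega> + t * Y \<omega> + \<theta>) \<partial>M) =
       cos \<theta> * exp (- (s\<^sup>2 + t\<^sup>2 + 2 * \<rho> * s * t) / 2))"

text \<open>On this degenerate pair the Hermite expansion becomes Parseval's identity, which is how
  tails of the expansion get bounded.\<close>

lemma gaussian_pair_diagonal: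
  "gaussian_pair std_normal_distribution 1 (\<lambda>x. x) (\<lambda>x. x)"
  unfolding gaussian_pair_def
proof (intro conjI allI)
  fix s t \<theta> :: real
  show "(\<integral>x. cos (s * x + t * x + \<theta>) \<partial>std_normal_distribution) =
       cos \<theta> * exp (- (s\<^sup>2 + t\<^sup>2 + 2 * 1 * s * t) / 2)"
    using integral_cos_std_normal[of "s + t" \<theta>] by (simp add: distrib_right power2_sum algebra_simps)
qed auto

text \<open>The \<open>l\<close> quarter turns of the two phases cancel in their difference and make
  \<open>l\<close> half turns in their sum.\<close>

lemma cos_times_cos_quarter_turns:
  "cos (\<theta> + real l * (pi / 2)) * cos (\<phi> + real l * (pi / 2)) = (cos (\<theta> - \<phi>) + (-1) ^ l * cos (\<theta> + \<phi>)) / 2"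
proof -
  have "\<theta> + real l * (pi / 2) + (\<phi> + real l * (pi / 2)) = \<theta> + \<phi> + real l * pi"
    by (simp add: field_simps)
  moreover have "cos (\<theta> + \<phi> + real l * pi) = (-1) ^ l * cos (\<theta> + \<phi>)"
    unfolding cos_add[of "\<theta> + \<phi>" "real l * pi"] by simp
  moreover have "\<theta> + real l * (pi / 2) - (\<phi> + real l * (pi / 2)) = \<theta> - \<phi>"
    by simp
  ultimately show ?thesis
    by (simp only: cos_times_cos)
qed

lemma integral_cos_cos_gaussian_pair:
  assumes "prob_space M" and XY: "gaussian_pair M \<rho> X Y"
  shows "(\<integral>\<omega>. cos (s * X \<omega> + \<theta>) * cos (t * Y \<omega> + \<phi>) \<partial>M) = 
    (cos (\<theta> - \<phi>) * exp (\<rho> * s * t) + cos (\<theta> + \<phi>) * exp (- (\<rho> * s * t))) / 2 * exp (- s\<^sup>2 / 2) * exp (- t\<^sup>2 / 2)"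
proof -
  interpret prob_space M by fact
  have [measurable]: "X \<in> borel_measurable M" "Y \<in> borel_measurable M"
    using XY by (auto simp: gaussian_pair_def)
  have int: "integrable M (\<lambda>\<omega>. cos (s * X \<omega> + t * Y \<omega> + \<theta>))" for s t \<theta>
    by (rule integrable_const_bound[where B = 1]) auto
  have "cos (s * X \<omega> + \<theta>) * cos (t * Y \<omega> + \<phi>) =
     cos (s * X \<omega> + (-t) * Y \<omega> + (\<theta> - \<phi>)) / 2 + cos (s * X \<omega> + t * Y \<omega> + (\<theta> + \<phi>)) / 2" for \<omega>
    using cos_times_cos[of "s * X \<omega> + \<theta>" "t * Y \<omega> + \<phi>"] by (simp add: algebra_simps add_divide_distrib)
  then have "(\<integral>\<omega>. cos (s * X \<omega> + \<theta>) * cos (t * Y \<omega> + \<phi>) \<partial>M) =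
     (\<integral>\<omega>. cos (s * X \<omega> + (-t) * Y \<omega> + (\<theta> - \<phi>)) \<partial>M) / 2 + (\<integral>\<omega>. cos (s * X \<omega> + t * Y \<omega> + (\<theta> + \<phi>)) \<partial>M) / 2"
    using int[of s "-t" "\<theta> - \<phi>"] int[of s t "\<theta> + \<phi>"] by simp
  also have "(\<integral>\<omega>. cos (s * X \<omega> + (-t) * Y \<omega> + (\<theta> - \<phi>)) \<partial>M) = cos (\<theta> - \<phi>) * exp (- (s\<^sup>2 + (-t)\<^sup>2 + 2 * \<rho> * s * (-t)) / 2)"
    using XY unfolding gaussian_pair_def by blast
  also have "(\<integral>\<omega>. cos (s * X \<omega> + t * Y \<omega> + (\<theta> + \<phi>)) \<partial>M) = cos (\<theta> + \<phi>) * exp (- (s\<^sup>2 + t\<^sup>2 + 2 * \<rho> * s * t) / 2)"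
    using XY unfolding gaussian_pair_def by blast
  also have "- (s\<^sup>2 + (-t)\<^sup>2 + 2 * \<rho> * s * (-t)) / 2 = \<rho> * s * t + - s\<^sup>2 / 2 + - t\<^sup>2 / 2"
    by (simp add: field_simps)
  also have "- (s\<^sup>2 + t\<^sup>2 + 2 * \<rho> * s * t) / 2 = - (\<rho> * s * t) + - s\<^sup>2 / 2 + - t\<^sup>2 / 2"
    by (simp add: field_simps)
  finally show ?thesis
    unfolding exp_add by (simp add: algebra_simps add_divide_distrib)
qed

text \<open>Mehler's formula in weak form. Both sides are bilinear, so cosines suffice. There the
  expectation combines \<open>exp (\<rho> * s * t)\<close> and
  \<open>exp (- (\<rho> * s * t))\<close>, whose power series match the products of Hermite
  coefficients term by term.\<close>

lemma trig_poly_hermite_expansion: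
  assumes "prob_space M" and XY: "gaussian_pair M \<rho> X Y" and "f \<in> trig_poly" "g \<in> trig_poly"
  shows "(\<lambda>l. \<rho> ^ l * hermite_coeff l f * hermite_coeff l g / fact l) sums (\<integral>\<omega>. f (X \<omega>) * g (Y \<omega>) \<partial>M)"
proof -
  interpret prob_space M by fact
  have X: "X \<in> borel_measurable M" and Y: "Y \<in> borel_measurable M"
    using XY by (auto simp: gaussian_pair_def)
  note sq = square_integrable_std_normal_trig_poly
  note int = square_integrable_mult[OF square_integrable_trig_poly[OF _ X] square_integrable_trig_poly[OF _ Y]]
  show ?thesis
    using assms(3)
  proof induction
    case (cos s \<theta>)
    show ?case
      using assms(4)
    proof induction
      case (cos t \<phi>)
      have e: "(\<lambda>l. x ^ l / fact l) sums exp x" for x :: real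
        using exp_converges[of x] by (simp add: divide_inverse mult.commute)
      have "(\<lambda>l. (cos (\<theta> - \<phi>) * ((\<rho> * s * t) ^ l / fact l) + cos (\<theta> + \<phi>) * ((- (\<rho> * s * t)) ^ l / fact l)) / 2 * exp (- s\<^sup>2 / 2) * exp (- t\<^sup>2 / 2)) sums
        ((cos (\<theta> - \<phi>) * exp (\<rho> * s * t) + cos (\<theta> + \<phi>) * exp (- (\<rho> * s * t))) / 2 * exp (- s\<^sup>2 / 2) * exp (- t\<^sup>2 / 2))"
        by (intro sums_mult2 sums_divide sums_add sums_mult e)
      moreover have "\<rho> ^ l * hermite_coeff l (\<lambda>x. cos (s * x + \<theta>)) * hermite_coeff l (\<lambda>x. cos (t * x + \<phi>)) / fact l =
        (cos (\<theta> - \<phi>) * ((\<rho> * s * t) ^ l / fact l) + cos (\<theta> + \<phi>) * ((- (\<rho> * s * t)) ^ l / fact l)) / 2 * exp (- s\<^sup>2 / 2) * exp (- t\<^sup>2 / 2)" for l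
      proof -
        have "\<rho> ^ l * hermite_coeff l (\<lambda>x. cos (s * x + \<theta>)) * hermite_coeff l (\<lambda>x. cos (t * x + \<phi>)) / fact l =
          (cos (\<theta> + real l * (pi / 2)) * cos (\<phi> + real l * (pi / 2))) * ((\<rho> * s * t) ^ l / fact l) * exp (- s\<^sup>2 / 2) * exp (- t\<^sup>2 / 2)"
          unfolding hermite_coeff_def integral_hermite_cos by (simp add: power_mult_distrib mult_ac)
        also have "\<dots> = ((cos (\<theta> - \<phi>) + (-1) ^ l * cos (\<theta> + \<phi>)) / 2) * ((\<rho> * s * t) ^ l / fact l) * exp (- s\<^sup>2 / 2) * exp (- t\<^sup>2 / 2)"
          by (simp only: cos_times_cos_quarter_turns)
        also have "\<dots> = (cos (\<theta> - \<phi>) * ((\<rho> * s * t) ^ l / fact l) + cos (\<theta> + \<phi>) * ((- (\<rho> * s * t)) ^ l / fact l)) / 2 * exp (- s\<^sup>2 / 2) * exp (- t\<^sup>2 / 2)"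
        proof -
          have "(- (\<rho> * s * t)) ^ l / fact l = (-1) ^ l * ((\<rho> * s * t) ^ l / fact l)"
            by (subst power_minus) simp
          moreover have "(c + m * d) / 2 * r * E * E' = (c * r + d * (m * r)) / 2 * E * E'" for c d m r E E' :: real
            by (simp add: algebra_simps add_divide_distrib)
          ultimately show ?thesis
            by (simp only:)
        qed
        finally show ?thesis .
      qed
      ultimately show ?case
        by (simp only: integral_cos_cos_gaussian_pair[OF \<open>prob_space M\<close> XY])
    next
      case (add g h)
      have "(\<integral>\<omega>. cos (s * X \<omega> + \<theta>) * (g (Y \<omega>) + h (Y \<omega>)) \<partial>M) =
        (\<integral>\<omega>. cos (s * X \<omega> + \<theta>) * g (Y \<omega>) \<partial>M) + (\<integral>\<omega>. cos (s * X \<omega> + \<theta>) * h (Y \<omega>) \<partial>M)"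
        unfolding distrib_left using add.hyps
        by (intro Bochner_Integration.integral_add int[OF trig_poly.cos])
      with sums_add[OF add.IH] show ?case
        by (simp add: hermite_coeff_add[OF sq sq] add.hyps algebra_simps add_divide_distrib)
    next
      case (cmult g c)
      from sums_mult[OF cmult.IH, of c] show ?case
        by (simp add: hermite_coeff_cmult mult_ac)
    qed
  next
    case (add f h)
    have "(\<integral>\<omega>. (f (X \<omega>) + h (X \<omega>)) * g (Y \<omega>) \<partial>M) = (\<integral>\<omega>. f (X \<omega>) * g (Y \<omega>) \<partial>M) + (\<integral>\<omega>. h (X \<omega>) * g (Y \<omega>) \<partial>M)"
      unfolding distrib_right using add.hyps assms(4)
      by (intro Bochner_Integration.integral_add int)
    with sums_add[OF add.IH] show ?case
      by (simp add: hermite_coeff_add[OF sq sq] add.hyps algebra_simps add_divide_distrib)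
  next
    case (cmult f c)
    from sums_mult[OF cmult.IH, of c] show ?case
      by (simp add: hermite_coeff_cmult mult_ac)
  qed
qed

text \<open>All terms are nonnegative, and \<open>\<rho> ^ l \<le> \<rho> ^ n\<close> from index
  \<open>n\<close> on, so Parseval's identity bounds the tail. The first \<open>n\<close> terms are
  kept because an approximation of a function orthogonal to low degrees is only nearly orthogonal to
  them.\<close>

lemma trig_poly_covariance_le:
  assumes "prob_space M" and XY: "gaussian_pair M \<rho> X Y" and \<rho>: "0 \<le> \<rho>" "\<rho> \<le> 1" and f: "f \<in> trig_poly"
  shows "(\<integral>\<omega>. f (X \<omega>) * f (Y \<omega>) \<partial>M) \<le>
    (\<Sum>l<n. \<rho> ^ l * (hermite_coeff l f * hermite_coeff l f) / fact l) + \<rho> ^ n * (\<integral>x. f x * f x \<partial>std_normal_distribution)"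
proof -
  define a where "a l = hermite_coeff l f * hermite_coeff l f / fact l" for l
  have a: "0 \<le> a l" for l
    by (simp add: a_def)
  have s1: "(\<lambda>l. \<rho> ^ l * a l) sums (\<integral>\<omega>. f (X \<omega>) * f (Y \<omega>) \<partial>M)"
    using trig_poly_hermite_expansion[OF assms(1,2) f f] by (simp add: a_def mult.assoc)
  have s2: "a sums (\<integral>x. f x * f x \<partial>std_normal_distribution)"
    using trig_poly_hermite_expansion[OF prob_space_std_normal gaussian_pair_diagonal f f]
    by (simp add: a_def[abs_def] mult.assoc)
  have tail: "(\<lambda>l. a (l + n)) sums ((\<integral>x. f x * f x \<partial>std_normal_distribution) - (\<Sum>l<n. a l))"
    using s2 by (rule sums_split_initial_segment)
  have "(\<integral>\<omega>. f (X \<omega>) * f (Y \<omega>) \<partial>M) - (\<Sum>l<n. \<rho> ^ l * a l) \<le>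
      \<rho> ^ n * ((\<integral>x. f x * f x \<partial>std_normal_distribution) - (\<Sum>l<n. a l))"
  proof (rule sums_le)
    show "(\<lambda>l. \<rho> ^ (l + n) * a (l + n)) sums ((\<integral>\<omega>. f (X \<omega>) * f (Y \<omega>) \<partial>M) - (\<Sum>l<n. \<rho> ^ l * a l))"
      using sums_split_initial_segment[OF s1, of n] .
    show "(\<lambda>l. \<rho> ^ n * a (l + n)) sums (\<rho> ^ n * ((\<integral>x. f x * f x \<partial>std_normal_distribution) - (\<Sum>l<n. a l)))"
      by (rule sums_mult[OF tail])
    show "\<rho> ^ (l + n) * a (l + n) \<le> \<rho> ^ n * a (l + n)" for l
      using \<rho> a by (intro mult_right_mono power_decreasing) auto
  qed
  also have "\<dots> \<le> \<rho> ^ n * (\<integral>x. f x * f x \<partial>std_normal_distribution)"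
    using \<rho> a by (intro mult_left_mono) (auto intro: sum_nonneg)
  finally show ?thesis
    by (simp add: a_def)
qed

section \<open>Density of the trigonometric polynomials in L2 of the normal law\<close>

definition trig_closure :: "(real \<Rightarrow> real) set" where
  "trig_closure = {f. square_integrable std_normal_distribution f \<and>
     (\<forall>e>0. \<exists>g\<in>trig_poly. (\<integral>x. (g x - f x)\<^sup>2 \<partial>std_normal_distribution) < e)}"

lemma integral_square_add_le:
  assumes "square_integrable M f" "square_integrable M g"
  shows "(\<integral>x. (f x + g x)\<^sup>2 \<partial>M) \<le> 2 * (\<integral>x. (f x)\<^sup>2 \<partial>M) + 2 * (\<integral>x. (g x)\<^sup>2 \<partial>M)"
proof -
  have "(\<integral>x. (f x + g x)\<^sup>2 \<partial>M) \<le> (\<integral>x. 2 * (f x)\<^sup>2 + 2 * (g x)\<^sup>2 \<partial>M)"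
  proof (rule integral_mono)
    show "integrable M (\<lambda>x. (f x + g x)\<^sup>2)"
      using square_integrable_add[OF assms] by auto
    show "integrable M (\<lambda>x. 2 * (f x)\<^sup>2 + 2 * (g x)\<^sup>2)"
      by (intro Bochner_Integration.integrable_add integrable_mult_right square_integrableD(2) assms)
    show "(f x + g x)\<^sup>2 \<le> 2 * (f x)\<^sup>2 + 2 * (g x)\<^sup>2" for x
      using sum_squares_bound[of "f x" "g x"] by (simp add: power2_sum)
  qed
  also have "\<dots> = 2 * (\<integral>x. (f x)\<^sup>2 \<partial>M) + 2 * (\<integral>x. (g x)\<^sup>2 \<partial>M)"
    using square_integrableD(2)[OF assms(1)] square_integrableD(2)[OF assms(2)] by simp
  finally show ?thesis .
qed

lemma trig_closureD: "f \<in> trig_closure \<Longrightarrow> square_integrable std_normal_distribution f"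
  by (simp add: trig_closure_def)

lemma trig_poly_in_closure: "f \<in> trig_poly \<Longrightarrow> f \<in> trig_closure"
  by (auto simp: trig_closure_def square_integrable_std_normal_trig_poly intro!: bexI[of _ f])

lemma trig_closure_approx:
  assumes f: "square_integrable std_normal_distribution f"
    and "\<And>e. 0 < e \<Longrightarrow> \<exists>h\<in>trig_closure. (\<integral>x. (h x - f x)\<^sup>2 \<partial>std_normal_distribution) < e"
  shows "f \<in> trig_closure"
  unfolding trig_closure_def
proof (intro CollectI conjI f allI impI)
  fix e :: real assume "0 < e"
  then obtain h where h: "h \<in> trig_closure" "(\<integral>x. (h x - f x)\<^sup>2 \<partial>std_normal_distribution) < e / 4"
    using assms(2)[of "e / 4"] by auto
  then obtain g where g: "g \<in> trig_poly" "(\<integral>x. (g x - h x)\<^sup>2 \<partial>std_normal_distribution) < e / 4"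
    using \<open>0 < e\<close> by (auto simp: trig_closure_def elim!: allE[of _ "e / 4"])
  have "(\<integral>x. ((g x - h x) + (h x - f x))\<^sup>2 \<partial>std_normal_distribution) \<le>
    2 * (\<integral>x. (g x - h x)\<^sup>2 \<partial>std_normal_distribution) + 2 * (\<integral>x. (h x - f x)\<^sup>2 \<partial>std_normal_distribution)"
    by (intro integral_square_add_le square_integrable_diff f trig_closureD[OF h(1)]
        square_integrable_std_normal_trig_poly g)
  also have "\<dots> < e"
    using g h by simp
  finally show "\<exists>g\<in>trig_poly. (\<integral>x. (g x - f x)\<^sup>2 \<partial>std_normal_distribution) < e"
    using g(1) by (intro bexI[of _ g]) simp_all
qed

lemma trig_closure_add:
  assumes f: "f \<in> trig_closure" and g: "g \<in> trig_closure"
  shows "(\<lambda>x. f x + g x) \<in> trig_closure"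
proof (rule trig_closure_approx)
  show "square_integrable std_normal_distribution (\<lambda>x. f x + g x)"
    by (intro square_integrable_add trig_closureD f g)
  fix e :: real assume "0 < e"
  then obtain f' g' where f': "f' \<in> trig_poly" "(\<integral>x. (f' x - f x)\<^sup>2 \<partial>std_normal_distribution) < e / 4"
    and g': "g' \<in> trig_poly" "(\<integral>x. (g' x - g x)\<^sup>2 \<partial>std_normal_distribution) < e / 4"
    using f g by (auto simp: trig_closure_def elim!: allE[of _ "e / 4"])
  have "(\<integral>x. ((f' x - f x) + (g' x - g x))\<^sup>2 \<partial>std_normal_distribution) \<le>
    2 * (\<integral>x. (f' x - f x)\<^sup>2 \<partial>std_normal_distribution) + 2 * (\<integral>x. (g' x - g x)\<^sup>2 \<partial>std_normal_distribution)"
    by (intro integral_square_add_le square_integrable_diff trig_closureD f g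
        square_integrable_std_normal_trig_poly f' g')
  also have "\<dots> < e"
    using f' g' by simp
  finally have "(\<integral>x. ((f' x + g' x) - (f x + g x))\<^sup>2 \<partial>std_normal_distribution) < e"
    by (simp add: algebra_simps)
  then show "\<exists>h\<in>trig_closure. (\<integral>x. (h x - (f x + g x))\<^sup>2 \<partial>std_normal_distribution) < e"
    using trig_poly_in_closure[OF trig_poly.add[OF f'(1) g'(1)]] by (intro bexI[of _ "\<lambda>x. f' x + g' x"])
qed

lemma trig_closure_cmult:
  assumes f: "f \<in> trig_closure"
  shows "(\<lambda>x. c * f x) \<in> trig_closure"
proof (rule trig_closure_approx)
  show "square_integrable std_normal_distribution (\<lambda>x. c * f x)"
    by (intro square_integrable_cmult trig_closureD f)
  fix e :: real assume "0 < e"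
  \<comment> \<open>The denominator \<open>c\<^sup>2 + 1\<close>, rather than
    \<open>c\<^sup>2\<close>, covers \<open>c = 0\<close>.\<close>
  then have "0 < e / (c\<^sup>2 + 1)"
    by (simp add: add_nonneg_pos)
  then obtain g where g: "g \<in> trig_poly" "(\<integral>x. (g x - f x)\<^sup>2 \<partial>std_normal_distribution) < e / (c\<^sup>2 + 1)"
    using f unfolding trig_closure_def by blast
  have nn: "0 \<le> (\<integral>x. (g x - f x)\<^sup>2 \<partial>std_normal_distribution)"
    by (rule Bochner_Integration.integral_nonneg) simp
  have "(\<integral>x. (c * g x - c * f x)\<^sup>2 \<partial>std_normal_distribution) = c\<^sup>2 * (\<integral>x. (g x - f x)\<^sup>2 \<partial>std_normal_distribution)"
    by (simp add: power_mult_distrib flip: right_diff_distrib)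
  also have "\<dots> \<le> (c\<^sup>2 + 1) * (\<integral>x. (g x - f x)\<^sup>2 \<partial>std_normal_distribution)"
    using nn by (simp add: distrib_right)
  also have "\<dots> < e"
    using g(2) add_nonneg_pos[of "c\<^sup>2" 1] by (simp add: field_simps)
  finally show "\<exists>h\<in>trig_closure. (\<integral>x. (h x - c * f x)\<^sup>2 \<partial>std_normal_distribution) < e"
    using trig_poly_in_closure[OF trig_poly.cmult[OF g(1)]] by (intro bexI[of _ "\<lambda>x. c * g x"])
qed

lemma trig_closure_sum: "(\<And>i. i \<in> I \<Longrightarrow> f i \<in> trig_closure) \<Longrightarrow> (\<lambda>x. \<Sum>i\<in>I. f i x) \<in> trig_closure"
  by (induction I rule: infinite_finite_induct)
    (auto intro: trig_closure_add trig_poly_in_closure trig_poly_const)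

text \<open>The error is at most \<open>2 * w\<close>, whose square is integrable, so dominated
  convergence improves pointwise convergence to convergence in L2.\<close>

lemma trig_closure_dominated:
  assumes F: "\<And>n. F n \<in> trig_closure" and [measurable]: "f \<in> borel_measurable borel"
    and w: "square_integrable std_normal_distribution w"
    and dom: "\<And>n x. \<bar>F n x\<bar> \<le> w x" and lim: "\<And>x. (\<lambda>n. F n x) \<longlonglongrightarrow> f x"
  shows "f \<in> trig_closure"
proof (rule trig_closure_approx)
  have fw: "\<bar>f x\<bar> \<le> w x" for x
    by (rule Lim_bounded[OF tendsto_rabs[OF lim[of x]], where M = 0]) (use dom in blast)
  show "square_integrable std_normal_distribution f"
  proof (rule square_integrable_bound[OF w])
    show "\<bar>f x\<bar> \<le> \<bar>w x\<bar>" for x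
      using fw[of x] by linarith
  qed simp
  have [measurable]: "F n \<in> borel_measurable borel" for n
    using trig_closureD[OF F[of n]] by (auto simp: square_integrable_def)
  have [measurable]: "w \<in> borel_measurable borel"
    using w by (auto simp: square_integrable_def)
  have "(\<lambda>n. \<integral>x. (F n x - f x)\<^sup>2 \<partial>std_normal_distribution) \<longlonglongrightarrow> (\<integral>x. 0 \<partial>std_normal_distribution)"
  proof (rule integral_dominated_convergence)
    show "integrable std_normal_distribution (\<lambda>x. (2 * w x)\<^sup>2)"
      by (rule square_integrableD(2)[OF square_integrable_cmult[OF w]])
    show "AE x in std_normal_distribution. (\<lambda>n. (F n x - f x)\<^sup>2) \<longlonglongrightarrow> 0"
      using lim by (auto intro!: AE_I2 tendsto_eq_intros)
    show "AE x in std_normal_distribution. norm ((F n x - f x)\<^sup>2) \<le> (2 * w x)\<^sup>2" for n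
    proof (rule AE_I2)
      fix x
      have "\<bar>F n x - f x\<bar> \<le> \<bar>2 * w x\<bar>"
        using dom[of n x] fw[of x] by linarith
      then show "norm ((F n x - f x)\<^sup>2) \<le> (2 * w x)\<^sup>2"
        by (simp add: abs_le_square_iff)
    qed
  qed simp_all
  then have "(\<lambda>n. \<integral>x. (F n x - f x)\<^sup>2 \<partial>std_normal_distribution) \<longlonglongrightarrow> 0"
    by simp
  then show "\<exists>h\<in>trig_closure. (\<integral>x. (h x - f x)\<^sup>2 \<partial>std_normal_distribution) < e" if "0 < e" for e
    using order_tendstoD(2)[OF _ that] eventually_happens'[OF sequentially_bot] F by blast
qed

text \<open>By Weierstrass, \<open>\<kappa>\<close> is a uniform limit of polynomials on
  \<open>{-1..1}\<close>, and a polynomial in \<open>sin (s * x)\<close> is a trigonometric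
  polynomial.\<close>

lemma trig_closure_continuous_sin:
  fixes \<kappa> :: "real \<Rightarrow> real"
  assumes \<kappa>: "continuous_on {-1..1} \<kappa>"
  shows "(\<lambda>x. \<kappa> (sin (s * x))) \<in> trig_closure"
proof -
  interpret prob_space std_normal_distribution
    by (rule prob_space_std_normal)
  have "\<exists>g. real_polynomial_function g \<and> (\<forall>x\<in>{-1..1}. \<bar>\<kappa> x - g x\<bar> < 1 / Suc n)" for n
    using Stone_Weierstrass_real_polynomial_function[OF compact_Icc \<kappa>, of "1 / Suc n"] by (metis of_nat_0_less_iff zero_less_Suc zero_less_divide_1_iff)
  then obtain q where q: "\<And>n. real_polynomial_function (q n)"
    and approx: "\<And>n u. u \<in> {-1..1} \<Longrightarrow> \<bar>\<kappa> u - q n u\<bar> < 1 / Suc n"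
    by metis
  have sin: "(\<lambda>x. sin (s * x)) \<in> trig_poly"
    using trig_poly.cos[of s "- (pi / 2)"] by (simp add: cos_diff)
  have qT: "(\<lambda>x. q n (sin (s * x))) \<in> trig_poly" for n
  proof -
    obtain a d where "q n = (\<lambda>x. \<Sum>i\<le>d. a i * x ^ i)"
      using q[of n] unfolding real_polynomial_function_iff_sum by blast
    then show ?thesis
      by (auto intro!: trig_poly_sum trig_poly.cmult trig_poly_power sin)
  qed
  have "compact (\<kappa> ` {-1..1})"
    by (intro compact_continuous_image \<kappa>) simp
  then have "bounded (\<kappa> ` {-1..1})"
    by (rule compact_imp_bounded)
  then obtain B where "\<forall>u\<in>{-1..1}. \<bar>\<kappa> u\<bar> \<le> B"
    by (auto simp: bounded_iff)
  then have B: "\<bar>\<kappa> u\<bar> \<le> B" if "u \<in> {-1..1}" for u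
    using that by blast
  show ?thesis
  proof (rule trig_closure_dominated)
    show "(\<lambda>x. q n (sin (s * x))) \<in> trig_closure" for n
      by (rule trig_poly_in_closure[OF qT])
    show "(\<lambda>x. \<kappa> (sin (s * x))) \<in> borel_measurable borel"
      by (intro borel_measurable_continuous_onI continuous_on_compose2[OF \<kappa>] continuous_intros) auto
    show "square_integrable std_normal_distribution (\<lambda>x. B + 1)"
      by (rule square_integrable_bounded) auto
    show "\<bar>q n (sin (s * x))\<bar> \<le> B + 1" for n x
    proof -
      have "1 / real (Suc n) \<le> 1" and s: "sin (s * x) \<in> {-1..1}"
        by simp_all
      then show ?thesis
        using approx[OF s, of n] B[OF s] by linarith
    qed
    show "(\<lambda>n. q n (sin (s * x))) \<longlonglongrightarrow> \<kappa> (sin (s * x))" for x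
    proof (rule LIM_zero_cancel, rule Lim_null_comparison)
      show "(\<lambda>n. 1 / real (Suc n)) \<longlonglongrightarrow> 0"
        by real_asymp
      show "\<forall>\<^sub>F n in sequentially. norm (q n (sin (s * x)) - \<kappa> (sin (s * x))) \<le> 1 / real (Suc n)"
        using approx[of "sin (s * x)"] by (auto intro!: always_eventually less_imp_le simp: abs_minus_commute)
    qed
  qed
qed

text \<open>On \<open>{-\<pi>n/2..\<pi>n/2}\<close> the function \<open>x \<mapsto> sin (x/n)\<close> is injective, so that steep continuous
  functions of it approximate the indicator of a half-line boundedly and pointwise.\<close>

lemma indicator_atMost_in_trig_closure: "indicator {..a} \<in> trig_closure"
proof (rule trig_closure_dominated)
  interpret prob_space std_normal_distribution
    by (rule prob_space_std_normal)
  \<comment> \<open>One factor \<open>n\<close> undoes the flattening of \<open>sin (x / n)\<close>;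
    the other lets the slope of the cutoff tend to infinity.\<close>
  define \<kappa> where "\<kappa> n u = max 0 (min 1 (1 - (real n)\<^sup>2 * (u - sin (a / real n))))" for n and u :: real
  let ?F = "\<lambda>n x. \<kappa> n (sin (1 / real n * x))"
  show "?F n \<in> trig_closure" for n
    unfolding \<kappa>_def by (intro trig_closure_continuous_sin continuous_intros)
  show "\<bar>?F n x\<bar> \<le> 1" for n x
    by (auto simp: \<kappa>_def)
  show "square_integrable std_normal_distribution (\<lambda>x. 1)"
    by (rule square_integrable_bounded) auto
  show "indicator {..a} \<in> borel_measurable borel"
    by simp
  show "(\<lambda>n. ?F n x) \<longlonglongrightarrow> indicator {..a} x" for x
  proof (cases "x \<le> a")
    case True
    have "\<forall>\<^sub>F n in sequentially. ?F n x = 1"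
    proof -
      have "\<forall>\<^sub>F n in sequentially. real n \<ge> max 1 (max \<bar>x\<bar> \<bar>a\<bar>)"
        by real_asymp
      then show ?thesis
      proof eventually_elim
        case (elim n)
        then have "\<bar>x / real n\<bar> \<le> 1" "\<bar>a / real n\<bar> \<le> 1" "x / real n \<le> a / real n"
          using True by (auto simp: divide_right_mono)
        then have "sin (x / real n) \<le> sin (a / real n)"
          using pi_ge_two by (intro sin_monotone_2pi_le) linarith+
        then have "(real n)\<^sup>2 * (sin (x / real n) - sin (a / real n)) \<le> 0"
          by (intro mult_nonneg_nonpos) auto
        then show ?case
          by (simp add: \<kappa>_def)
      qed
    qed
    then show ?thesis
      using True by (simp add: tendsto_eventually)
  next
    case False
    then have "x - a > 0"
      by simp
    have lim: "(\<lambda>n. real n * sin (c / real n)) \<longlonglongrightarrow> c" for c :: real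
      by real_asymp
    have "filterlim (\<lambda>n. (real n * sin (x / real n) - real n * sin (a / real n)) * real n) at_top sequentially"
      by (rule filterlim_tendsto_pos_mult_at_top[OF tendsto_diff[OF lim lim] \<open>x - a > 0\<close> filterlim_real_sequentially])
    then have "filterlim (\<lambda>n. (real n)\<^sup>2 * (sin (1 / real n * x) - sin (a / real n))) at_top sequentially"
      by (simp add: algebra_simps power2_eq_square)
    then have "\<forall>\<^sub>F n in sequentially. (real n)\<^sup>2 * (sin (1 / real n * x) - sin (a / real n)) \<ge> 1"
      by (simp only: filterlim_at_top)
    then have "\<forall>\<^sub>F n in sequentially. ?F n x = 0"
      by eventually_elim (simp add: \<kappa>_def)
    then show ?thesis
      using False by (simp add: tendsto_eventually)
  qed
qed

text \<open>Dynkin's theorem with the half-lines as intersection-stable generator. Partial sums over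
  a disjoint family stay below 1, so \<open>trig_closure_dominated\<close> handles unions.\<close>

lemma indicator_in_trig_closure:
  assumes "A \<in> sets borel"
  shows "indicator A \<in> trig_closure"
proof -
  interpret prob_space std_normal_distribution
    by (rule prob_space_std_normal)
  have borel: "sets borel = sigma_sets UNIV (range (\<lambda>a::real. {..a}))"
    by (simp add: borel_eq_atMost)
  have "Int_stable (range (\<lambda>a::real. {..a}))" "range (\<lambda>a::real. {..a}) \<subseteq> Pow UNIV"
    by (auto simp: Int_stable_def) 
  moreover have "A \<in> sigma_sets UNIV (range (\<lambda>a::real. {..a}))"
    using assms borel by simp
  ultimately show ?thesis
  proof (induction rule: sigma_sets_induct_disjoint)
    case (basic A)
    then show ?case
      by (auto intro: indicator_atMost_in_trig_closure)
  next
    case empty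
    show ?case
      using trig_poly_in_closure[OF trig_poly_const[of 0]] by (simp add: indicator_def)
  next
    case (compl A)
    have "(\<lambda>x. 1 + (-1) * indicator A x) \<in> trig_closure"
      by (intro trig_closure_add trig_closure_cmult compl.IH trig_poly_in_closure trig_poly_const)
    moreover have "indicator (UNIV - A) x = 1 + (-1) * (indicator A x :: real)" for x
      by (simp add: indicator_def)
    ultimately show ?case
      by (simp add: fun_eq_iff[symmetric])
  next
    case (union A)
    show ?case
    proof (rule trig_closure_dominated)
      show "(\<lambda>x. \<Sum>i<n. indicator (A i) x) \<in> trig_closure" for n
        by (intro trig_closure_sum union.IH)
      show "indicator (\<Union> (range A)) \<in> borel_measurable borel"
        using union.hyps borel by (intro borel_measurable_indicator sets.countable_UN) auto
      show "square_integrable std_normal_distribution (\<lambda>x. 1)"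
        by (rule square_integrable_bounded) auto
      show "\<bar>\<Sum>i<n. indicator (A i) x\<bar> \<le> (1::real)" for n x
      proof -
        have "(\<Sum>i<n. indicator (A i) x) = (indicator (\<Union>i<n. A i) x :: real)"
          using union.hyps(1) by (intro indicator_UN_disjoint[symmetric]) (auto intro: disjoint_family_on_mono)
        then show ?thesis
          by (simp add: indicator_def)
      qed
      show "(\<lambda>n. \<Sum>i<n. indicat_real (A i) x) \<longlonglongrightarrow> indicat_real (\<Union> (range A)) x" for x
        using indicator_sums[of A x] union.hyps(1)
        by (auto simp: sums_def disjoint_family_on_def)
    qed
  qed
qed

lemma square_integrable_in_trig_closure:
  assumes f: "square_integrable std_normal_distribution f"
  shows "f \<in> trig_closure"
proof -
  have meas: "f \<in> borel_measurable borel"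
    using f by (auto simp: square_integrable_def)
  obtain F where F: "\<And>i. simple_function borel (F i)" "\<And>x. (\<lambda>i. F i x) \<longlonglongrightarrow> f x"
    "\<And>i x. \<bar>F i x\<bar> \<le> 2 * \<bar>f x\<bar>"
    using borel_measurable_implies_sequence_metric[OF meas, of 0] by (auto simp: dist_real_def)
  show ?thesis
  proof (rule trig_closure_dominated)
    show "F i \<in> trig_closure" for i
    proof -
      have "(\<lambda>x. \<Sum>y\<in>range (F i). y * indicator (F i -` {y}) x) \<in> trig_closure"
        using simple_functionD(2)[OF F(1)[of i]]
        by (intro trig_closure_sum trig_closure_cmult indicator_in_trig_closure) simp
      moreover have "(\<lambda>x. \<Sum>y\<in>range (F i). y * indicator (F i -` {y}) x) = F i"
        by (rule ext, rule sym, subst simple_function_indicator_representation_banach[OF F(1)[of i]])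
          (simp_all add: mult.commute)
      ultimately show ?thesis
        by (rule back_subst[where P = "\<lambda>f. f \<in> trig_closure"])
    qed
    have "square_integrable std_normal_distribution (\<lambda>x. \<bar>f x\<bar>)"
      using f meas by (simp add: square_integrable_def)
    then show "square_integrable std_normal_distribution (\<lambda>x. 2 * \<bar>f x\<bar>)"
      by (rule square_integrable_cmult)
  qed (use meas F in auto)
qed

text \<open>Orthogonality enters only after the passage to the limit, in which the finitely many
  coefficients and the norm converge. The standard normal marginals transport L2 convergence from
  the line to \<open>M\<close>.\<close>

theorem gaussian_pair_covariance_le:
  assumes M: "prob_space M" and XY: "gaussian_pair M \<rho> X Y" and \<rho>: "0 \<le> \<rho>" "\<rho> \<le> 1"
    and X: "distr M borel X = std_normal_distribution" and Y: "distr M borel Y = std_normal_distribution"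
    and f: "square_integrable std_normal_distribution f"
    and orth: "\<And>l. l < n \<Longrightarrow> hermite_coeff l f = 0"
  shows "(\<integral>\<omega>. f (X \<omega>) * f (Y \<omega>) \<partial>M) \<le> \<rho> ^ n * (\<integral>x. (f x)\<^sup>2 \<partial>std_normal_distribution)"
proof -
  interpret prob_space M by fact
  have [measurable]: "X \<in> borel_measurable M" "Y \<in> borel_measurable M"
    using XY by (auto simp: gaussian_pair_def)
  have "\<exists>g\<in>trig_poly. (\<integral>x. (g x - f x)\<^sup>2 \<partial>std_normal_distribution) < 1 / Suc k" for k
    using square_integrable_in_trig_closure[OF f] by (simp add: trig_closure_def)
  then obtain g where g: "\<And>k. g k \<in> trig_poly"
    and le: "\<And>k. (\<integral>x. (g k x - f x)\<^sup>2 \<partial>std_normal_distribution) < 1 / Suc k"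
    by metis
  note sq = square_integrable_std_normal_trig_poly[OF g]
  have lim: "(\<lambda>k. \<integral>x. (g k x - f x)\<^sup>2 \<partial>std_normal_distribution) \<longlonglongrightarrow> 0"
  proof (rule Lim_null_comparison)
    show "(\<lambda>k. 1 / real (Suc k)) \<longlonglongrightarrow> 0"
      by real_asymp
    show "\<forall>\<^sub>F k in sequentially. norm (\<integral>x. (g k x - f x)\<^sup>2 \<partial>std_normal_distribution) \<le> 1 / real (Suc k)"
      using le by (auto intro!: always_eventually less_imp_le simp: Bochner_Integration.integral_nonneg)
  qed
  have comp: "square_integrable M (\<lambda>\<omega>. h (Z \<omega>)) \<and>
     (\<integral>\<omega>. (h (Z \<omega>))\<^sup>2 \<partial>M) = (\<integral>x. (h x)\<^sup>2 \<partial>std_normal_distribution)"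
    if h: "square_integrable std_normal_distribution h" and Z: "distr M borel Z = std_normal_distribution"
      and [measurable]: "Z \<in> borel_measurable M" for h Z
  proof -
    have [measurable]: "h \<in> borel_measurable borel"
      using h by (auto simp: square_integrable_def)
    show ?thesis
      using h unfolding Z[symmetric] square_integrable_def
      by (simp add: integral_distr integrable_distr_eq)
  qed
  note compX = comp[OF _ X \<open>X \<in> borel_measurable M\<close>] and compY = comp[OF _ Y \<open>Y \<in> borel_measurable M\<close>]
  have limX: "(\<lambda>k. \<integral>\<omega>. (g k (X \<omega>) - f (X \<omega>))\<^sup>2 \<partial>M) \<longlonglongrightarrow> 0"
    using lim compX[OF square_integrable_diff[OF sq f]] by simp
  have limY: "(\<lambda>k. \<integral>\<omega>. (g k (Y \<omega>) - f (Y \<omega>))\<^sup>2 \<partial>M) \<longlonglongrightarrow> 0"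
    using lim compY[OF square_integrable_diff[OF sq f]] by simp
  have L: "(\<lambda>k. \<integral>\<omega>. g k (X \<omega>) * g k (Y \<omega>) \<partial>M) \<longlonglongrightarrow> (\<integral>\<omega>. f (X \<omega>) * f (Y \<omega>) \<partial>M)"
    using compX compY f sq by (intro tendsto_integral_mult_L2 limX limY) auto
  have C: "(\<lambda>k. hermite_coeff l (g k)) \<longlonglongrightarrow> hermite_coeff l f" for l
    unfolding hermite_coeff_def
    by (intro tendsto_integral_mult_L2 f sq lim square_integrable_hermite) simp
  have Q: "(\<lambda>k. \<integral>x. g k x * g k x \<partial>std_normal_distribution) \<longlonglongrightarrow> (\<integral>x. f x * f x \<partial>std_normal_distribution)"
    by (intro tendsto_integral_mult_L2 f sq lim)
  have "(\<lambda>k. (\<Sum>l<n. \<rho> ^ l * (hermite_coeff l (g k) * hermite_coeff l (g k)) / fact l) +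
      \<rho> ^ n * (\<integral>x. g k x * g k x \<partial>std_normal_distribution)) \<longlonglongrightarrow>
     (\<Sum>l<n. \<rho> ^ l * (hermite_coeff l f * hermite_coeff l f) / fact l) + \<rho> ^ n * (\<integral>x. f x * f x \<partial>std_normal_distribution)"
    by (intro tendsto_intros C Q) simp
  then have "(\<integral>\<omega>. f (X \<omega>) * f (Y \<omega>) \<partial>M) \<le>
     (\<Sum>l<n. \<rho> ^ l * (hermite_coeff l f * hermite_coeff l f) / fact l) + \<rho> ^ n * (\<integral>x. f x * f x \<partial>std_normal_distribution)"
    using L trig_poly_covariance_le[OF M XY \<rho> g] by (intro LIMSEQ_le) auto
  then show ?thesis
    using orth by (simp add: power2_eq_square)
qed

section \<open>Stationary Gaussian sequences\<close>

lemma (in prob_space) normal_integral_cos: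
  assumes "0 < \<sigma>" and X: "distributed M lborel X (normal_density 0 \<sigma>)"
  shows "expectation (\<lambda>\<omega>. cos (X \<omega> + \<theta>)) = cos \<theta> * exp (- \<sigma>\<^sup>2 / 2)"
proof -
  have Z: "distributed M lborel (\<lambda>\<omega>. X \<omega> / \<sigma>) std_normal_density"
    using X normal_standard_normal_convert[OF \<open>0 < \<sigma>\<close>, of X 0] by simp
  have "expectation (\<lambda>\<omega>. cos (X \<omega> + \<theta>)) = expectation (\<lambda>\<omega>. cos (\<sigma> * (X \<omega> / \<sigma>) + \<theta>))"
    using \<open>0 < \<sigma>\<close> by simp
  also have "\<dots> = (\<integral>x. std_normal_density x * cos (\<sigma> * x + \<theta>) \<partial>lborel)"
    by (rule distributed_integral[OF Z, symmetric])
      (auto intro!: borel_measurable_continuous_onI continuous_intros)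
  also have "\<dots> = (\<integral>x. cos (\<sigma> * x + \<theta>) \<partial>std_normal_distribution)"
    by (subst integral_density) (auto intro!: borel_measurable_continuous_onI continuous_intros)
  finally show ?thesis
    by (simp add: integral_cos_std_normal)
qed

lemma (in prob_space) gaussian_rv_centered:
  assumes X: "gaussian_rv M X" and mean: "expectation X = 0"
  obtains (normal) \<sigma> where "0 < \<sigma>" "distributed M lborel X (normal_density 0 \<sigma>)"
      "square_integrable M X" "expectation (\<lambda>\<omega>. (X \<omega>)\<^sup>2) = \<sigma>\<^sup>2"
    | (degenerate) "AE \<omega> in M. X \<omega> = 0" "square_integrable M X" "expectation (\<lambda>\<omega>. (X \<omega>)\<^sup>2) = 0"
proof -
  have meas [measurable]: "X \<in> borel_measurable M"
    using X by (simp add: gaussian_rv_def)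
  from X consider \<mu> \<sigma> where "0 < \<sigma>" "distributed M lborel X (normal_density \<mu> \<sigma>)"
    | \<mu> where "AE \<omega> in M. X \<omega> = \<mu>"
    by (auto simp: gaussian_rv_def)
  then show thesis
  proof cases
    case (1 \<mu> \<sigma>)
    then have "\<mu> = 0"
      using normal_distributed_expectation mean by metis
    with 1 have D: "distributed M lborel X (normal_density 0 \<sigma>)"
      by simp
    have "integrable lborel (\<lambda>x. normal_density 0 \<sigma> x * x\<^sup>2)"
      using integrable_normal_moment[OF \<open>0 < \<sigma>\<close>, of 0 2] by simp
    then have "square_integrable M X"
      using distributed_integrable[OF D, of "\<lambda>x. x\<^sup>2"] by (simp add: square_integrable_def)
    moreover have "expectation (\<lambda>\<omega>. (X \<omega>)\<^sup>2) = \<sigma>\<^sup>2"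
      using normal_distributed_variance[OF \<open>0 < \<sigma>\<close> D] mean by simp
    ultimately show thesis
      using normal \<open>0 < \<sigma>\<close> D by blast
  next
    case (2 \<mu>)
    have "expectation X = expectation (\<lambda>_. \<mu>)"
      using 2 by (intro integral_cong_AE) auto
    then have "\<mu> = 0"
      using mean by (simp add: prob_space)
    with 2 have ae: "AE \<omega> in M. X \<omega> = 0"
      by simp
    then have ae2: "AE \<omega> in M. (X \<omega>)\<^sup>2 = 0"
      by eventually_elim simp
    have "integrable M (\<lambda>\<omega>. (X \<omega>)\<^sup>2) \<longleftrightarrow> integrable M (\<lambda>\<omega>. 0 :: real)"
      using ae2 by (intro integrable_cong_AE) auto
    moreover have "expectation (\<lambda>\<omega>. (X \<omega>)\<^sup>2) = expectation (\<lambda>\<omega>. 0)"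
      using ae2 by (intro integral_cong_AE) auto
    ultimately show thesis
      using degenerate ae by (simp add: square_integrable_def)
  qed
qed

lemma (in prob_space) gaussian_rv_integral_cos:
  assumes X: "gaussian_rv M X" and mean: "expectation X = 0"
  shows "expectation (\<lambda>\<omega>. cos (X \<omega> + \<theta>)) = cos \<theta> * exp (- expectation (\<lambda>\<omega>. (X \<omega>)\<^sup>2) / 2)"
  using assms
proof (cases rule: gaussian_rv_centered)
  case (normal \<sigma>)
  then show ?thesis
    by (simp add: normal_integral_cos)
next
  case degenerate
  have "AE \<omega> in M. cos (X \<omega> + \<theta>) = cos \<theta>"
    using degenerate(1) by eventually_elim simp
  then have "expectation (\<lambda>\<omega>. cos (X \<omega> + \<theta>)) = expectation (\<lambda>\<omega>. cos \<theta>)"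
    using X by (intro integral_cong_AE) (auto simp: gaussian_rv_def)
  then show ?thesis
    using degenerate(3) by (simp add: prob_space)
qed

lemma (in prob_space) gaussian_rv_distr:
  assumes X: "gaussian_rv M X" and mean: "expectation X = 0" and var: "expectation (\<lambda>\<omega>. (X \<omega>)\<^sup>2) = 1"
  shows "distr M borel X = std_normal_distribution"
  using X mean
proof (cases rule: gaussian_rv_centered)
  case (normal \<sigma>)
  then have "\<sigma> = 1"
    using var by (auto simp: power2_eq_1_iff)
  with normal have "distr M lborel X = std_normal_distribution"
    by (simp add: distributed_def)
  moreover have "distr M borel X = distr M lborel X"
    by (rule distr_cong) simp_all
  ultimately show ?thesis
    by simp
next
  case degenerate
  then show ?thesis
    using var by simp
qed

locale stationary_gaussian = prob_space M for M :: "'a measure" +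
  fixes \<eta> :: "nat \<Rightarrow> 'a \<Rightarrow> real" and \<gamma> :: "nat \<Rightarrow> real"
  assumes gauss: "gaussian_sequence M \<eta>"
    and stat: "stationary_sequence M \<eta>"
    and mean: "integral\<^sup>L M (\<eta> 1) = 0"
    and var: "(\<integral>\<omega>. (\<eta> 1 \<omega>)\<^sup>2 \<partial>M) = 1"
    and cov: "\<And>k. \<gamma> k = (\<integral>\<omega>. \<eta> 1 \<omega> * \<eta> (k + 1) \<omega> \<partial>M)"
    and cov_pos: "\<And>k. 0 < \<gamma> k"
begin

lemma measurable_eta: "1 \<le> i \<Longrightarrow> \<eta> i \<in> borel_measurable M"
  using stat by (simp add: stationary_sequence_def)

lemma gaussian_eta: "1 \<le> i \<Longrightarrow> gaussian_rv M (\<eta> i)"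
  using gauss[unfolded gaussian_sequence_def, rule_format, of "{i}" "\<lambda>_. 1"] by simp

lemma stationary_expectation:
  assumes [measurable]: "case_prod h \<in> borel_measurable (borel \<Otimes>\<^sub>M borel)" and "1 \<le> i" "1 \<le> j"
  shows "expectation (\<lambda>\<omega>. h (\<eta> (i + n) \<omega>) (\<eta> (j + n) \<omega>)) = (expectation (\<lambda>\<omega>. h (\<eta> i \<omega>) (\<eta> j \<omega>)) :: real)"
proof -
  let ?P = "\<Pi>\<^sub>M n\<in>{1::nat..}. (borel :: real measure)"
  let ?D = "\<lambda>n. distr M ?P (\<lambda>\<omega>. \<lambda>k\<in>{1..}. \<eta> (k + n) \<omega>)"
  have shift: "(\<integral>x. h (x i) (x j) \<partial>?D n) = expectation (\<lambda>\<omega>. h (\<eta> (i + n) \<omega>) (\<eta> (j + n) \<omega>))" for n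
  proof (subst integral_distr)
    show "(\<lambda>\<omega>. \<lambda>k\<in>{1..}. \<eta> (k + n) \<omega>) \<in> M \<rightarrow>\<^sub>M ?P"
      by (rule measurable_restrict) (simp add: measurable_eta)
    have "(\<lambda>x. x i) \<in> borel_measurable ?P" "(\<lambda>x. x j) \<in> borel_measurable ?P"
      using assms(2,3) by (auto intro!: measurable_component_singleton)
    then show "(\<lambda>x. h (x i) (x j)) \<in> borel_measurable ?P"
      using measurable_compose[OF measurable_Pair assms(1)] by simp
  qed (use assms(2,3) in simp)
  have "?D n = ?D 0"
    using stat by (simp add: stationary_sequence_def)
  then show ?thesis
    using shift[of n] shift[of 0] by simp
qed

lemma expectation_eta: "1 \<le> i \<Longrightarrow> expectation (\<eta> i) = 0"
  using stationary_expectation[of "\<lambda>x y. x" 1 1 "i - 1"] mean by simp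

lemma expectation_eta_square: "1 \<le> i \<Longrightarrow> expectation (\<lambda>\<omega>. (\<eta> i \<omega>)\<^sup>2) = 1"
  using stationary_expectation[of "\<lambda>x y. x\<^sup>2" 1 1 "i - 1"] var by simp

text \<open>In natural numbers, \<open>\<bar>i - j\<bar>\<close> is \<open>i - j + (j - i)\<close>.\<close>

lemma expectation_eta_mult:
  assumes "1 \<le> i" "1 \<le> j"
  shows "expectation (\<lambda>\<omega>. \<eta> i \<omega> * \<eta> j \<omega>) = \<gamma> (i - j + (j - i))"
proof -
  have le: "expectation (\<lambda>\<omega>. \<eta> i \<omega> * \<eta> j \<omega>) = \<gamma> (j - i)" if "1 \<le> i" "i \<le> j" for i j
    using stationary_expectation[of "\<lambda>x y. x * y" 1 "j - i + 1" "i - 1"] that by (simp add: cov)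
  show ?thesis
    using assms le[of i j] le[of j i] by (cases "i \<le> j") (simp_all add: mult.commute)
qed

lemma square_integrable_eta:
  assumes "1 \<le> i"
  shows "square_integrable M (\<eta> i)"
  using gaussian_eta[OF assms] expectation_eta[OF assms] by (cases rule: gaussian_rv_centered)

lemma distr_eta: "1 \<le> i \<Longrightarrow> distr M borel (\<eta> i) = std_normal_distribution"
  by (intro gaussian_rv_distr gaussian_eta expectation_eta expectation_eta_square)

lemma covariance_le_1: "\<gamma> k \<le> 1"
  using Cauchy_Schwarz_integral[OF square_integrable_eta[of 1] square_integrable_eta[of "k + 1"]]
    expectation_eta_square[of 1] expectation_eta_square[of "k + 1"] by (simp add: cov)

text \<open>Every linear combination of \<open>\<eta> i\<close> and \<open>\<eta> j\<close> is
  centred Gaussian, possibly degenerate, so its variance determines its characteristic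
  function.\<close>

lemma gaussian_pair_eta:
  assumes i: "1 \<le> i" and j: "1 \<le> j"
  shows "gaussian_pair M (\<gamma> (i - j + (j - i))) (\<eta> i) (\<eta> j)"
  unfolding gaussian_pair_def
proof (intro conjI allI measurable_eta i j)
  fix s t \<theta> :: real
  define W where "W \<omega> = s * \<eta> i \<omega> + t * \<eta> j \<omega>" for \<omega>
  note sq [simp] = square_integrable_eta[OF i] square_integrable_eta[OF j]
  have one: "square_integrable M (\<lambda>_. 1)"
    by (simp add: square_integrable_def)
  have int [simp]: "integrable M (\<eta> i)" "integrable M (\<eta> j)"
    using square_integrable_mult[OF sq(1) one] square_integrable_mult[OF sq(2) one] by simp_all
  \<comment> \<open>The coefficient adds two conditionals because \<open>{i, j}\<close> is a
    singleton for \<open>i = j\<close>, where it has to be \<open>s + t\<close>.\<close>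
  have "(\<Sum>k\<in>{i, j}. ((if k = i then s else 0) + (if k = j then t else 0)) * \<eta> k \<omega>) = W \<omega>" for \<omega>
    by (cases "i = j") (auto simp: W_def algebra_simps)
  then have "gaussian_rv M W"
    using gauss[unfolded gaussian_sequence_def, rule_format,
        of "{i, j}" "\<lambda>k. (if k = i then s else 0) + (if k = j then t else 0)"] i j
    by simp
  moreover have "expectation W = 0"
    using i j by (simp add: W_def[abs_def] expectation_eta)
  ultimately have "expectation (\<lambda>\<omega>. cos (W \<omega> + \<theta>)) = cos \<theta> * exp (- expectation (\<lambda>\<omega>. (W \<omega>)\<^sup>2) / 2)"
    by (rule gaussian_rv_integral_cos)
  also have "expectation (\<lambda>\<omega>. (W \<omega>)\<^sup>2) =
     expectation (\<lambda>\<omega>. s\<^sup>2 * (\<eta> i \<omega>)\<^sup>2 + (t\<^sup>2 * (\<eta> j \<omega>)\<^sup>2 + 2 * s * t * (\<eta> i \<omega> * \<eta> j \<omega>)))"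
    by (simp add: W_def power2_eq_square algebra_simps)
  also have "\<dots> = s\<^sup>2 + t\<^sup>2 + 2 * \<gamma> (i - j + (j - i)) * s * t"
    using i j square_integrableD(2)[OF sq(1)] square_integrableD(2)[OF sq(2)] square_integrable_mult[OF sq]
    by (simp add: expectation_eta_square expectation_eta_mult)
  finally show "expectation (\<lambda>\<omega>. cos (s * \<eta> i \<omega> + t * \<eta> j \<omega> + \<theta>)) =
      cos \<theta> * exp (- (s\<^sup>2 + t\<^sup>2 + 2 * \<gamma> (i - j + (j - i)) * s * t) / 2)"
    by (simp add: W_def)
qed

text \<open>Each lag below \<open>b - a\<close> occurs at most once on either side of
  \<open>i\<close>; counting lag 0 twice only enlarges the bound.\<close>

lemma sum_covariance_le:
  assumes "a < i" "i \<le> b"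
  shows "(\<Sum>j\<in>{a<..b}. \<gamma> (i - j + (j - i)) ^ q) \<le> 2 * (\<Sum>k<b - a. \<gamma> k ^ q)"
proof -
  have nn: "0 \<le> \<gamma> k ^ q" for k
    using cov_pos[of k] by simp
  have "(\<Sum>j\<in>{a<..b}. \<gamma> (i - j + (j - i)) ^ q) \<le>
      (\<Sum>j\<in>{a<..i}. \<gamma> (i - j + (j - i)) ^ q) + (\<Sum>j\<in>{i..b}. \<gamma> (i - j + (j - i)) ^ q)"
  proof -
    have split: "{a<..b} = {a<..i} \<union> {i..b}"
      using assms by auto
    have "0 \<le> (\<Sum>j\<in>{a<..i} \<inter> {i..b}. \<gamma> (i - j + (j - i)) ^ q)"
      by (intro sum_nonneg nn)
    moreover have "(\<Sum>j\<in>{a<..i} \<union> {i..b}. \<gamma> (i - j + (j - i)) ^ q) + (\<Sum>j\<in>{a<..i} \<inter> {i..b}. \<gamma> (i - j + (j - i)) ^ q) =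
        (\<Sum>j\<in>{a<..i}. \<gamma> (i - j + (j - i)) ^ q) + (\<Sum>j\<in>{i..b}. \<gamma> (i - j + (j - i)) ^ q)"
      by (rule sum.union_inter) simp_all
    ultimately show ?thesis
      unfolding split by linarith
  qed
  also have "(\<Sum>j\<in>{a<..i}. \<gamma> (i - j + (j - i)) ^ q) = (\<Sum>k\<in>(\<lambda>j. i - j) ` {a<..i}. \<gamma> k ^ q)"
    by (subst sum.reindex) (auto simp: inj_on_def)
  also have "\<dots> \<le> (\<Sum>k<b - a. \<gamma> k ^ q)"
    using assms nn by (intro sum_mono2) auto
  also have "(\<Sum>j\<in>{i..b}. \<gamma> (i - j + (j - i)) ^ q) = (\<Sum>k\<in>(\<lambda>j. j - i) ` {i..b}. \<gamma> k ^ q)"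
    by (subst sum.reindex) (auto simp: inj_on_def)
  also have "\<dots> \<le> (\<Sum>k<b - a. \<gamma> k ^ q)"
    using assms nn by (intro sum_mono2) auto
  finally show ?thesis
    by simp
qed

lemma square_integrable_comp_eta:
  assumes f: "square_integrable std_normal_distribution f" and i: "1 \<le> i"
  shows "square_integrable M (\<lambda>\<omega>. f (\<eta> i \<omega>))"
    and "expectation (\<lambda>\<omega>. (f (\<eta> i \<omega>))\<^sup>2) = (\<integral>x. (f x)\<^sup>2 \<partial>std_normal_distribution)"
proof -
  have [measurable]: "\<eta> i \<in> borel_measurable M" "f \<in> borel_measurable borel"
    using measurable_eta[OF i] f by (auto simp: square_integrable_def)
  show "square_integrable M (\<lambda>\<omega>. f (\<eta> i \<omega>))"
    using f unfolding distr_eta[OF i, symmetric] square_integrable_def by (simp add: integrable_distr_eq)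
  show "expectation (\<lambda>\<omega>. (f (\<eta> i \<omega>))\<^sup>2) = (\<integral>x. (f x)\<^sup>2 \<partial>std_normal_distribution)"
    unfolding distr_eta[OF i, symmetric] by (simp add: integral_distr)
qed

text \<open>Expanding the square gives pairwise covariances, each bounded through
  \<open>gaussian_pair_covariance_le\<close>; the rows of this matrix are then summed by
  lag.\<close>

lemma second_moment_block_sum_le:
  assumes f: "square_integrable std_normal_distribution f"
    and orth: "\<And>l. l < q \<Longrightarrow> hermite_coeff l f = 0"
  shows "expectation (\<lambda>\<omega>. (\<Sum>i\<in>{a<..b}. f (\<eta> i \<omega>))\<^sup>2) \<le>
    2 * real (b - a) * (\<Sum>k<b - a. \<gamma> k ^ q) * (\<integral>x. (f x)\<^sup>2 \<partial>std_normal_distribution)"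
    and "integrable M (\<lambda>\<omega>. (\<Sum>i\<in>{a<..b}. f (\<eta> i \<omega>))\<^sup>2)"
proof -
  have int: "integrable M (\<lambda>\<omega>. f (\<eta> i \<omega>) * f (\<eta> j \<omega>))" if "i \<in> {a<..b}" "j \<in> {a<..b}" for i j
    using that by (intro square_integrable_mult square_integrable_comp_eta(1) f) auto
  have eq: "(\<Sum>i\<in>{a<..b}. f (\<eta> i \<omega>))\<^sup>2 = (\<Sum>i\<in>{a<..b}. \<Sum>j\<in>{a<..b}. f (\<eta> i \<omega>) * f (\<eta> j \<omega>))" for \<omega>
    by (simp add: power2_eq_square sum_product)
  show "integrable M (\<lambda>\<omega>. (\<Sum>i\<in>{a<..b}. f (\<eta> i \<omega>))\<^sup>2)"
    unfolding eq by (intro Bochner_Integration.integrable_sum int)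
  let ?N = "\<integral>x. (f x)\<^sup>2 \<partial>std_normal_distribution"
  have N: "0 \<le> ?N"
    by (rule Bochner_Integration.integral_nonneg) simp
  have "expectation (\<lambda>\<omega>. (\<Sum>i\<in>{a<..b}. f (\<eta> i \<omega>))\<^sup>2) =
      (\<Sum>i\<in>{a<..b}. expectation (\<lambda>\<omega>. \<Sum>j\<in>{a<..b}. f (\<eta> i \<omega>) * f (\<eta> j \<omega>)))"
    unfolding eq by (intro Bochner_Integration.integral_sum Bochner_Integration.integrable_sum int)
  also have "\<dots> = (\<Sum>i\<in>{a<..b}. \<Sum>j\<in>{a<..b}. expectation (\<lambda>\<omega>. f (\<eta> i \<omega>) * f (\<eta> j \<omega>)))"
    by (intro sum.cong refl Bochner_Integration.integral_sum int)
  also have "\<dots> \<le> (\<Sum>i\<in>{a<..b}. \<Sum>j\<in>{a<..b}. \<gamma> (i - j + (j - i)) ^ q * ?N)"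
    using cov_pos covariance_le_1
    by (intro sum_mono gaussian_pair_covariance_le gaussian_pair_eta prob_space_axioms distr_eta f orth)
       (auto intro: less_imp_le)
  also have "\<dots> = (\<Sum>i\<in>{a<..b}. \<Sum>j\<in>{a<..b}. \<gamma> (i - j + (j - i)) ^ q) * ?N"
    by (simp add: sum_distrib_right)
  also have "\<dots> \<le> (\<Sum>i\<in>{a<..b}. 2 * (\<Sum>k<b - a. \<gamma> k ^ q)) * ?N"
    by (intro mult_right_mono sum_mono sum_covariance_le N) auto
  finally show "expectation (\<lambda>\<omega>. (\<Sum>i\<in>{a<..b}. f (\<eta> i \<omega>))\<^sup>2) \<le> 2 * real (b - a) * (\<Sum>k<b - a. \<gamma> k ^ q) * ?N"
    by (simp add: mult_ac)
qed

text \<open>For large \<open>k\<close> the summand is at most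
  \<open>k powr (\<beta> - \<delta> / 2)\<close> times \<open>1 / k\<close>. Evaluating the power at
  \<open>n\<close> leaves a harmonic sum, which treats \<open>q * D\<close> below, at and above 1
  alike; its logarithm costs \<open>n powr (\<delta> / 2)\<close>.\<close>

lemma sum_covariance_power_bound:
  assumes L: "slowly_varying L"
    and decay: "\<forall>\<^sub>F k in sequentially. \<gamma> k = real k powr (- D) * L (real k)"
    and "0 < q" "0 < \<delta>"
  shows "\<exists>C\<ge>0. \<forall>n\<ge>1. (\<Sum>k<n. \<gamma> k ^ q) \<le> C * real n powr (max 0 (1 - real q * D) + \<delta>)"
proof -
  define \<beta> where "\<beta> = max 0 (1 - real q * D) + \<delta>"
  \<comment> \<open>Chosen so that \<open>q * e = \<delta> / 2\<close>: half of the slack pays for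
    the slowly varying factor.\<close>
  define e where "e = \<delta> / (2 * real q)"
  have "0 < e"
    using assms by (simp add: e_def)
  have "\<forall>\<^sub>F k::nat in sequentially. L (real k) \<le> real k powr e"
    using eventually_compose_filterlim[OF slowly_varying_bounds[OF L \<open>0 < e\<close>] filterlim_real_sequentially]
    by (rule eventually_mono) simp
  with decay have "\<forall>\<^sub>F k in sequentially. \<gamma> k ^ q \<le> real k powr (\<beta> - \<delta> / 2) * (1 / real k)"
    using eventually_ge_at_top[of 1]
  proof eventually_elim
    case (elim k)
    have "\<gamma> k \<le> real k powr (- D) * real k powr e"
      using elim by (simp add: mult_left_mono)
    then have "\<gamma> k ^ q \<le> (real k powr (e - D)) ^ q"
      using cov_pos[of k] by (intro power_mono) (auto simp flip: powr_add)
    also have "\<dots> = real k powr (real q * (e - D))"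
      using elim by (simp add: powr_powr mult.commute flip: powr_realpow)
    also have "\<dots> \<le> real k powr (\<beta> - \<delta> / 2 - 1)"
    proof (rule powr_mono)
      have "real q * e = \<delta> / 2"
        using assms by (simp add: e_def)
      then show "real q * (e - D) \<le> \<beta> - \<delta> / 2 - 1"
        by (simp add: \<beta>_def right_diff_distrib)
    qed (use elim in simp)
    also have "\<dots> = real k powr (\<beta> - \<delta> / 2) * (1 / real k)"
      using elim by (simp add: powr_diff)
    finally show ?case .
  qed
  then obtain K where K: "\<And>k. k \<ge> K \<Longrightarrow> \<gamma> k ^ q \<le> real k powr (\<beta> - \<delta> / 2) * (1 / real k)"
    by (auto simp: eventually_sequentially)
  define C where "C = real K + 1 + 2 / \<delta>"
  have "(\<Sum>k<n. \<gamma> k ^ q) \<le> C * real n powr \<beta>" if n: "n \<ge> 1" for n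
  proof -
    have b: "0 \<le> \<beta> - \<delta> / 2" "0 \<le> \<beta>"
      using assms by (auto simp: \<beta>_def)
    \<comment> \<open>The finitely many lags below \<open>K\<close> are estimated by 1; for the
      others, \<open>\<beta> - \<delta> / 2 \<ge> 0\<close> allows replacing \<open>k\<close> by
      \<open>n\<close> in the power.\<close>
    have "\<gamma> k ^ q \<le> of_bool (k < K) + real n powr (\<beta> - \<delta> / 2) * (1 / real k)" if "k < n" for k
    proof (cases "k < K")
      case True
      have "\<gamma> k ^ q \<le> 1"
        using covariance_le_1[of k] cov_pos[of k] by (intro power_le_one) auto
      with True show ?thesis
        by (simp add: add_increasing2)
    next
      case False
      then have "\<gamma> k ^ q \<le> real k powr (\<beta> - \<delta> / 2) * (1 / real k)"
        by (intro K) simp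
      also have "\<dots> \<le> real n powr (\<beta> - \<delta> / 2) * (1 / real k)"
        using that b by (intro mult_right_mono powr_mono2) auto
      finally show ?thesis
        using False by simp
    qed
    then have "(\<Sum>k<n. \<gamma> k ^ q) \<le> (\<Sum>k<n. of_bool (k < K) + real n powr (\<beta> - \<delta> / 2) * (1 / real k))"
      by (intro sum_mono) auto
    also have "\<dots> = real (card {k. k < n \<and> k < K}) + real n powr (\<beta> - \<delta> / 2) * (\<Sum>k<n. 1 / real k)"
      by (simp add: sum.distrib sum_distrib_left Collect_conj_eq lessThan_def Int_commute)
    also have "\<dots> \<le> real K + real n powr (\<beta> - \<delta> / 2) * (1 + ln (real n))"
    proof (intro add_mono mult_left_mono)
      have "card {k. k < n \<and> k < K} \<le> card {..<K}"
        by (intro card_mono) auto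
      then show "real (card {k. k < n \<and> k < K}) \<le> real K"
        by simp
      \<comment> \<open>The summand at 0 is \<open>1 / 0 = 0\<close>, so including that index does
        not change the harmonic number.\<close>
      have "(\<Sum>k<n. 1 / real k) \<le> (\<Sum>k\<in>insert 0 {1..n}. 1 / real k)"
        by (intro sum_mono2) auto
      also have "\<dots> = harm n"
        by (simp add: harm_def inverse_eq_divide)
      also have "\<dots> \<le> 1 + ln (real n)"
        using decseqD[OF decseq_harm_diff_ln, of 0 "n - 1"] n by (simp add: harm_expand)
      finally show "(\<Sum>k<n. 1 / real k) \<le> 1 + ln (real n)" .
    qed simp
    also have "\<dots> \<le> real K * real n powr \<beta> + real n powr (\<beta> - \<delta> / 2) * ((1 + 2 / \<delta>) * real n powr (\<delta> / 2))"
    proof (intro add_mono mult_left_mono)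
      show "real K \<le> real K * real n powr \<beta>"
        using n b ge_one_powr_ge_zero[of "real n" \<beta>] by (simp add: mult_le_cancel_left1)
      show "1 + ln (real n) \<le> (1 + 2 / \<delta>) * real n powr (\<delta> / 2)"
      proof -
        have "ln (real n) \<le> 2 / \<delta> * real n powr (\<delta> / 2)"
          using n assms ln_powr_bound[of "real n" "\<delta> / 2"] by (simp add: mult.commute)
        moreover have "1 \<le> real n powr (\<delta> / 2)"
          using n assms by (simp add: ge_one_powr_ge_zero)
        ultimately show ?thesis
          unfolding distrib_right by linarith
      qed
    qed simp
    also have "\<dots> = C * real n powr \<beta>"
      using n by (simp add: C_def algebra_simps flip: powr_add)
    finally show ?thesis .
  qed
  then show ?thesis
    unfolding \<beta>_def[symmetric] using assms by (intro exI[of _ C]) (auto simp: C_def)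
qed

end

section \<open>The reduction error\<close>

text \<open>The series of \<open>Z k / w k\<close> has finite expectation, hence is finite almost
  surely, and it dominates each of its terms. This takes the place of a Borel-Cantelli
  argument.\<close>

lemma (in prob_space) AE_bounded_if_summable_expectations:
  fixes Z :: "nat \<Rightarrow> 'a \<Rightarrow> real"
  assumes int: "\<And>k. integrable M (Z k)" and nn: "\<And>k \<omega>. 0 \<le> Z k \<omega>"
    and w: "\<And>k. 0 < w k" and le: "\<And>k. expectation (Z k) \<le> w k * s k" and s: "summable s"
  shows "AE \<omega> in M. \<exists>C. \<forall>k. Z k \<omega> \<le> C * w k"
proof -
  have s_nn: "0 \<le> s k" for k
  proof -
    have "0 \<le> w k * s k"
      using Bochner_Integration.integral_nonneg[of M "Z k"] nn le[of k] by (meson order_trans)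
    then show ?thesis
      using w[of k] by (simp add: zero_le_mult_iff)
  qed
  have [measurable]: "Z k \<in> borel_measurable M" for k
    using int by auto
  let ?T = "\<lambda>\<omega>. \<Sum>k. ennreal (Z k \<omega> / w k)"
  have "(\<integral>\<^sup>+\<omega>. ?T \<omega> \<partial>M) = (\<Sum>k. \<integral>\<^sup>+\<omega>. ennreal (Z k \<omega> / w k) \<partial>M)"
    by (rule nn_integral_suminf) simp
  also have "\<dots> = (\<Sum>k. ennreal (expectation (Z k) / w k))"
    using int nn w by (simp add: nn_integral_eq_integral less_imp_le)
  also have "\<dots> \<le> (\<Sum>k. ennreal (s k))"
    using le w by (intro suminf_le ennreal_leI) (auto simp: divide_le_eq mult.commute)
  also have "\<dots> = ennreal (suminf s)"
    by (rule suminf_ennreal2[OF s_nn s])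
  finally have "(\<integral>\<^sup>+\<omega>. ?T \<omega> \<partial>M) \<noteq> \<infinity>"
    by (auto simp: top_unique)
  then have "AE \<omega> in M. ?T \<omega> \<noteq> \<infinity>"
    by (intro nn_integral_PInf_AE) simp_all
  then show ?thesis
  proof eventually_elim
    case (elim \<omega>)
    then obtain C where C: "?T \<omega> = ennreal C" "0 \<le> C"
      by (metis ennreal_cases infinity_ennreal_def)
    have "Z k \<omega> \<le> C * w k" for k
    proof -
      have "ennreal (Z k \<omega> / w k) = (\<Sum>i\<in>{k}. ennreal (Z i \<omega> / w i))"
        by simp
      also have "\<dots> \<le> ?T \<omega>"
        by (rule sum_le_suminf) auto
      finally have "Z k \<omega> / w k \<le> C"
        using C by simp
      then show ?thesis
        using w[of k] by (simp add: divide_le_eq)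
    qed
    then show ?case
      by blast
  qed
qed

locale subordinated_gaussian = stationary_gaussian +
  fixes G F :: "real \<Rightarrow> real" and \<tau> :: nat
  assumes G_meas [measurable]: "G \<in> borel_measurable borel"
    and F: "F = cdf (distr M borel (\<lambda>\<omega>. G (\<eta> 1 \<omega>)))"
    and F_cont: "continuous_on UNIV F"
    and rank: "is_hermite_rank F G \<tau>"
begin

lemma rank_ge_1: "1 \<le> \<tau>"
  using rank by (simp add: is_hermite_rank_def is_smallest_def)

lemma F_eq_cdf: "F = cdf (distr std_normal_distribution borel G)"
proof -
  have "distr M borel (\<lambda>\<omega>. G (\<eta> 1 \<omega>)) = distr (distr M borel (\<eta> 1)) borel G"
    using measurable_eta[of 1] by (subst distr_distr) (simp_all add: comp_def)
  then show ?thesis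
    by (simp add: F distr_eta)
qed

lemma real_distribution_G: "real_distribution (distr std_normal_distribution borel G)"
proof -
  interpret N: prob_space std_normal_distribution
    by (rule prob_space_std_normal)
  show ?thesis
    by (rule N.real_distribution_distr) simp
qed

lemma F_measure: "F x = measure std_normal_distribution {z. G z \<le> x}"
  by (simp add: F_eq_cdf cdf_def measure_distr vimage_def)

lemma F_bounds: "0 \<le> F x" "F x \<le> 1"
  by (simp_all add: F_measure prob_space.prob_le_1[OF prob_space_std_normal])

lemma F_mono: "x \<le> y \<Longrightarrow> F x \<le> F y"
  using real_distribution_G
  by (simp add: F_eq_cdf finite_borel_measure.cdf_nondecreasing real_distribution.finite_borel_measure_M)

lemma F_measurable [measurable]: "F \<in> borel_measurable borel"
  using F_cont by (rule borel_measurable_continuous_onI)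

text \<open>Continuity makes the sublevel set closed and forces the value \<open>y\<close> at its
  right end point. The event \<open>F (G z) \<le> y\<close> thereby becomes
  \<open>G z \<le> b\<close>, which links \<open>J_coeff\<close> at \<open>y\<close> to
  \<open>c_coeff\<close> at \<open>b\<close>.\<close>

lemma F_sublevel:
  assumes "0 < y" "y < 1"
  shows "\<exists>b. F b = y \<and> (\<forall>x. F x \<le> y \<longleftrightarrow> x \<le> b)"
proof -
  interpret D: real_distribution "distr std_normal_distribution borel G"
    by (rule real_distribution_G)
  let ?A = "{x. F x \<le> y}"
  have "(F \<longlongrightarrow> 0) at_bot" "(F \<longlongrightarrow> 1) at_top"
    unfolding F_eq_cdf by (rule D.cdf_lim_at_bot, rule D.cdf_lim_at_top_prob)
  then have "\<forall>\<^sub>F x in at_bot. F x < y" "\<forall>\<^sub>F x in at_top. F x > y"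
    using assms by (auto intro: order_tendstoD)
  then obtain l u where l: "F l < y" and u: "F u > y"
    by (metis (mono_tags, lifting) eventually_at_bot_linorder eventually_at_top_linorder order_refl)
  have ne: "?A \<noteq> {}"
    using l by (auto intro!: exI[of _ l])
  have bdd: "bdd_above ?A"
  proof (rule bdd_aboveI)
    show "x \<le> u" if "x \<in> ?A" for x
      using that u F_mono[of u x] by (cases "x \<le> u") auto
  qed
  have "closed ?A"
    by (intro closed_Collect_le F_cont continuous_on_const)
  then have b: "Sup ?A \<in> ?A"
    by (rule closed_contains_Sup[OF ne bdd])
  have iff: "F x \<le> y \<longleftrightarrow> x \<le> Sup ?A" for x
    using cSup_upper[OF _ bdd, of x] b F_mono[of x "Sup ?A"] by auto
  have "continuous_on {Sup ?A..u} F"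
    using F_cont by (rule continuous_on_subset) simp
  moreover have "Sup ?A \<le> u"
    using u iff[of u] by simp
  ultimately obtain x where x: "Sup ?A \<le> x" "F x = y"
    using IVT'[of F "Sup ?A" y u] b u by auto
  then have "x = Sup ?A"
    using iff[of x] by simp
  then show ?thesis
    using iff x(2) by blast
qed

lemma sublevel_measurable [measurable]: "{z. F (G z) \<le> y} \<in> sets borel"
  by measurable

lemma uniform_transform:
  assumes "y \<in> {0..1}"
  shows "measure std_normal_distribution {z. F (G z) \<le> y} = y"
proof -
  interpret N: prob_space std_normal_distribution
    by (rule prob_space_std_normal)
  have inner: "measure std_normal_distribution {z. F (G z) \<le> y} = y" if y: "0 < y" "y < 1" for y
  proof -
    obtain b where b: "F b = y" "\<And>x. F x \<le> y \<longleftrightarrow> x \<le> b"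
      using F_sublevel[OF y] by blast
    then show ?thesis
      using F_measure[of b] by simp
  qed
  consider "y = 0" | "y = 1" | "0 < y \<and> y < 1"
    using assms by force
  then show ?thesis
  proof cases
    case 1
    \<comment> \<open>Level 0 is approached from above; the minimum with \<open>1/2\<close> keeps
      the comparison level inside the open unit interval.\<close>
    have "measure std_normal_distribution {z. F (G z) \<le> 0} \<le> 0 + e" if "0 < e" for e
    proof -
      define e' where "e' = min e (1/2)"
      have "measure std_normal_distribution {z. F (G z) \<le> 0} \<le> measure std_normal_distribution {z. F (G z) \<le> e'}"
        using that by (intro N.finite_measure_mono) (auto simp: e'_def)
      also have "\<dots> = e'"
        using that by (intro inner) (auto simp: e'_def)
      finally show ?thesis
        by (simp add: e'_def)
    qed
    then have "measure std_normal_distribution {z. F (G z) \<le> 0} \<le> 0"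
      by (rule field_le_epsilon)
    then show ?thesis
      using 1 measure_nonneg[of std_normal_distribution "{z. F (G z) \<le> 0}"] by simp
  next
    case 2
    then have "{z. F (G z) \<le> y} = UNIV"
      using F_bounds(2) by auto
    then show ?thesis
      using N.prob_space 2 by simp
  qed (use inner in auto)
qed

definition cent :: "real \<Rightarrow> real \<Rightarrow> real" where
  "cent y z = of_bool (F (G z) \<le> y) - y"

text \<open>Since \<open>hermite \<tau>\<close> has squared norm \<open>\<tau>!\<close>, the
  subtracted term is the orthogonal projection of \<open>cent y\<close> on it.\<close>

definition resid :: "real \<Rightarrow> real \<Rightarrow> real" where
  "resid y z = cent y z - J_coeff F G \<tau> y / fact \<tau> * hermite \<tau> z"

lemma J_coeff_eq: "J_coeff F G l y = hermite_coeff l (cent y)"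
  by (simp add: J_coeff_def hermite_coeff_def cent_def)

lemma cent_measurable [measurable]: "cent y \<in> borel_measurable borel"
  unfolding cent_def[abs_def] by measurable

lemma square_integrable_cent: "square_integrable std_normal_distribution (cent y)"
proof -
  interpret N: prob_space std_normal_distribution
    by (rule prob_space_std_normal)
  show ?thesis
    by (rule N.square_integrable_bounded[where B = "1 + \<bar>y\<bar>"]) (auto simp: cent_def)
qed

lemma square_integrable_resid: "square_integrable std_normal_distribution (resid y)"
  unfolding resid_def[abs_def]
  by (intro square_integrable_diff square_integrable_cmult square_integrable_cent square_integrable_hermite)

lemma AE_cent_endpoint:
  assumes "y = 0 \<or> y = 1"
  shows "AE z in std_normal_distribution. cent y z = 0"
proof (cases "y = 0")
  case True
  interpret N: prob_space std_normal_distribution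
    by (rule prob_space_std_normal)
  have "measure std_normal_distribution {z. F (G z) \<le> 0} = 0"
    by (rule uniform_transform) simp
  then have "{z. F (G z) \<le> 0} \<in> null_sets std_normal_distribution"
    by (simp add: null_sets_def N.emeasure_eq_measure)
  from AE_not_in[OF this] have "AE z in std_normal_distribution. \<not> F (G z) \<le> 0"
    by simp
  then show ?thesis
    by eventually_elim (simp add: cent_def True)
next
  case False
  then show ?thesis
    using assms F_bounds by (simp add: cent_def)
qed

lemma hermite_coeff_cent_endpoint:
  assumes "y = 0 \<or> y = 1"
  shows "hermite_coeff l (cent y) = 0"
proof -
  have "hermite_coeff l (cent y) = (\<integral>z. 0 \<partial>std_normal_distribution)"
    unfolding hermite_coeff_def using AE_cent_endpoint[OF assms] by (intro integral_cong_AE) auto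
  then show ?thesis
    by simp
qed

text \<open>Degree 0 expresses that \<open>F (G z)\<close> is uniform. For
  \<open>1 \<le> l < \<tau>\<close> and inner \<open>y\<close> the coefficient is
  \<open>c_coeff\<close> at a point \<open>b\<close> with \<open>F b = y\<close>, which vanishes by
  minimality of the rank.\<close>

lemma hermite_coeff_cent:
  assumes "y \<in> {0..1}" "l < \<tau>"
  shows "hermite_coeff l (cent y) = 0"
proof -
  interpret N: prob_space std_normal_distribution
    by (rule prob_space_std_normal)
  consider "y = 0 \<or> y = 1" | "0 < y" "y < 1"
    using assms by force
  then show ?thesis
  proof cases
    case 1
    then show ?thesis
      by (rule hermite_coeff_cent_endpoint)
  next
    case 2
    show ?thesis
    proof (cases "l = 0")
      case True
      have "(\<integral>z. of_bool (F (G z) \<le> y) \<partial>std_normal_distribution) = (\<integral>z. indicat_real {z. F (G z) \<le> y} z \<partial>std_normal_distribution)"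
        by (intro Bochner_Integration.integral_cong) (auto simp: indicator_def)
      then have "(\<integral>z. of_bool (F (G z) \<le> y) \<partial>std_normal_distribution) = y"
        using uniform_transform[OF assms(1)] by simp
      moreover have "integrable std_normal_distribution (\<lambda>z. of_bool (F (G z) \<le> y) :: real)"
        by (rule N.integrable_const_bound[where B = 1]) auto
      ultimately show ?thesis
        using True N.prob_space by (simp add: hermite_coeff_def cent_def hermite_eq_poly)
    next
      case False
      obtain b where b: "F b = y" "\<And>x. F x \<le> y \<longleftrightarrow> x \<le> b"
        using F_sublevel[OF 2] by blast
      have "c_coeff F G l b = 0"
      proof (rule ccontr)
        assume "c_coeff F G l b \<noteq> 0"
        then have "l \<in> {l. 1 \<le> l \<and> (\<exists>x. c_coeff F G l x \<noteq> 0)}"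
          using False by auto
        then have "\<tau> \<le> l"
          using rank unfolding is_hermite_rank_def is_smallest_def by blast
        with assms(2) show False
          by simp
      qed
      then show ?thesis
        using b by (simp add: c_coeff_def hermite_coeff_def cent_def)
    qed
  qed
qed

lemma hermite_coeff_hermite: "l \<le> \<tau> \<Longrightarrow> hermite_coeff l (hermite \<tau>) = (if l = \<tau> then fact \<tau> else 0)"
  by (simp add: hermite_coeff_def integral_hermite_hermite)

lemma hermite_coeff_resid:
  assumes "y \<in> {0..1}" "l < Suc \<tau>"
  shows "hermite_coeff l (resid y) = 0"
proof -
  have "hermite_coeff l (resid y) = hermite_coeff l (cent y) - J_coeff F G \<tau> y / fact \<tau> * hermite_coeff l (hermite \<tau>)"
    unfolding resid_def[abs_def]
    by (simp only: hermite_coeff_diff[OF square_integrable_cent square_integrable_cmult[OF square_integrable_hermite]]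
        hermite_coeff_cmult)
  then show ?thesis
    using assms hermite_coeff_cent[OF assms(1), of l]
    by (cases "l = \<tau>") (auto simp: hermite_coeff_hermite J_coeff_eq)
qed

text \<open>Pythagoras: the squared norm of the residual increment is that of the indicator
  increment, at most \<open>y - x\<close>, minus \<open>c\<^sup>2 / fact \<tau>\<close>. The second
  claim is thus Bessel's inequality, and makes \<open>J_coeff\<close> Hoelder continuous of order
  \<open>1/2\<close>.\<close>

lemma resid_increment:
  assumes "0 \<le> x" "x \<le> y" "y \<le> 1"
  shows "(\<integral>z. (resid y z - resid x z)\<^sup>2 \<partial>std_normal_distribution) \<le> y - x"
    and "(J_coeff F G \<tau> y - J_coeff F G \<tau> x)\<^sup>2 \<le> fact \<tau> * (y - x)"
proof -
  interpret N: prob_space std_normal_distribution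
    by (rule prob_space_std_normal)
  define h where "h z = cent y z - cent x z" for z
  define c where "c = J_coeff F G \<tau> y - J_coeff F G \<tau> x"
  let ?H = "hermite \<tau>"
  have h: "square_integrable std_normal_distribution h"
    unfolding h_def[abs_def] by (intro square_integrable_diff square_integrable_cent)
  have c: "(\<integral>z. h z * ?H z \<partial>std_normal_distribution) = c"
    using hermite_coeff_diff[OF square_integrable_cent square_integrable_cent, of \<tau> y x]
    by (simp add: c_def J_coeff_eq h_def[abs_def] hermite_coeff_def)
  have H2: "(\<integral>z. ?H z * ?H z \<partial>std_normal_distribution) = fact \<tau>"
    by (simp add: integral_hermite_hermite)
  have int_h: "(\<integral>z. h z * h z \<partial>std_normal_distribution) \<le> y - x"
  proof -
    let ?A = "{z. F (G z) \<le> y} - {z. F (G z) \<le> x}"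
    have A: "measure std_normal_distribution ?A = y - x"
      using assms by (subst N.finite_measure_Diff) (auto simp: uniform_transform)
    have hz: "h z = indicator ?A z - (y - x)" for z
      using assms by (auto simp: h_def cent_def indicator_def)
    have "h z * h z = (1 - 2 * (y - x)) * indicator ?A z + (y - x) * (y - x)" for z
      unfolding hz by (simp add: indicator_def algebra_simps)
    then have "(\<integral>z. h z * h z \<partial>std_normal_distribution) =
        (\<integral>z. (1 - 2 * (y - x)) * indicator ?A z + (y - x) * (y - x) \<partial>std_normal_distribution)"
      by simp
    also have "\<dots> = (1 - 2 * (y - x)) * measure std_normal_distribution ?A + (y - x) * (y - x)"
    proof -
      have "integrable std_normal_distribution (indicat_real ?A)"
        by (rule N.integrable_const_bound[where B = 1]) auto
      then show ?thesis
        using N.prob_space by simp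
    qed
    also have "\<dots> = (y - x) - (y - x) * (y - x)"
      by (simp add: A algebra_simps)
    finally show ?thesis
      by simp
  qed
  have eq: "(resid y z - resid x z)\<^sup>2 = h z * h z - 2 * c / fact \<tau> * (h z * ?H z) + (c / fact \<tau>)\<^sup>2 * (?H z * ?H z)" for z
  proof -
    have "resid y z - resid x z = h z - c / fact \<tau> * ?H z"
      by (simp add: resid_def h_def c_def diff_divide_distrib left_diff_distrib)
    then show ?thesis
      by (simp only: power2_diff) (simp add: power2_eq_square mult_ac)
  qed
  note ints = square_integrable_mult[OF h h] square_integrable_mult[OF h square_integrable_hermite]
    square_integrable_mult[OF square_integrable_hermite square_integrable_hermite]
  have "(\<integral>z. (resid y z - resid x z)\<^sup>2 \<partial>std_normal_distribution) =
      (\<integral>z. h z * h z \<partial>std_normal_distribution) - 2 * c / fact \<tau> * c + (c / fact \<tau>)\<^sup>2 * fact \<tau>"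
    unfolding eq using ints by (simp add: c H2)
  also have "\<dots> = (\<integral>z. h z * h z \<partial>std_normal_distribution) - c\<^sup>2 / fact \<tau>"
    by (simp add: power2_eq_square field_simps)
  finally have R: "(\<integral>z. (resid y z - resid x z)\<^sup>2 \<partial>std_normal_distribution) =
    (\<integral>z. h z * h z \<partial>std_normal_distribution) - c\<^sup>2 / fact \<tau>" .
  moreover have "0 \<le> c\<^sup>2 / fact \<tau>"
    by simp
  ultimately show "(\<integral>z. (resid y z - resid x z)\<^sup>2 \<partial>std_normal_distribution) \<le> y - x"
    using int_h by linarith
  have "0 \<le> (\<integral>z. (resid y z - resid x z)\<^sup>2 \<partial>std_normal_distribution)"
    by (rule Bochner_Integration.integral_nonneg) simp
  then have "c\<^sup>2 / fact \<tau> \<le> y - x"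
    using R int_h by linarith
  then show "(J_coeff F G \<tau> y - J_coeff F G \<tau> x)\<^sup>2 \<le> fact \<tau> * (y - x)"
    by (simp add: c_def field_simps)
qed

end

section \<open>Chaining the reduction error in time and level\<close>

context subordinated_gaussian
begin

text \<open>The \<open>R(y, m)\<close> of the overview. Half-open index ranges let consecutive
  dyadic blocks fit together.\<close>

definition err :: "real \<Rightarrow> nat \<Rightarrow> 'a \<Rightarrow> real" where
  "err y m \<omega> = (\<Sum>i\<in>{0<..m}. resid y (\<eta> i \<omega>))"

lemma err_0 [simp]: "err y 0 \<omega> = 0"
  by (simp add: err_def)

lemma err_diff:
  assumes "a \<le> b"
  shows "(err y b \<omega> - err x b \<omega>) - (err y a \<omega> - err x a \<omega>) = (\<Sum>i\<in>{a<..b}. resid y (\<eta> i \<omega>) - resid x (\<eta> i \<omega>))"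
proof -
  have "{0<..b} = {0<..a} \<union> {a<..b}"
    using assms by auto
  then have "err z b \<omega> = err z a \<omega> + (\<Sum>i\<in>{a<..b}. resid z (\<eta> i \<omega>))" for z
    unfolding err_def by (simp only:) (rule sum.union_disjoint, auto)
  then show ?thesis
    by (simp add: sum_subtractf)
qed

text \<open>Level \<open>s\<close> has \<open>2 ^ (k - s)\<close> blocks of length
  \<open>2 ^ s\<close>, so the lengths add up to \<open>2 ^ k\<close> on each of the
  \<open>k + 1\<close> levels. The covariance sum of a block is enlarged to the full range.\<close>

lemma expectation_dyadic_sq_err:
  assumes "0 \<le> x" "x \<le> y" "y \<le> 1"
  shows "expectation (\<lambda>\<omega>. dyadic_sq k (\<lambda>m. err y m \<omega> - err x m \<omega>)) \<le>
      2 * (real k + 1) * 2 ^ k * (\<Sum>i<2 ^ k. \<gamma> i ^ Suc \<tau>) * (y - x)"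
    and "integrable M (\<lambda>\<omega>. dyadic_sq k (\<lambda>m. err y m \<omega> - err x m \<omega>))"
proof -
  let ?f = "\<lambda>z. resid y z - resid x z"
  let ?B = "\<lambda>s c \<omega>. (\<Sum>i\<in>{c * 2 ^ s<..Suc c * 2 ^ s}. ?f (\<eta> i \<omega>))\<^sup>2"
  let ?S = "\<Sum>i<2 ^ k. \<gamma> i ^ Suc \<tau>"
  have f: "square_integrable std_normal_distribution ?f"
    by (intro square_integrable_diff square_integrable_resid)
  have orth: "hermite_coeff l ?f = 0" if "l < Suc \<tau>" for l
    using assms that by (simp only: hermite_coeff_diff[OF square_integrable_resid square_integrable_resid])
      (simp add: hermite_coeff_resid)
  have B1: "expectation (\<lambda>\<omega>. (\<Sum>i\<in>{a<..b}. ?f (\<eta> i \<omega>))\<^sup>2) \<le>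
      2 * real (b - a) * (\<Sum>k<b - a. \<gamma> k ^ Suc \<tau>) * (\<integral>z. (?f z)\<^sup>2 \<partial>std_normal_distribution)" for a b
    by (rule second_moment_block_sum_le(1)[OF f]) (rule orth)
  have B2: "integrable M (\<lambda>\<omega>. (\<Sum>i\<in>{a<..b}. ?f (\<eta> i \<omega>))\<^sup>2)" for a b
    by (rule second_moment_block_sum_le(2)[OF f]) (rule orth)
  have eq: "dyadic_sq k (\<lambda>m. err y m \<omega> - err x m \<omega>) = (\<Sum>s\<le>k. \<Sum>c<2 ^ (k - s). ?B s c \<omega>)" for \<omega>
    unfolding dyadic_sq_def by (intro sum.cong refl arg_cong[where f = "\<lambda>x. x\<^sup>2"] err_diff) simp
  show "integrable M (\<lambda>\<omega>. dyadic_sq k (\<lambda>m. err y m \<omega> - err x m \<omega>))"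
    unfolding eq by (intro Bochner_Integration.integrable_sum B2)
  have "expectation (\<lambda>\<omega>. dyadic_sq k (\<lambda>m. err y m \<omega> - err x m \<omega>)) = (\<Sum>s\<le>k. \<Sum>c<2 ^ (k - s). expectation (?B s c))"
    unfolding eq
    by (subst Bochner_Integration.integral_sum; intro Bochner_Integration.integrable_sum sum.cong refl
        Bochner_Integration.integral_sum B2)
  also have "\<dots> \<le> (\<Sum>s\<le>k. \<Sum>c<(2::nat) ^ (k - s). 2 * 2 ^ s * ?S * (y - x))"
  proof (intro sum_mono)
    fix s c assume "s \<in> {..k}"
    have len: "Suc c * 2 ^ s - c * 2 ^ s = 2 ^ s"
      by simp
    have "expectation (?B s c) \<le> 2 * real (2 ^ s) * (\<Sum>i<2 ^ s. \<gamma> i ^ Suc \<tau>) * (\<integral>z. (?f z)\<^sup>2 \<partial>std_normal_distribution)"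
      using B1[of "c * 2 ^ s" "Suc c * 2 ^ s"] unfolding len .
    also have "\<dots> \<le> 2 * real (2 ^ s) * ?S * (y - x)"
      using \<open>s \<in> {..k}\<close> less_imp_le[OF cov_pos]
      by (intro mult_mono sum_mono2 resid_increment assms)
        (auto intro!: mult_nonneg_nonneg sum_nonneg Bochner_Integration.integral_nonneg order_less_le_trans power_increasing)
    finally show "expectation (?B s c) \<le> 2 * 2 ^ s * ?S * (y - x)"
      by simp
  qed
  also have "\<dots> = (\<Sum>s\<le>k. 2 ^ (k - s) * 2 ^ s * (2 * ?S * (y - x)))"
    by (simp add: mult_ac)
  also have "\<dots> = (\<Sum>s\<le>k. 2 ^ k * (2 * ?S * (y - x)))"
    by (intro sum.cong refl) (simp flip: power_add)
  also have "\<dots> = 2 * (real k + 1) * 2 ^ k * ?S * (y - x)"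
    by (simp add: algebra_simps)
  finally show "expectation (\<lambda>\<omega>. dyadic_sq k (\<lambda>m. err y m \<omega> - err x m \<omega>)) \<le>
      2 * (real k + 1) * 2 ^ k * ?S * (y - x)" .
qed

text \<open>The mesh is the inverse square of the number \<open>2 ^ k\<close> of observations.
  Within a cell, \<open>m * y\<close> then changes by at most 1, and the Hoelder continuous
  \<open>J_coeff\<close> by at most a constant times \<open>1 / 2 ^ k\<close>.\<close>

definition chain_sq :: "nat \<Rightarrow> 'a \<Rightarrow> real" where
  "chain_sq k \<omega> = (\<Sum>r\<le>2 * k. \<Sum>a<2 ^ (2 * k - r).
     dyadic_sq k (\<lambda>m. err (real (Suc a * 2 ^ r) / 2 ^ (2 * k)) m \<omega> - err (real (a * 2 ^ r) / 2 ^ (2 * k)) m \<omega>))"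

text \<open>On every level the lengths of the grid cells add up to 1, so a bound linear in the
  length is paid once for each of the \<open>2 * k + 1\<close> levels.\<close>

lemma expectation_chain_sq:
  shows "expectation (chain_sq k) \<le> (2 * real k + 1) * (2 * (real k + 1) * 2 ^ k * (\<Sum>i<2 ^ k. \<gamma> i ^ Suc \<tau>))"
    and "integrable M (chain_sq k)"
proof -
  let ?S = "\<Sum>i<2 ^ k. \<gamma> i ^ Suc \<tau>"
  let ?x = "\<lambda>r a. real (a * 2 ^ r) / 2 ^ (2 * k)"
  let ?Q = "\<lambda>r a \<omega>. dyadic_sq k (\<lambda>m. err (?x r (Suc a)) m \<omega> - err (?x r a) m \<omega>)"
  have grid: "0 \<le> ?x r a" "?x r a \<le> ?x r (Suc a)" "?x r (Suc a) \<le> 1" if "r \<in> {..2 * k}" "a \<in> {..<2 ^ (2 * k - r)}" for r a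
  proof -
    have "Suc a * 2 ^ r \<le> 2 ^ (2 * k - r) * 2 ^ r"
      using that by (intro mult_right_mono) auto
    also have "\<dots> = (2::nat) ^ (2 * k)"
      using that by (simp flip: power_add)
    finally have "real (Suc a * 2 ^ r) \<le> real (2 ^ (2 * k))"
      by (simp only: of_nat_le_iff)
    then show "?x r (Suc a) \<le> 1"
      by simp
  qed (auto intro!: divide_right_mono)
  have int: "integrable M (?Q r a)" if "r \<in> {..2 * k}" "a \<in> {..<2 ^ (2 * k - r)}" for r a
    using grid[OF that] by (rule expectation_dyadic_sq_err(2))
  show "integrable M (chain_sq k)"
    unfolding chain_sq_def[abs_def] by (intro Bochner_Integration.integrable_sum int)
  have "expectation (chain_sq k) = (\<Sum>r\<le>2 * k. expectation (\<lambda>\<omega>. \<Sum>a<2 ^ (2 * k - r). ?Q r a \<omega>))"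
    unfolding chain_sq_def[abs_def] by (intro Bochner_Integration.integral_sum Bochner_Integration.integrable_sum int)
  also have "\<dots> = (\<Sum>r\<le>2 * k. \<Sum>a<2 ^ (2 * k - r). expectation (?Q r a))"
    by (intro sum.cong refl Bochner_Integration.integral_sum int)
  also have "\<dots> \<le> (\<Sum>r\<le>2 * k. \<Sum>a<(2::nat) ^ (2 * k - r). 2 * (real k + 1) * 2 ^ k * ?S * (?x r (Suc a) - ?x r a))"
    using grid by (intro sum_mono expectation_dyadic_sq_err(1))
  also have "\<dots> = (\<Sum>r\<le>2 * k. \<Sum>a<(2::nat) ^ (2 * k - r). 2 * (real k + 1) * 2 ^ k * ?S * (2 ^ r / 2 ^ (2 * k)))"
    by (intro sum.cong refl arg_cong2[where f = "(*)"]) (simp add: field_simps)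
  also have "\<dots> = (\<Sum>r\<le>2 * k. (2 ^ (2 * k - r) * 2 ^ r) / 2 ^ (2 * k) * (2 * (real k + 1) * 2 ^ k * ?S))"
    by (intro sum.cong refl) (simp add: field_simps)
  also have "\<dots> = (\<Sum>r\<le>2 * k. 2 * (real k + 1) * 2 ^ k * ?S)"
    by (intro sum.cong refl) (simp flip: power_add)
  also have "\<dots> = (2 * real k + 1) * (2 * (real k + 1) * 2 ^ k * ?S)"
    by simp
  finally show "expectation (chain_sq k) \<le> (2 * real k + 1) * (2 * (real k + 1) * 2 ^ k * ?S)" .
qed

lemma chain_sq_nonneg: "0 \<le> chain_sq k \<omega>"
  unfolding chain_sq_def by (intro sum_nonneg dyadic_sq_nonneg)

lemma err_grid_le:
  assumes zero: "\<And>m. err 0 m \<omega> = 0" and "j \<le> 2 ^ (2 * k)" "m \<le> 2 ^ k"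
  shows "\<bar>err (real j / 2 ^ (2 * k)) m \<omega>\<bar> \<le> sqrt ((2 * real k + 1) * (real k + 1) * chain_sq k \<omega>)"
proof (rule real_le_rsqrt)
  show "\<bar>err (real j / 2 ^ (2 * k)) m \<omega>\<bar>\<^sup>2 \<le> (2 * real k + 1) * (real k + 1) * chain_sq k \<omega>"
    using dyadic_chaining_2d[OF assms(2,3), of "\<lambda>j m. err (real j / 2 ^ (2 * k)) m \<omega>"]
    by (simp add: zero chain_sq_def del: mult_Suc)
qed

definition hermite_sq :: "nat \<Rightarrow> 'a \<Rightarrow> real" where
  "hermite_sq N \<omega> = (\<Sum>i\<in>{0<..N}. (hermite \<tau> (\<eta> i \<omega>))\<^sup>2)"

lemma expectation_hermite_sq:
  shows "expectation (hermite_sq N) = real N * fact \<tau>" and "integrable M (hermite_sq N)"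
proof -
  have i: "integrable M (\<lambda>\<omega>. (hermite \<tau> (\<eta> i \<omega>))\<^sup>2)"
      "expectation (\<lambda>\<omega>. (hermite \<tau> (\<eta> i \<omega>))\<^sup>2) = fact \<tau>" if "i \<in> {0<..N}" for i
    using square_integrable_comp_eta[OF square_integrable_hermite, of i \<tau>] that
      integral_hermite_hermite[of \<tau> \<tau>] by (auto simp: power2_eq_square square_integrable_def)
  show "integrable M (hermite_sq N)"
    unfolding hermite_sq_def[abs_def] by (intro Bochner_Integration.integrable_sum i(1))
  have "expectation (hermite_sq N) = (\<Sum>i\<in>{0<..N}. expectation (\<lambda>\<omega>. (hermite \<tau> (\<eta> i \<omega>))\<^sup>2))"
    unfolding hermite_sq_def[abs_def] by (intro Bochner_Integration.integral_sum i(1))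
  then show "expectation (hermite_sq N) = real N * fact \<tau>"
    using i(2) by simp
qed

text \<open>The counting part of \<open>err\<close> increases with the level. A decrease can come
  only from the centring, which costs at most 1, and from the Hermite sum, whose coefficient changes
  by at most \<open>1 / 2 ^ k\<close> and which Cauchy-Schwarz bounds through
  \<open>hermite_sq\<close>.\<close>

lemma err_increment_ge:
  assumes "0 \<le> x" "x \<le> y" "y \<le> 1" "y - x \<le> 1 / 2 ^ (2 * k)" "m \<le> 2 ^ k"
  shows "err x m \<omega> \<le> err y m \<omega> + (1 + sqrt (hermite_sq (2 ^ k) \<omega> / 2 ^ k))"
proof -
  let ?H = "\<lambda>i. hermite \<tau> (\<eta> i \<omega>)"
  let ?d = "(J_coeff F G \<tau> y - J_coeff F G \<tau> x) / fact \<tau>"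
  have d: "\<bar>?d\<bar> \<le> 1 / 2 ^ k"
  proof -
    have "?d\<^sup>2 = (J_coeff F G \<tau> y - J_coeff F G \<tau> x)\<^sup>2 / (fact \<tau>)\<^sup>2"
      by (simp add: power_divide)
    also have "\<dots> \<le> (fact \<tau> * (y - x)) / (fact \<tau>)\<^sup>2"
      by (intro divide_right_mono resid_increment assms) simp
    also have "\<dots> = (y - x) / fact \<tau>"
      by (simp add: power2_eq_square)
    also have "\<dots> \<le> (y - x) / 1"
      using assms by (intro divide_left_mono) (auto simp: fact_ge_1)
    also have "\<dots> \<le> (1 / 2 ^ k)\<^sup>2"
      using assms by (simp add: power_divide power_even_eq)
    finally show ?thesis
      by (simp flip: abs_le_square_iff)
  qed
  have sumH: "(\<Sum>i\<in>{0<..m}. \<bar>?H i\<bar>) \<le> sqrt (2 ^ k * hermite_sq (2 ^ k) \<omega>)"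
  proof (rule real_le_rsqrt)
    have "(\<Sum>i\<in>{0<..m}. \<bar>?H i\<bar>)\<^sup>2 \<le> (\<Sum>i\<in>{0<..2 ^ k}. \<bar>?H i\<bar>)\<^sup>2"
      using assms(5) by (intro power_mono sum_mono2 sum_nonneg) auto
    also have "\<dots> \<le> (\<Sum>i\<in>{0<..2 ^ k}. \<bar>?H i\<bar>\<^sup>2) * real (card {0<..(2::nat) ^ k})"
      by (rule sum_squared_le_sum_of_squares)
    also have "\<dots> = 2 ^ k * hermite_sq (2 ^ k) \<omega>"
      by (simp add: hermite_sq_def)
    finally show "(\<Sum>i\<in>{0<..m}. \<bar>?H i\<bar>)\<^sup>2 \<le> 2 ^ k * hermite_sq (2 ^ k) \<omega>" .
  qed
  have "real m * (y - x) \<le> 2 ^ k * (1 / 2 ^ (2 * k))"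
    using assms by (intro mult_mono) (auto simp flip: of_nat_power intro: of_nat_mono)
  also have "\<dots> \<le> 1"
    by (simp add: power_even_eq power2_eq_square)
  finally have m: "real m * (y - x) \<le> 1" .
  have "\<bar>?d * (\<Sum>i\<in>{0<..m}. ?H i)\<bar> \<le> 1 / 2 ^ k * (\<Sum>i\<in>{0<..m}. \<bar>?H i\<bar>)"
    unfolding abs_mult by (intro mult_mono d sum_abs) auto
  also have "\<dots> \<le> 1 / 2 ^ k * sqrt (2 ^ k * hermite_sq (2 ^ k) \<omega>)"
    by (intro mult_left_mono sumH) simp
  also have "\<dots> = sqrt (hermite_sq (2 ^ k) \<omega> / 2 ^ k)"
    by (simp add: real_sqrt_mult real_sqrt_divide field_simps)
  finally have dH: "\<bar>?d * (\<Sum>i\<in>{0<..m}. ?H i)\<bar> \<le> sqrt (hermite_sq (2 ^ k) \<omega> / 2 ^ k)" .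
  have "resid y (\<eta> i \<omega>) - resid x (\<eta> i \<omega>) \<ge> - (y - x) - ?d * ?H i" for i
    using assms by (auto simp: resid_def cent_def diff_divide_distrib left_diff_distrib)
  then have "(\<Sum>i\<in>{0<..m}. resid y (\<eta> i \<omega>) - resid x (\<eta> i \<omega>)) \<ge> (\<Sum>i\<in>{0<..m}. - (y - x) - ?d * ?H i)"
    by (intro sum_mono)
  also have "(\<Sum>i\<in>{0<..m}. - (y - x) - ?d * ?H i) = - (real m * (y - x)) - ?d * (\<Sum>i\<in>{0<..m}. ?H i)"
  proof -
    have "(\<Sum>i\<in>{0<..m}. - c - d * ?H i) = - (real m * c) - d * (\<Sum>i\<in>{0<..m}. ?H i)" for c d
      by (simp add: sum_subtractf sum_distrib_left)
    then show ?thesis .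
  qed
  finally have "err y m \<omega> - err x m \<omega> \<ge> - (real m * (y - x)) - ?d * (\<Sum>i\<in>{0<..m}. ?H i)"
    by (simp add: err_def sum_subtractf)
  then show ?thesis
    using m dH by linarith
qed

text \<open>Independent of \<open>y\<close> and \<open>m\<close>, and free of square roots, so that
  its expectation is accessible. The 3 comes from squaring a sum of three terms.\<close>

definition err_majorant :: "nat \<Rightarrow> 'a \<Rightarrow> real" where
  "err_majorant k \<omega> = 3 * ((2 * real k + 1) * (real k + 1) * chain_sq k \<omega> + 1 + hermite_sq (2 ^ k) \<omega> / 2 ^ k)"

lemma err_square_le:
  assumes zero: "\<And>m. err 0 m \<omega> = 0" and y: "y \<in> {0..1}" and m: "m \<le> 2 ^ k"
  shows "(err y m \<omega>)\<^sup>2 \<le> err_majorant k \<omega>"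
proof -
  define A where "A = (2 * real k + 1) * (real k + 1) * chain_sq k \<omega>"
  define B where "B = hermite_sq (2 ^ k) \<omega> / 2 ^ k"
  have nn: "0 \<le> A" "0 \<le> B"
    by (auto simp: A_def B_def chain_sq_nonneg hermite_sq_def sum_nonneg)
  \<comment> \<open>Floor and ceiling, instead of floor and floor plus one, keep the upper neighbour
    in the grid at \<open>y = 1\<close>.\<close>
  define j where "j = nat \<lfloor>y * 2 ^ (2 * k)\<rfloor>"
  define j' where "j' = nat \<lceil>y * 2 ^ (2 * k)\<rceil>"
  have nny: "0 \<le> y * 2 ^ (2 * k)"
    using y by simp
  have j: "real j \<le> y * 2 ^ (2 * k)" "y * 2 ^ (2 * k) \<le> real j + 1"
    using nny by (auto simp: j_def)
  have j': "y * 2 ^ (2 * k) \<le> real j'" "real j' \<le> y * 2 ^ (2 * k) + 1"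
    using nny by (auto simp: j'_def)
  have "j \<le> j'"
    by (auto simp: j_def j'_def intro!: nat_mono floor_le_ceiling)
  have "y * 2 ^ (2 * k) \<le> of_int (2 ^ (2 * k))"
    using y by (simp add: mult_le_cancel_right1)
  then have "\<lceil>y * 2 ^ (2 * k)\<rceil> \<le> 2 ^ (2 * k)"
    by (simp only: ceiling_le_iff)
  then have j'_le: "j' \<le> 2 ^ (2 * k)"
    unfolding j'_def by (simp add: nat_le_iff)
  have j_le: "j \<le> 2 ^ (2 * k)"
    using \<open>j \<le> j'\<close> j'_le by simp
  have grid1: "\<bar>err (real j / 2 ^ (2 * k)) m \<omega>\<bar> \<le> sqrt A"
    unfolding A_def by (rule err_grid_le[OF zero j_le m])
  have grid2: "\<bar>err (real j' / 2 ^ (2 * k)) m \<omega>\<bar> \<le> sqrt A"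
    unfolding A_def by (rule err_grid_le[OF zero j'_le m])
  have b1: "a \<le> b / T \<and> b / T - a \<le> 1 / T" if "0 < T" "a * T \<le> b" "b \<le> a * T + 1" for a b T :: real
  proof -
    have "b / T \<le> (a * T + 1) / T" "a * T / T \<le> b / T"
      by (rule divide_right_mono; use that in linarith)+
    then show ?thesis
      using that(1) by (simp add: add_divide_distrib)
  qed
  have b2: "b / T \<le> a \<and> a - b / T \<le> 1 / T" if "0 < T" "b \<le> a * T" "a * T \<le> b + 1" for a b T :: real
  proof -
    have "(a * T - 1) / T \<le> b / T" "b / T \<le> a * T / T"
      by (rule divide_right_mono; use that in linarith)+
    then show ?thesis
      using that(1) by (simp add: diff_divide_distrib)
  qed
  have "real j' / 2 ^ (2 * k) \<le> 1"
    using j'_le by (simp flip: of_nat_power)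
  \<comment> \<open>One-sided control of increments is enough: the upper neighbour bounds
    \<open>err y\<close> from above, the lower one from below.\<close>
  then have up: "err y m \<omega> \<le> err (real j' / 2 ^ (2 * k)) m \<omega> + (1 + sqrt B)"
    unfolding B_def using b1[OF _ j'] y m by (intro err_increment_ge) auto
  have low: "err (real j / 2 ^ (2 * k)) m \<omega> \<le> err y m \<omega> + (1 + sqrt B)"
    unfolding B_def using b2[OF _ j] y m by (intro err_increment_ge) auto
  have "\<bar>err y m \<omega>\<bar> \<le> sqrt A + 1 + sqrt B"
    using grid1 grid2 up low by linarith
  then have "\<bar>err y m \<omega>\<bar>\<^sup>2 \<le> (sqrt A + 1 + sqrt B)\<^sup>2"
    by (intro power_mono) auto
  also have "\<dots> \<le> 3 * ((sqrt A)\<^sup>2 + 1 + (sqrt B)\<^sup>2)"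
  proof -
    have "3 * (a\<^sup>2 + 1 + b\<^sup>2) - (a + 1 + b)\<^sup>2 = (a - 1)\<^sup>2 + (b - 1)\<^sup>2 + (a - b)\<^sup>2" for a b :: real
      by (simp add: power2_eq_square algebra_simps)
    then show ?thesis
      by (metis add_nonneg_nonneg diff_ge_0_iff_ge zero_le_power2)
  qed
  also have "\<dots> = err_majorant k \<omega>"
    using nn by (simp add: err_majorant_def A_def B_def)
  finally show ?thesis
    by simp
qed

lemma expectation_err_majorant:
  shows "expectation (err_majorant k) \<le>
      3 * ((2 * real k + 1)\<^sup>2 * (real k + 1)\<^sup>2 * (2 * 2 ^ k * (\<Sum>i<2 ^ k. \<gamma> i ^ Suc \<tau>)) + 1 + fact \<tau>)"
    and "integrable M (err_majorant k)"
proof -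
  note ints = expectation_chain_sq(2)[of k] expectation_hermite_sq(2)[of "2 ^ k"]
  show "integrable M (err_majorant k)"
    unfolding err_majorant_def[abs_def] using ints by simp
  have "expectation (err_majorant k) =
      3 * ((2 * real k + 1) * (real k + 1) * expectation (chain_sq k) + 1 + expectation (hermite_sq (2 ^ k)) / 2 ^ k)"
    unfolding err_majorant_def[abs_def] using ints by (simp add: prob_space)
  also have "\<dots> \<le> 3 * ((2 * real k + 1) * (real k + 1) *
      ((2 * real k + 1) * (2 * (real k + 1) * 2 ^ k * (\<Sum>i<2 ^ k. \<gamma> i ^ Suc \<tau>))) + 1 + fact \<tau>)"
    by (intro mult_left_mono add_mono expectation_chain_sq order_refl) (simp_all add: expectation_hermite_sq)
  also have "(2 * real k + 1) * (real k + 1) * ((2 * real k + 1) * (2 * (real k + 1) * 2 ^ k * S)) =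
      (2 * real k + 1)\<^sup>2 * (real k + 1)\<^sup>2 * (2 * 2 ^ k * S)" for S
    unfolding power2_eq_square by (simp only: mult_ac)
  finally show "expectation (err_majorant k) \<le>
      3 * ((2 * real k + 1)\<^sup>2 * (real k + 1)\<^sup>2 * (2 * 2 ^ k * (\<Sum>i<2 ^ k. \<gamma> i ^ Suc \<tau>)) + 1 + fact \<tau>)" .
qed

text \<open>The chains in the level start at 0, where the residual vanishes outside the null event
  that some \<open>F (G (\<eta> i \<omega>))\<close> is 0.\<close>

lemma AE_err_0: "AE \<omega> in M. \<forall>m. err 0 m \<omega> = 0"
proof -
  have *: "AE z in std_normal_distribution. resid 0 z = 0"
    using AE_cent_endpoint[of 0] hermite_coeff_cent_endpoint[of 0 \<tau>]
    by (simp add: resid_def J_coeff_eq)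
  have "AE z in distr M borel (\<eta> i). resid 0 z = 0" if "1 \<le> i" for i
    unfolding distr_eta[OF that] by (rule *)
  then have "AE \<omega> in M. resid 0 (\<eta> i \<omega>) = 0" if "1 \<le> i" for i
    using that by (intro AE_distrD[OF measurable_eta])
  then have "AE \<omega> in M. \<forall>i. 1 \<le> i \<longrightarrow> resid 0 (\<eta> i \<omega>) = 0"
    by (simp add: AE_all_countable)
  then show ?thesis
    by eventually_elim (simp add: err_def)
qed

text \<open>The scales \<open>2 ^ k\<close> are handled by summable expectations, and every
  \<open>n\<close> lies between two consecutive ones. The bound is on squares, hence the halved
  exponent.\<close>

theorem AE_err_bound:
  assumes L: "slowly_varying L"
    and decay: "\<forall>\<^sub>F k in sequentially. \<gamma> k = real k powr (- D) * L (real k)"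
    and "0 < \<delta>"
  shows "AE \<omega> in M. \<exists>C. \<forall>n\<ge>1. \<forall>m\<le>n. \<forall>y\<in>{0..1}.
    \<bar>err y m \<omega>\<bar> \<le> C * real n powr ((1 + max 0 (1 - real (Suc \<tau>) * D)) / 2 + \<delta>)"
proof -
  define \<beta> where "\<beta> = max 0 (1 - real (Suc \<tau>) * D)"
  \<comment> \<open>One \<open>\<delta>\<close> is spent on the covariance sum; the other yields
    \<open>2 powr (- \<delta> * real k)\<close>, which makes the polynomial factors from chaining
    summable.\<close>
  define e where "e = 1 + \<beta> + 2 * \<delta>"
  have pos: "0 \<le> \<beta>" "0 < e"
    using \<open>0 < \<delta>\<close> by (auto simp: \<beta>_def e_def add_pos_nonneg)
  obtain C0 where C0: "0 \<le> C0" "\<And>n. n \<ge> 1 \<Longrightarrow> (\<Sum>k<n. \<gamma> k ^ Suc \<tau>) \<le> C0 * real n powr (\<beta> + \<delta>)"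
    using sum_covariance_power_bound[OF L decay, of "Suc \<tau>" \<delta>] \<open>0 < \<delta>\<close> unfolding \<beta>_def by auto
  define C1 where "C1 = 3 * (2 * C0 + 1 + fact \<tau>)"
  define w where "w k = (2 ^ k) powr e" for k :: nat
  define s where "s k = C1 * ((2 * real k + 1)\<^sup>2 * (real k + 1)\<^sup>2 * 2 powr (- \<delta> * real k))" for k :: nat
  have "summable s"
  proof -
    have "summable (\<lambda>k. (2 * real k + 1)\<^sup>2 * (real k + 1)\<^sup>2 * 2 powr (- \<delta> * real k))"
    proof (rule summable_comparison_test_bigo)
      show "summable (\<lambda>k. norm (1 / real k ^ 2))"
        using inverse_power_summable[of 2, where 'a = real] by (simp add: inverse_eq_divide)
      show "(\<lambda>k. (2 * real k + 1)\<^sup>2 * (real k + 1)\<^sup>2 * 2 powr (- \<delta> * real k)) \<in> O(\<lambda>k. 1 / real k ^ 2)"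
        using \<open>0 < \<delta>\<close> by real_asymp
    qed
    then show ?thesis
      unfolding s_def[abs_def] by (rule summable_mult)
  qed
  have le: "expectation (err_majorant k) \<le> w k * s k" for k
  proof -
    let ?P = "(2 * real k + 1)\<^sup>2 * (real k + 1)\<^sup>2"
    let ?W = "(2 ^ k) powr (1 + \<beta> + \<delta>) :: real"
    have P: "1 \<le> ?P"
      using mult_mono[of 1 "(2 * real k + 1)\<^sup>2" 1 "(real k + 1)\<^sup>2"] by (simp add: one_le_power)
    have W: "1 \<le> ?W"
      using pos \<open>0 < \<delta>\<close> by (intro ge_one_powr_ge_zero) auto
    have "2 * 2 ^ k * (\<Sum>i<2 ^ k. \<gamma> i ^ Suc \<tau>) \<le> 2 * 2 ^ k * (C0 * (2 ^ k) powr (\<beta> + \<delta>))"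
      using C0(2)[of "2 ^ k"] by (intro mult_left_mono) auto
    also have "\<dots> = 2 * C0 * ?W"
      by (simp add: powr_add)
    finally have S: "2 * 2 ^ k * (\<Sum>i<2 ^ k. \<gamma> i ^ Suc \<tau>) \<le> 2 * C0 * ?W" .
    have PW: "1 \<le> ?P * ?W"
      using mult_mono[OF P W] by simp
    have "expectation (err_majorant k) \<le> 3 * (?P * (2 * 2 ^ k * (\<Sum>i<2 ^ k. \<gamma> i ^ Suc \<tau>)) + 1 + fact \<tau>)"
      by (rule expectation_err_majorant)
    also have "\<dots> \<le> 3 * (?P * (2 * C0 * ?W) + (1 + fact \<tau>) * (?P * ?W))"
    proof -
      have "?P * (2 * 2 ^ k * (\<Sum>i<2 ^ k. \<gamma> i ^ Suc \<tau>)) \<le> ?P * (2 * C0 * ?W)"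
        by (intro mult_left_mono S) simp
      moreover have "(1 + fact \<tau>) * 1 \<le> (1 + fact \<tau>) * (?P * ?W)"
        by (intro mult_left_mono PW) simp
      moreover have "3 * (a + 1 + f) \<le> 3 * (b + c)" if "a \<le> b" "(1 + f) * 1 \<le> c" for a b c f :: real
        using that by simp
      ultimately show ?thesis
        by blast
    qed
    also have "\<dots> = C1 * ?P * ?W"
      by (simp add: C1_def algebra_simps)
    also have "?W = w k * 2 powr (- \<delta> * real k)"
      by (simp add: w_def e_def powr_powr algebra_simps flip: powr_realpow powr_add)
    finally show ?thesis
      by (simp add: s_def mult_ac)
  qed
  have nn: "0 \<le> err_majorant k \<omega>" for k \<omega>
    by (simp add: err_majorant_def chain_sq_nonneg hermite_sq_def sum_nonneg)
  have "AE \<omega> in M. \<exists>C. \<forall>k. err_majorant k \<omega> \<le> C * w k"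
    by (rule AE_bounded_if_summable_expectations[OF expectation_err_majorant(2) nn _ le \<open>summable s\<close>])
      (simp add: w_def)
  then show ?thesis
    using AE_err_0
  proof eventually_elim
    case (elim \<omega>)
    then obtain C where C: "\<And>k. err_majorant k \<omega> \<le> C * w k"
      by blast
    define C' where "C' = sqrt (\<bar>C\<bar> * 2 powr e)"
    have "\<bar>err y m \<omega>\<bar> \<le> C' * real n powr ((1 + \<beta>) / 2 + \<delta>)" if n: "n \<ge> 1" and m: "m \<le> n" and y: "y \<in> {0..1}" for n m y
    proof -
      \<comment> \<open>Level \<open>k + 1\<close> covers all \<open>m \<le> n\<close>, and
        \<open>2 ^ (k + 1) \<le> 2 * n\<close> loses only the constant
        \<open>2 powr e\<close>.\<close>
      obtain k where k: "2 ^ k \<le> n" "n < 2 ^ (k + 1)"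
        using ex_power_ivl1[of 2 n] n by auto
      have "(err y m \<omega>)\<^sup>2 \<le> C * w (k + 1)"
        using err_square_le[of \<omega> y m "k + 1"] C[of "k + 1"] elim y m k by (meson le_trans less_imp_le order_trans)
      also have "\<dots> \<le> \<bar>C\<bar> * (2 * real n) powr e"
      proof (rule mult_mono)
        have "real (2 ^ k) \<le> real n"
          using k(1) by (simp only: of_nat_le_iff)
        then show "w (k + 1) \<le> (2 * real n) powr e"
          unfolding w_def using pos by (intro powr_mono2) auto
      qed (auto simp: w_def)
      also have "\<dots> = \<bar>C\<bar> * 2 powr e * real n powr e"
        by (simp add: powr_mult)
      finally have "sqrt ((err y m \<omega>)\<^sup>2) \<le> sqrt (\<bar>C\<bar> * 2 powr e * real n powr e)"
        by (rule real_sqrt_le_mono)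
      also have "\<dots> = C' * real n powr (e / 2)"
        by (simp add: C'_def real_sqrt_mult powr_half_sqrt[symmetric] powr_powr)
      also have "e / 2 = (1 + \<beta>) / 2 + \<delta>"
        by (simp add: e_def add_divide_distrib)
      finally show ?thesis
        by simp
    qed
    then show ?case
      unfolding \<beta>_def by blast
  qed
qed

end

section \<open>The empirical quantile function\<close>

context subordinated_gaussian
begin

lemma err_eq_emp_df:
  "err y m \<omega> = real m * (emp_df (\<lambda>i. F (G (\<eta> i \<omega>))) m y - y) - V_process (J_coeff F G \<tau>) (\<lambda>i. \<eta> i \<omega>) \<tau> y m"
proof (cases "m = 0")
  case False
  have "{0<..m} = {1..m}"
    by auto
  then show ?thesis
    using False by (simp add: err_def resid_def cent_def emp_df_def V_process_def sum_subtractf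
        right_diff_distrib flip: sum_distrib_left sum_divide_distrib)
qed (simp add: err_def V_process_def)

lemma J_coeff_increment:
  assumes "x \<in> {0..1}" "y \<in> {0..1}"
  shows "\<bar>J_coeff F G \<tau> y - J_coeff F G \<tau> x\<bar> \<le> sqrt (fact \<tau> * \<bar>y - x\<bar>)"
proof (rule real_le_rsqrt)
  show "\<bar>J_coeff F G \<tau> y - J_coeff F G \<tau> x\<bar>\<^sup>2 \<le> fact \<tau> * \<bar>y - x\<bar>"
    using assms resid_increment(2)[of x y] resid_increment(2)[of y x]
    by (cases "x \<le> y") (auto simp: power2_commute)
qed

text \<open>The jumps of the empirical distribution function are absorbed by twice the supremum of the
  reduction error because \<open>V\<close> is continuous in \<open>y\<close>; hence possible ties among the \<open>U\<^sub>i\<close> do no harm.\<close>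

lemma emp_df_at_quantile:
  fixes m :: nat and \<omega> :: 'a
  defines "E \<equiv> emp_df (\<lambda>i. F (G (\<eta> i \<omega>))) m"
  assumes m: "1 \<le> m" and y: "0 < y" "y \<le> 1" and B: "\<And>y. y \<in> {0..1} \<Longrightarrow> \<bar>err y m \<omega>\<bar> \<le> B"
  shows "Inf {s. y \<le> E s} \<in> {0..1}" and "\<bar>real m * (E (Inf {s. y \<le> E s}) - y)\<bar> \<le> 2 * B"
proof -
  define Q where "Q = Inf {s. y \<le> E s}"
  define H where "H = \<bar>\<Sum>i=1..m. hermite \<tau> (\<eta> i \<omega>)\<bar> / fact \<tau>"
  \<comment> \<open>Up to reduction errors, \<open>\<phi> h\<close> bounds the growth of
    \<open>m * E\<close> over an interval of length \<open>h\<close>; it tends to 0 with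
    \<open>h\<close>.\<close>
  define \<phi> where "\<phi> h = real m * h + sqrt (fact \<tau> * h) * H" for h
  have "0 \<le> B"
    using B[of 0] by force
  have mono: "E s \<le> E t" if "s \<le> t" for s t
    unfolding E_def emp_df_def using that by (intro divide_right_mono sum_mono) auto
  have E1: "E 1 = 1"
    using m F_bounds(2) by (simp add: E_def emp_df_def)
  have E_neg: "E s = 0" if "s < 0" for s
  proof -
    have "\<not> F (G (\<eta> i \<omega>)) \<le> s" for i
      using F_bounds(1)[of "G (\<eta> i \<omega>)"] that by linarith
    then show ?thesis
      by (simp add: E_def emp_df_def)
  qed
  have in1: "1 \<in> {s. y \<le> E s}"
    using y E1 by simp
  have ge0: "0 \<le> s" if "s \<in> {s. y \<le> E s}" for s
    using that y E_neg[of s] by (cases "s < 0") auto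
  have bdd: "bdd_below {s. y \<le> E s}"
    using ge0 by (rule bdd_belowI)
  show Q: "Inf {s. y \<le> E s} \<in> {0..1}"
    using cInf_greatest[of "{s. y \<le> E s}" 0] ge0 in1 cInf_lower[OF in1 bdd] by auto
  have step: "real m * (E t - E s) \<le> 2 * B + \<phi> (t - s)" if "s \<in> {0..1}" "t \<in> {0..1}" "s \<le> t" for s t
  proof -
    let ?J = "J_coeff F G \<tau>"
    have "real m * (E t - E s) = err t m \<omega> - err s m \<omega> + real m * (t - s) +
        (?J t - ?J s) * ((\<Sum>i=1..m. hermite \<tau> (\<eta> i \<omega>)) / fact \<tau>)"
      by (simp add: err_eq_emp_df E_def V_process_def algebra_simps diff_divide_distrib)
    moreover have "(?J t - ?J s) * ((\<Sum>i=1..m. hermite \<tau> (\<eta> i \<omega>)) / fact \<tau>) \<le> sqrt (fact \<tau> * \<bar>t - s\<bar>) * H"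
    proof -
      have "(?J t - ?J s) * ((\<Sum>i=1..m. hermite \<tau> (\<eta> i \<omega>)) / fact \<tau>) \<le> \<bar>?J t - ?J s\<bar> * H"
        unfolding H_def by (rule order_trans[OF abs_ge_self]) (simp add: abs_mult)
      also have "\<dots> \<le> sqrt (fact \<tau> * \<bar>t - s\<bar>) * H"
        using that by (intro mult_right_mono J_coeff_increment) (auto simp: H_def)
      finally show ?thesis .
    qed
    ultimately show ?thesis
      using B[OF that(1)] B[OF that(2)] that(3) by (simp add: \<phi>_def)
  qed
  have lim: "((\<lambda>h. 2 * B + \<phi> h) \<longlongrightarrow> 2 * B) (at_right 0)"
    unfolding \<phi>_def by (auto intro!: tendsto_eq_intros)
  have small: "z \<le> 2 * B" if "0 < d" "\<And>h. 0 < h \<Longrightarrow> h < d \<Longrightarrow> z \<le> 2 * B + \<phi> h" for z d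
  proof (rule tendsto_lowerbound[OF lim])
    show "\<forall>\<^sub>F h in at_right 0. z \<le> 2 * B + \<phi> h"
      using that unfolding eventually_at_right_field by blast
  qed simp
  have "real m * (E Q - y) \<le> 2 * B"
  proof (cases "Q = 0")
    case True
    \<comment> \<open>There is no room to the left of 0, but \<open>J_coeff\<close> vanishes there,
      so that \<open>m * E 0\<close> is itself a reduction error.\<close>
    have "J_coeff F G \<tau> 0 = 0"
      by (simp add: J_coeff_eq hermite_coeff_cent_endpoint)
    then have "real m * E 0 = err 0 m \<omega>"
      by (simp add: err_eq_emp_df E_def V_process_def)
    moreover have "0 \<le> real m * y"
      using y by simp
    ultimately show ?thesis
      using True B[of 0] \<open>0 \<le> B\<close> by (simp add: right_diff_distrib)
  next
    case False
    show ?thesis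
    proof (rule small)
      show "0 < Q"
        using Q False by (auto simp: Q_def)
      fix h assume h: "0 < h" "h < Q"
      \<comment> \<open>Left of the infimum \<open>E\<close> is below \<open>y\<close>, so its
        excess over \<open>y\<close> at \<open>Q\<close> is at most its growth over an arbitrarily
        short interval.\<close>
      have "\<not> y \<le> E (Q - h)"
        using cInf_lower[OF _ bdd, of "Q - h"] h by (auto simp: Q_def)
      then have "real m * (E Q - y) \<le> real m * (E Q - E (Q - h))"
        by (intro mult_left_mono) auto
      also have "\<dots> \<le> 2 * B + \<phi> (Q - (Q - h))"
        using h Q by (intro step) (auto simp: Q_def)
      finally show "real m * (E Q - y) \<le> 2 * B + \<phi> h"
        by simp
    qed
  qed
  moreover have "real m * (y - E Q) \<le> 2 * B"
  proof (cases "Q = 1")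
    case True
    then have "real m * (y - E Q) \<le> 0"
      using E1 y by (simp add: mult_le_0_iff)
    then show ?thesis
      using \<open>0 \<le> B\<close> by simp
  next
    case False
    show ?thesis
    proof (rule small)
      show "0 < 1 - Q"
        using Q False by (auto simp: Q_def)
      fix h assume h: "0 < h" "h < 1 - Q"
      \<comment> \<open>Some point of the set lies below \<open>Q + h\<close>, and monotonicity
        carries the level \<open>y\<close> over to \<open>Q + h\<close>.\<close>
      have "Inf {s. y \<le> E s} < Q + h"
        using h by (simp add: Q_def)
      then obtain s where "y \<le> E s" "s < Q + h"
        using in1 bdd by (subst (asm) cInf_less_iff) auto
      then have "y \<le> E (Q + h)"
        using mono[of s "Q + h"] by linarith
      then have "real m * (y - E Q) \<le> real m * (E (Q + h) - E Q)"
        by (intro mult_left_mono) auto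
      also have "\<dots> \<le> 2 * B + \<phi> (Q + h - Q)"
        using h Q by (intro step) (auto simp: Q_def)
      finally show "real m * (y - E Q) \<le> 2 * B + \<phi> h"
        by simp
    qed
  qed
  ultimately show "\<bar>real m * (E (Inf {s. y \<le> E s}) - y)\<bar> \<le> 2 * B"
    unfolding Q_def[symmetric] by (simp add: abs_le_iff right_diff_distrib)
qed

text \<open>The values of \<open>emp_df\<close> are multiples of \<open>1 / m\<close>, so all
  positive levels up to \<open>1 / m\<close> have the same quantile, and the limit from the right is
  attained.\<close>

lemma emp_quantile_0:
  assumes m: "1 \<le> m"
  shows "emp_quantile u m 0 = Inf {s. 1 / real m \<le> emp_df u m s}"
proof -
  have iff: "z \<le> emp_df u m s \<longleftrightarrow> 1 / real m \<le> emp_df u m s" if z: "0 < z" "z \<le> 1 / real m" for z s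
  proof
    define N :: nat where "N = (\<Sum>i=1..m. of_bool (u i \<le> s))"
    have E: "emp_df u m s = real N / real m"
      by (simp add: emp_df_def N_def)
    assume "z \<le> emp_df u m s"
    then have "N \<noteq> 0"
      using z E by (cases "N = 0") auto
    then show "1 / real m \<le> emp_df u m s"
      unfolding E by (intro divide_right_mono) auto
  qed (use z in linarith)
  have "((\<lambda>z. Inf {s. emp_df u m s \<ge> z}) \<longlongrightarrow> Inf {s. 1 / real m \<le> emp_df u m s}) (at_right 0)"
  proof (rule tendsto_eventually)
    have "\<forall>\<^sub>F z in at_right 0. 0 < z \<and> z < 1 / real m"
      using m by (auto simp: eventually_at_right_field intro!: exI[of _ "1 / real m"])
    then show "\<forall>\<^sub>F z in at_right 0. Inf {s. emp_df u m s \<ge> z} = Inf {s. 1 / real m \<le> emp_df u m s}"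
      by eventually_elim (simp add: iff)
  qed
  then show ?thesis
    unfolding emp_quantile_def by (simp add: tendsto_Lim)
qed

text \<open>The constant adds the reduction errors at \<open>y\<close> and at the quantile, the
  \<open>2 * B\<close> of \<open>emp_df_at_quantile\<close>, and 1 for \<open>y = 0\<close>, where
  the quantile belongs to level \<open>1 / m\<close>.\<close>

lemma R_star_bound:
  assumes norming: "norming D L \<tau> n \<noteq> 0" and t: "t \<in> {0..1}" and y: "y \<in> {0..1}"
    and B: "\<And>m y. m \<le> n \<Longrightarrow> y \<in> {0..1} \<Longrightarrow> \<bar>err y m \<omega>\<bar> \<le> B"
  shows "\<bar>R_star D L \<tau> (\<lambda>i. F (G (\<eta> i \<omega>))) n y t -
      (V_process (J_coeff F G \<tau>) (\<lambda>i. \<eta> i \<omega>) \<tau> y (npart n t) -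
       V_process (J_coeff F G \<tau>) (\<lambda>i. \<eta> i \<omega>) \<tau> (emp_quantile (\<lambda>i. F (G (\<eta> i \<omega>))) (npart n t) y) (npart n t))\<bar>
    \<le> 4 * B + 1"
proof -
  define m where "m = npart n t"
  define u where "u i = F (G (\<eta> i \<omega>))" for i
  define Q where "Q = emp_quantile u m y"
  let ?V = "\<lambda>y. V_process (J_coeff F G \<tau>) (\<lambda>i. \<eta> i \<omega>) \<tau> y m"
  have "real n * t \<le> real n"
    using t by (simp add: mult_left_le)
  then have "\<lfloor>real n * t\<rfloor> \<le> int n"
    by linarith
  then have m: "m \<le> n"
    by (simp add: m_def npart_def)
  have "0 \<le> B"
    using B[OF m y] by linarith
  have err_u: "err y m \<omega> = real m * (emp_df u m y - y) - ?V y" for y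
    unfolding u_def[abs_def] by (rule err_eq_emp_df)
  have R: "R_star D L \<tau> u n y t = real m * (emp_df u m y - y) - real m * (y - Q)"
    using norming
    by (simp add: R_star_def emp_process_def quant_process_def Q_def m_def mult.assoc
        flip: right_diff_distrib)
  have "\<bar>R_star D L \<tau> u n y t - (?V y - ?V Q)\<bar> \<le> 4 * B + 1"
  proof (cases "m = 0")
    case True
    then show ?thesis
      using \<open>0 \<le> B\<close> by (simp add: R V_process_def)
  next
    case False
    have "Q \<in> {0..1} \<and> \<bar>real m * (emp_df u m Q - y)\<bar> \<le> 2 * B + 1"
    proof (cases "y = 0")
      case True
      have "Q = Inf {s. 1 / real m \<le> emp_df u m s}"
        unfolding Q_def True using False by (intro emp_quantile_0) simp
      moreover have "0 < 1 / real m" "1 / real m \<le> 1"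
        using False by auto
      ultimately have "Q \<in> {0..1}" "\<bar>real m * (emp_df u m Q - 1 / real m)\<bar> \<le> 2 * B"
        using emp_df_at_quantile[of m "1 / real m" \<omega> B] False B[OF m] by (simp_all add: u_def[abs_def])
      moreover have "real m * (emp_df u m Q - 1 / real m) = real m * emp_df u m Q - 1"
        using False by (simp add: right_diff_distrib)
      ultimately show ?thesis
        using True by (simp add: abs_le_iff)
    next
      case nz: False
      have "Q = Inf {s. y \<le> emp_df u m s}"
        using nz by (simp add: Q_def emp_quantile_def)
      then show ?thesis
        using emp_df_at_quantile[of m y \<omega> B] False nz y B[OF m] by (force simp: u_def[abs_def])
    qed
    moreover have "R_star D L \<tau> u n y t - (?V y - ?V Q) =
        err y m \<omega> - err Q m \<omega> + real m * (emp_df u m Q - y)"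
      unfolding R err_u by (simp add: algebra_simps)
    ultimately show ?thesis
      using B[OF m y] B[OF m, of Q] by linarith
  qed
  then show ?thesis
    by (simp add: m_def u_def[abs_def] Q_def)
qed

end

text \<open>Put \<open>a = 1 - \<tau> * D\<close>. Minimality of \<open>p\<close> gives
  \<open>p \<le> \<tau> + 2\<close> if \<open>D \<le> a\<close>, and
  \<open>a * p \<le> 1 + a\<close> if \<open>D > a\<close>. At these extreme values the two
  exponents coincide.\<close>

lemma reduction_exponent_le:
  fixes D \<nu> :: real and \<tau> :: nat and p :: int
  assumes \<tau>: "1 \<le> \<tau>" and D: "0 < D" "D < 1 / real \<tau>"
    and p: "is_smallest {q :: int.
        Max {2, real \<tau>, real \<tau> * D / (1 - real \<tau> * D)} < real_of_int q \<and>
        real_of_int q \<le> max ((4 - real \<tau> * D) / D) ((4 - real \<tau> * D) / (1 - real \<tau> * D))} p"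
    and \<nu>: "\<nu> = min D (1 - real \<tau> * D) / 2"
  shows "(1 + max 0 (1 - real (Suc \<tau>) * D)) / 2 \<le> 1 - \<nu> * real_of_int p / 2 - real \<tau> * D / 4"
proof -
  define a where "a = 1 - real \<tau> * D"
  have a: "0 < a"
    using D \<tau> by (simp add: a_def field_simps)
  let ?M = "Max {2, real \<tau>, real \<tau> * D / a}"
  have "real_of_int p - 1 \<le> ?M"
  proof (rule ccontr)
    assume "\<not> ?thesis"
    \<comment> \<open>The upper bound passes from \<open>p\<close> to \<open>p - 1\<close>, which
      would be a smaller admissible integer.\<close>
    then have "p - 1 \<in> {q :: int. Max {2, real \<tau>, real \<tau> * D / (1 - real \<tau> * D)} < real_of_int q \<and>
        real_of_int q \<le> max ((4 - real \<tau> * D) / D) ((4 - real \<tau> * D) / (1 - real \<tau> * D))}"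
      using p by (auto simp: is_smallest_def a_def)
    then have "p \<le> p - 1"
      using p unfolding is_smallest_def by blast
    then show False
      by simp
  qed
  then have p_le: "real_of_int p - 1 \<le> max 2 (max (real \<tau>) (real \<tau> * D / a))"
    by simp
  show ?thesis
  proof (cases "D \<le> a")
    case True
    have "real \<tau> * D / a \<le> real \<tau>"
      using True a \<tau> by (simp add: pos_divide_le_eq mult_left_mono)
    then have "real_of_int p \<le> real \<tau> + 2"
      using p_le \<tau> by linarith
    then have "D * real_of_int p \<le> D * (real \<tau> + 2)"
      using D by (intro mult_left_mono) auto
    moreover have max: "max 0 (1 - real (Suc \<tau>) * D) = 1 - real (Suc \<tau>) * D"
      using True by (simp add: a_def algebra_simps)
    moreover have \<nu>': "\<nu> = D / 2"
      using True \<nu> by (simp add: a_def)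
    ultimately show ?thesis
      unfolding max \<nu>' by (simp add: field_simps)
  next
    case False
    \<comment> \<open>From \<open>\<tau> * D = 1 - a\<close> and \<open>a < D\<close>, each entry of
      the maximum is at most \<open>1 / a\<close>.\<close>
    have "D * 1 \<le> D * real \<tau>"
      using \<tau> D by (intro mult_left_mono) auto
    then have "a * 2 \<le> 1" 
      using False by (simp add: a_def mult.commute)
    moreover have "a * real \<tau> \<le> 1"
      using mult_right_mono[of a D "real \<tau>"] False a by (simp add: a_def mult.commute)
    moreover have "a * (real \<tau> * D / a) \<le> 1"
      using a by (simp add: a_def)
    ultimately have "a * max 2 (max (real \<tau>) (real \<tau> * D / a)) \<le> 1"
      by (simp add: max_def)
    then have "a * (real_of_int p - 1) \<le> 1"
      using mult_left_mono[OF p_le, of a] a by linarith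
    moreover have max: "max 0 (1 - real (Suc \<tau>) * D) = 0"
      using False by (simp add: a_def algebra_simps)
    moreover have \<nu>': "\<nu> = a / 2" "real \<tau> * D = 1 - a"
      using False \<nu> by (simp_all add: a_def)
    ultimately show ?thesis
      unfolding max \<nu>' by (simp add: field_simps)
  qed
qed

theorem theorem2p1:
  fixes M :: "'a measure"
    and \<eta> :: "nat \<Rightarrow> 'a \<Rightarrow> real"
    and G F L :: "real \<Rightarrow> real"
    and \<gamma> :: "nat \<Rightarrow> real"
    and U :: "nat \<Rightarrow> 'a \<Rightarrow> real"
    and D \<nu> :: real
    and \<tau> :: nat
    and p :: int
  assumes prob: "prob_space M"
    and gauss: "gaussian_sequence M \<eta>"
    and stat: "stationary_sequence M \<eta>"
    and mean: "integral\<^sup>L M (\<eta> 1) = 0"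
    and var: "(\<integral>\<omega>. (\<eta> 1 \<omega>)\<^sup>2 \<partial>M) = 1"
    and cov: "\<And>k. \<gamma> k = (\<integral>\<omega>. \<eta> 1 \<omega> * \<eta> (k + 1) \<omega> \<partial>M)"
    and cov_pos: "\<And>k. 0 < \<gamma> k"
    and slow: "slowly_varying L"
    and cov_decay: "\<forall>\<^sub>F k in sequentially. \<gamma> k = real k powr (- D) * L (real k)"
    and G_meas: "G \<in> borel_measurable borel"
    and F: "F = cdf (distr M borel (\<lambda>\<omega>. G (\<eta> 1 \<omega>)))"
    and F_cont: "continuous_on UNIV F"
    and rank: "is_hermite_rank F G \<tau>"
    and D: "0 < D" "D < 1 / real \<tau>"
    and U: "\<And>i \<omega>. U i \<omega> = F (G (\<eta> i \<omega>))"
    and p: "is_smallest {q :: int.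
        Max {2, real \<tau>, real \<tau> * D / (1 - real \<tau> * D)} < real_of_int q \<and>
        real_of_int q \<le> max ((4 - real \<tau> * D) / D) ((4 - real \<tau> * D) / (1 - real \<tau> * D))} p"
    and \<nu>: "\<nu> = min D (1 - real \<tau> * D) / 2"
  shows "\<exists>\<epsilon>\<^sub>0>0. \<forall>\<epsilon>. 0 < \<epsilon> \<and> \<epsilon> < \<epsilon>\<^sub>0 \<longrightarrow>
    bigo_as M
      (\<lambda>n \<omega>. SUP t\<in>{0..1}. SUP y\<in>{0..1}. ereal
         \<bar>R_star D L \<tau> (\<lambda>i. U i \<omega>) n y t -
          (V_process (J_coeff F G \<tau>) (\<lambda>i. \<eta> i \<omega>) \<tau> y (npart n t) -
           V_process (J_coeff F G \<tau>) (\<lambda>i. \<eta> i \<omega>) \<tau>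
             (emp_quantile (\<lambda>i. U i \<omega>) (npart n t) y) (npart n t))\<bar>)
      (\<lambda>n. real n powr (1 - \<nu> * real_of_int p / 2 - real \<tau> * D / 4 + \<epsilon>) *
           L (real n) powr (real \<tau> / 2))"
proof (intro exI[of _ 1] conjI allI impI)
  fix \<epsilon> :: real assume "0 < \<epsilon> \<and> \<epsilon> < 1"
  then have \<epsilon>: "0 < \<epsilon>"
    by simp
  interpret prob_space M
    by (rule prob)
  interpret subordinated_gaussian M \<eta> \<gamma> G F \<tau>
    by unfold_locales (fact gauss stat mean var cov cov_pos G_meas F F_cont rank)+
  define \<theta> where "\<theta> = (1 + max 0 (1 - real (Suc \<tau>) * D)) / 2"
  define e where "e = 1 - \<nu> * real_of_int p / 2 - real \<tau> * D / 4"
  have \<theta>: "0 \<le> \<theta>" "\<theta> \<le> e"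
    using reduction_exponent_le[OF rank_ge_1 D p \<nu>] by (simp_all add: \<theta>_def e_def)
  have \<tau>: "real \<tau> > 0"
    using rank_ge_1 by simp
  \<comment> \<open>Half of \<open>\<epsilon>\<close> is left to the almost sure bound. The other
    half pays for the slowly varying factor: the bound
    \<open>n powr (- (\<epsilon> / \<tau>))\<close> for \<open>L n\<close>, raised to the power
    \<open>\<tau> / 2\<close>, is \<open>n powr (- \<epsilon> / 2)\<close>.\<close>
  have a_lower: "\<forall>\<^sub>F n::nat in sequentially. 1 \<le> n \<and> 0 < L (real n) \<and>
      real n powr (\<theta> + \<epsilon> / 2) \<le> real n powr (e + \<epsilon>) * L (real n) powr (real \<tau> / 2)"
  proof -
    have "0 < \<epsilon> / real \<tau>"
      using \<epsilon> \<tau> by simp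
    from eventually_compose_filterlim[OF slowly_varying_bounds[OF slow this] filterlim_real_sequentially]
    have "\<forall>\<^sub>F n::nat in sequentially. real n powr (- (\<epsilon> / real \<tau>)) \<le> L (real n)"
      by (rule eventually_mono) simp
    then show ?thesis
      using eventually_ge_at_top[of 1]
    proof eventually_elim
      case (elim n)
      have "0 < real n powr (- (\<epsilon> / real \<tau>))"
        using elim by simp
      with elim have "0 < L (real n)"
        by linarith
      have "real n powr (\<theta> + \<epsilon> / 2) \<le> real n powr (e + \<epsilon> - \<epsilon> / 2)"
        using elim \<theta> by (intro powr_mono) auto
      also have "\<dots> = real n powr (e + \<epsilon>) * (real n powr (- (\<epsilon> / real \<tau>))) powr (real \<tau> / 2)"
        using \<tau> by (simp add: powr_powr flip: powr_add)
      also have "\<dots> \<le> real n powr (e + \<epsilon>) * L (real n) powr (real \<tau> / 2)"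
        using elim by (intro mult_left_mono powr_mono2) auto
      finally show ?case
        using elim \<open>0 < L (real n)\<close> by simp
    qed
  qed
  have "AE \<omega> in M. \<exists>C. \<forall>n\<ge>1. \<forall>m\<le>n. \<forall>y\<in>{0..1}. \<bar>err y m \<omega>\<bar> \<le> C * real n powr (\<theta> + \<epsilon> / 2)"
    unfolding \<theta>_def using \<epsilon> by (intro AE_err_bound[OF slow cov_decay]) simp
  then show "bigo_as M
      (\<lambda>n \<omega>. SUP t\<in>{0..1}. SUP y\<in>{0..1}. ereal
         \<bar>R_star D L \<tau> (\<lambda>i. U i \<omega>) n y t -
          (V_process (J_coeff F G \<tau>) (\<lambda>i. \<eta> i \<omega>) \<tau> y (npart n t) -
           V_process (J_coeff F G \<tau>) (\<lambda>i. \<eta> i \<omega>) \<tau>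
             (emp_quantile (\<lambda>i. U i \<omega>) (npart n t) y) (npart n t))\<bar>)
      (\<lambda>n. real n powr (1 - \<nu> * real_of_int p / 2 - real \<tau> * D / 4 + \<epsilon>) *
           L (real n) powr (real \<tau> / 2))"
    unfolding bigo_as_def e_def[symmetric]
  proof eventually_elim
    case (elim \<omega>)
    then obtain C where C: "\<And>n m y. n \<ge> 1 \<Longrightarrow> m \<le> n \<Longrightarrow> y \<in> {0..1} \<Longrightarrow> \<bar>err y m \<omega>\<bar> \<le> C * real n powr (\<theta> + \<epsilon> / 2)"
      by blast
    let ?T = "\<lambda>n t y. \<bar>R_star D L \<tau> (\<lambda>i. U i \<omega>) n y t -
          (V_process (J_coeff F G \<tau>) (\<lambda>i. \<eta> i \<omega>) \<tau> y (npart n t) -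
           V_process (J_coeff F G \<tau>) (\<lambda>i. \<eta> i \<omega>) \<tau>
             (emp_quantile (\<lambda>i. U i \<omega>) (npart n t) y) (npart n t))\<bar>"
    let ?A = "\<lambda>n. SUP t\<in>{0..1}. SUP y\<in>{0..1}. ereal (?T n t y)"
    let ?a = "\<lambda>n. real n powr (e + \<epsilon>) * L (real n) powr (real \<tau> / 2)"
    have "\<forall>\<^sub>F n in sequentially. \<bar>?A n\<bar> / ereal (?a n) \<le> ereal (4 * \<bar>C\<bar> + 1)"
      using a_lower
    proof eventually_elim
      case (elim n)
      let ?B = "\<bar>C\<bar> * real n powr (\<theta> + \<epsilon> / 2)"
      have a: "0 < ?a n"
        using elim by simp
      have "0 < real n powr (2 - real \<tau> * D) * L (real n) ^ \<tau>"
        using elim by simp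
      then have norming: "norming D L \<tau> n \<noteq> 0"
        unfolding norming_def by (metis less_irrefl real_sqrt_gt_zero)
      have err_B: "\<bar>err y m \<omega>\<bar> \<le> ?B" if "m \<le> n" "y \<in> {0..1}" for m y
      proof -
        have "\<bar>err y m \<omega>\<bar> \<le> C * real n powr (\<theta> + \<epsilon> / 2)"
          using C that elim by blast
        also have "\<dots> \<le> ?B"
          by (intro mult_right_mono) auto
        finally show ?thesis .
      qed
      have T: "?T n t y \<le> (4 * \<bar>C\<bar> + 1) * ?a n" if "t \<in> {0..1}" "y \<in> {0..1}" for t y
      proof -
        have "?T n t y \<le> 4 * ?B + 1"
          unfolding U by (rule R_star_bound[OF norming that err_B])
        \<comment> \<open>The additive 1 of \<open>R_star_bound\<close> is absorbed by a power with
          nonnegative exponent.\<close>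
        also have "1 \<le> real n powr (\<theta> + \<epsilon> / 2)"
          using elim \<theta> \<epsilon> by (intro ge_one_powr_ge_zero) auto
        also have "4 * ?B + real n powr (\<theta> + \<epsilon> / 2) = (4 * \<bar>C\<bar> + 1) * real n powr (\<theta> + \<epsilon> / 2)"
          by (simp add: algebra_simps)
        also have "\<dots> \<le> (4 * \<bar>C\<bar> + 1) * ?a n"
          using elim by (intro mult_left_mono) auto
        finally show ?thesis
          by simp
      qed
      have upper: "?A n \<le> ereal ((4 * \<bar>C\<bar> + 1) * ?a n)"
        using T by (intro SUP_least) simp
      have lower: "0 \<le> ?A n"
        by (intro SUP_upper2[of 0]) auto
      \<comment> \<open>The supremum is an extended real; its two bounds make it finite before the
        division by the rate.\<close>
      obtain r where r: "?A n = ereal r"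
        using upper lower by (cases "?A n") auto
      have "0 \<le> r" "r \<le> (4 * \<bar>C\<bar> + 1) * ?a n"
        using upper lower unfolding r by simp_all
      moreover have "\<bar>ereal r\<bar> / ereal x \<le> ereal K" if "0 \<le> r" "r \<le> K * x" "0 < x" for K x
        using that by (simp add: pos_divide_le_eq)
      ultimately show ?case
        unfolding r using a by blast
    qed
    then have "limsup (\<lambda>n. \<bar>?A n\<bar> / ereal (?a n)) \<le> ereal (4 * \<bar>C\<bar> + 1)"
      by (rule Limsup_bounded)
    also have "\<dots> < \<infinity>"
      by simp
    finally show ?case .
  qed
qed simp

end
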